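(* Let $s\ge 0$ be a real number, let $q\ge 3$ be an integer, and let $\omega=(\omega(n))_{n\in\mathbb{Z}}$ be a weight such that $$\omega(n)=(1+n)^{s}\quad\text{for all } n\ge 0,$$ $$\omega(-n)\ge c\,(1+n)^{s}\quad\text{for all } n\ge 0,\ \text{ for some constant } c>0,$$ and $$\omega(-n)=O\big(e^{n^{\beta}}\big),\quad n\to+\infty,\ \text{ for some constant } \beta<b(1/q).$$ Then $E_{1/q}$ satisfies spectral synthesis in $A_{\omega}(\mathbb{T})$, that is, $J_\omega(E_{1/q})=I_\omega(E_{1/q})$.
   Context: $\mathbb{T}$ is the unit circle in $\mathbb{C}$ and $\mathcal{C}(\mathbb{T})$ is the space of continuous complex functions on $\mathbb{T}$. For $\xi\in(0,1/2)$, $$E_{\xi}=\Big\{\exp\Big(2i\pi(1-\xi)\sum_{n=1}^{+\infty}\epsilon_n\xi^{n-1}\Big):\ \epsilon_n\in\{0,1\}\ (n\ge 1)\Big\}\subset\mathbb{T},\qquad b(\xi)=\frac{\log\frac1\xi-\log 2}{2\log\frac1\xi-\log 2}.$$ A weight is a real sequence $\omega=(\omega(n))_{n\in\mathbb{Z}}$ with $\omega(n)\ge1$ and $\omega(n+m)\le\omega(n)\omega(m)$ for all $m,n\in\mathbb{Z}$. The associated Beurling algebra is $$A_\omega(\mathbb{T})=\Big\{f\in\mathcal{C}(\mathbb{T}):\ \|f\|_\omega=\sum_{n=-\infty}^{+\infty}|\widehat f(n)|\,\omega(n)<+\infty\Big\},$$ where $\widehat f(n)$ is the $n$-th Fourier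 coefficient of $f$. For a closed set $E\subset\mathbb{T}$, $I_\omega(E)=\{f\in A_\omega(\mathbb{T}): f=0\text{ on }E\}$, and $J_\omega(E)$ is the closure in $(A_\omega(\mathbb{T}),\|\cdot\|_\omega)$ of the set of $f\in A_\omega(\mathbb{T})$ that vanish on a neighborhood of $E$. The set $E$ satisfies spectral synthesis in $A_\omega(\mathbb{T})$ if $J_\omega(E)=I_\omega(E)$. *)

theory Defs
  imports "HOL-Analysis.Analysis" "HOL-Library.Landau_Symbols"
begin

abbreviation unit_circle :: "complex set" where
  "unit_circle \<equiv> sphere 0 1"

definition fourier_coeff :: "(complex \<Rightarrow> complex) \<Rightarrow> int \<Rightarrow> complex" where
  "fourier_coeff f n =
     integral {0..2 * pi} (\<lambda>t. f (cis t) * cis (- (of_int n * t))) / of_real (2 * pi)"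

definition is_weight :: "(int \<Rightarrow> real) \<Rightarrow> bool" where
  "is_weight \<omega> \<longleftrightarrow> (\<forall>n. 1 \<le> \<omega> n) \<and> (\<forall>m n. \<omega> (n + m) \<le> \<omega> n * \<omega> m)"

text \<open>Functions on the circle are represented by functions on the whole plane. No notion below
  looks at their values off the circle, so each of the sets of functions defined here is closed
  under changing a member off the circle.\<close>

definition beurling_algebra :: "(int \<Rightarrow> real) \<Rightarrow> (complex \<Rightarrow> complex) set" where
  "beurling_algebra \<omega> =
     {f. continuous_on unit_circle f \<and> (\<lambda>n. norm (fourier_coeff f n) * \<omega> n) summable_on UNIV}"

text \<open>The sum is meaningful for members of the algebra only: \<^const>\<open>infsum\<close> is 0 on a
  family that is not summable.\<close>

definition beurling_norm :: "(int \<Rightarrow> real) \<Rightarrow> (complex \<Rightarrow> complex) \<Rightarrow> real" where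
  "beurling_norm \<omega> f = (\<Sum>\<^sub>\<infinity>n\<in>UNIV. norm (fourier_coeff f n) * \<omega> n)"

definition ideal_I :: "(int \<Rightarrow> real) \<Rightarrow> complex set \<Rightarrow> (complex \<Rightarrow> complex) set" where
  "ideal_I \<omega> E = {f \<in> beurling_algebra \<omega>. \<forall>z\<in>E. f z = 0}"

definition vanishing_near :: "(int \<Rightarrow> real) \<Rightarrow> complex set \<Rightarrow> (complex \<Rightarrow> complex) set" where
  "vanishing_near \<omega> E =
     {f \<in> beurling_algebra \<omega>.
        \<exists>U. openin (top_of_set unit_circle) U \<and> E \<subseteq> U \<and> (\<forall>z\<in>U. f z = 0)}"

definition ideal_J :: "(int \<Rightarrow> real) \<Rightarrow> complex set \<Rightarrow> (complex \<Rightarrow> complex) set" where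
  "ideal_J \<omega> E =
     {f \<in> beurling_algebra \<omega>.
        \<forall>\<epsilon>>0. \<exists>g\<in>vanishing_near \<omega> E. beurling_norm \<omega> (\<lambda>z. f z - g z) < \<epsilon>}"

text \<open>Intended for closed subsets \<open>E\<close> of the circle.\<close>

definition spectral_synthesis :: "(int \<Rightarrow> real) \<Rightarrow> complex set \<Rightarrow> bool" where
  "spectral_synthesis \<omega> E \<longleftrightarrow> ideal_J \<omega> E = ideal_I \<omega> E"

text \<open>The digits are numbered from 1, as in \<open>\<Sum>n\<ge>1. \<epsilon> n * \<xi> ^ (n - 1)\<close>; the value
  \<open>\<epsilon> 0\<close> is irrelevant.\<close>

definition cantor_set :: "real \<Rightarrow> complex set" where
  "cantor_set \<xi> =
     {exp (2 * \<i> * of_real pi * of_real (1 - \<xi>) * of_real (\<Sum>n. \<epsilon> (Suc n) * \<xi> ^ n)) | \<epsilon>.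
        \<forall>n\<ge>1. \<epsilon> n \<in> {0, 1}}"

definition cantor_b :: "real \<Rightarrow> real" where
  "cantor_b \<xi> = (ln (1 / \<xi>) - ln 2) / (2 * ln (1 / \<xi>) - ln 2)"

end

theory Submission
  imports Defs "HOL-Complex_Analysis.Complex_Analysis" "HOL-Real_Asymp.Real_Asymp"
begin

text \<open>
Let \<open>\<pi>\<close> be the quotient map of the Beurling algebra by \<open>J\<close>, the closure of the functions that vanish near the
Cantor set \<open>E\<close>. The proof first bounds the norm of \<open>\<pi> (z ^ n)\<close> by a multiple of \<open>(1 + \<bar>n\<bar>) ^ s\<close> for negative
\<open>n\<close> too, although the weight may be almost as large as \<open>exp (\<bar>n\<bar> ^ b)\<close> there. For this put poles at
\<open>(1 + q ^ (- k)) e\<close>, where \<open>e\<close> runs over the endpoints of the intervals of \<open>E\<close> of length \<open>q ^ (- k)\<close>, \<open>k \<le> K\<close>, let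
\<open>U\<close> be the sum of the functions \<open>1 / (1 + q ^ (- k) - z / e)\<close> with the weights \<open>q ^ (- (1 - a) k)\<close>, and put
\<open>F = exp (- U)\<close>. Uniformly in \<open>K\<close>, \<open>F\<close> has bounded norm for the weight \<open>(1 + n) ^ s\<close> and \<open>F 0\<close> is bounded away
from \<open>0\<close>, while \<open>\<bar>F\<bar>\<close> is at most \<open>exp (- c q ^ (a K))\<close> near \<open>E\<close>, so that \<open>\<pi> F\<close> tends to \<open>0\<close>. Since
\<open>(1 - F / F 0) / z\<close> has only nonnegative powers of \<open>z\<close>, this bounds \<open>\<pi> (1 / z)\<close>, and because \<open>z ^ (q ^ k)\<close> maps \<open>E\<close>
into itself the same argument with \<open>z ^ (q ^ k)\<close> in place of \<open>z\<close> bounds \<open>\<pi> (z ^ (- n))\<close> for \<open>n \<le> q ^ k\<close>.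

It remains to approximate a function \<open>f\<close> that vanishes on \<open>E\<close> in the norm with weight \<open>(1 + \<bar>n\<bar>) ^ s\<close>, by functions
of the algebra that vanish near \<open>E\<close>. This is Herz's argument: near every \<open>q ^ k\<close>-th root of unity replace \<open>f\<close> by
its Taylor polynomial there, of degree the integer part of \<open>s\<close>. Since \<open>E\<close> is perfect, the Taylor polynomials at
points of \<open>E\<close> vanish, and every point of \<open>E\<close> has distance at most \<open>1 / q\<close> of the mesh from a root of unity in \<open>E\<close>.
\<close>

text \<open>The obstacle is the size of \<open>\<omega>\<close> at negative frequencies, which makes
  any cutoff near \<open>E\<close> very expensive. \<open>F K\<close> pays for it. With
  \<open>Q = q ^ K\<close>, the product of \<open>F K\<close> and a cutoff at scale
  \<open>1 / Q\<close> has norm at most about \<open>exp (C Q ^ a')\<close> for the larger weight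
  \<open>exp_weight \<gamma>\<close>, but supremum at most a multiple of
  \<open>exp (- c Q ^ a)\<close>. As \<open>a' < a\<close>, the geometric mean of the two bounds
  tends to \<open>0\<close>, and it controls the norm for \<open>\<omega>\<close> because
  \<open>\<beta> < \<gamma>\<close>. The upper limit for \<open>a\<close> comes from counting: level
  \<open>k\<close> has at most \<open>2 ^ (k + 1)\<close> poles of weight
  \<open>q ^ (- (1 - a) k)\<close>, with bounded total when \<open>a < d = 1 - ln 2 / ln q\<close>,
  one minus the dimension of \<open>E\<close>. The lower limit comes from the cost of
  \<open>F K\<close> and of the cutoff, which needs \<open>\<gamma> / (1 - \<gamma>) < a'\<close>.
  Both limits meet at \<open>\<gamma> = d / (1 + d)\<close>, which is
  \<open>cantor_b (1 / q)\<close>. Every level up to \<open>K\<close> carries poles so that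
  \<open>F K\<close> is damped at every scale of distance from \<open>E\<close>; this is what bounds
  its derivatives uniformly in \<open>K\<close>.\<close>

section \<open>Absolutely convergent weighted Fourier series\<close>

text \<open>Bounding the norm by \<open>B\<close> with an unspecified family \<open>c\<close> keeps
  integrals out of the algebra. That \<open>c\<close> must be \<open>fourier_coeff f\<close> is
  shown later and ties the predicate to \<open>beurling_algebra\<close>.\<close>

definition wiener :: "(int \<Rightarrow> real) \<Rightarrow> (complex \<Rightarrow> complex) \<Rightarrow> real \<Rightarrow> bool" where
  "wiener w f B \<longleftrightarrow> (\<exists>c. (\<lambda>n. norm (c n) * w n) summable_on UNIV \<and>
     (\<Sum>\<^sub>\<infinity>n. norm (c n) * w n) \<le> B \<and>
     (\<forall>z\<in>unit_circle. ((\<lambda>n. c n * z powi n) has_sum f z) UNIV))"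

lemma is_weight_ge1: "is_weight w \<Longrightarrow> 1 \<le> w n"
  by (simp add: is_weight_def)

lemma is_weight_mult: "is_weight w \<Longrightarrow> w (m + n) \<le> w m * w n"
  unfolding is_weight_def by (metis add.commute mult.commute)

lemma is_weight_pos: "is_weight w \<Longrightarrow> 0 < w n"
  using is_weight_ge1[of w n] by linarith

lemma norm_powi_unit: "z \<in> unit_circle \<Longrightarrow> norm (z powi n) = 1"
  by (simp add: norm_power_int)

lemma weighted_abs_summable:
  assumes "is_weight w" and "(\<lambda>j. norm (a j) * w (k j)) summable_on J"
  shows "(\<lambda>j. norm (a j)) summable_on J"
  using assms(2)
  by (rule summable_on_comparison_test)
     (use is_weight_ge1[OF assms(1)] mult_left_mono[of 1 _ "norm _"] in auto)

text \<open>Frequencies \<open>k j\<close> may repeat and come in any order: terms of equal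
  frequency are merged, which by the triangle inequality does not increase the norm.\<close>

lemma wienerI:
  assumes w: "is_weight w"
    and s: "(\<lambda>j. norm (a j) * w (k j)) summable_on J"
    and B: "(\<Sum>\<^sub>\<infinity>j\<in>J. norm (a j) * w (k j)) \<le> B"
    and f: "\<And>z. z \<in> unit_circle \<Longrightarrow> ((\<lambda>j. a j * z powi k j) has_sum f z) J"
  shows "wiener w f B"
proof -
  \<comment> \<open>The fibres of \<open>k\<close> partition \<open>J\<close>, so a sum over
    \<open>J\<close> becomes a double sum over frequencies and fibres.\<close>
  define Jn where "Jn n = {j\<in>J. k j = n}" for n
  have bij: "bij_betw snd (Sigma UNIV Jn) J"
    by (rule bij_betwI[of _ _ _ "\<lambda>j. (k j, j)"]) (auto simp: Jn_def)
  define c where "c n = (\<Sum>\<^sub>\<infinity>j\<in>Jn n. a j)" for n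
  have na: "(\<lambda>j. norm (a j)) summable_on J"
    by (rule weighted_abs_summable[OF w s])
  have na': "(\<lambda>j. norm (a j)) summable_on Jn n" for n
    by (rule summable_on_subset_banach[OF na]) (auto simp: Jn_def)
  have sa: "a summable_on Jn n" for n
    using na' by (rule abs_summable_summable)
  have w0: "w n \<ge> 0" for n using is_weight_pos[OF w, of n] by simp
  have wS: "((\<lambda>x. norm (a (snd x)) * w (k (snd x))) has_sum (\<Sum>\<^sub>\<infinity>j\<in>J. norm (a j) * w (k j))) (Sigma UNIV Jn)"
    using has_sum_reindex_bij_betw[OF bij, of "\<lambda>j. norm (a j) * w (k j)"] s by simp
  define d where "d n = (\<Sum>\<^sub>\<infinity>j\<in>Jn n. norm (a j)) * w n" for n
  have dn: "((\<lambda>j. norm (a j) * w (k j)) has_sum d n) (Jn n)" for n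
  proof -
    have "((\<lambda>j. norm (a j) * w n) has_sum d n) (Jn n)"
      unfolding d_def by (intro has_sum_cmult_left has_sum_infsum na')
    then show ?thesis by (rule has_sum_cong[THEN iffD1, rotated]) (auto simp: Jn_def)
  qed
  have D: "(d has_sum (\<Sum>\<^sub>\<infinity>j\<in>J. norm (a j) * w (k j))) UNIV"
    by (rule has_sum_Sigma'[OF wS]) (use dn in simp)
  have cd: "norm (c n) * w n \<le> d n" for n
    unfolding c_def d_def by (intro mult_right_mono norm_infsum_bound na' w0)
  have cs: "(\<lambda>n. norm (c n) * w n) summable_on UNIV"
    by (rule summable_on_comparison_test[OF has_sum_imp_summable[OF D]]) (use cd w0 in auto)
  have cB: "(\<Sum>\<^sub>\<infinity>n. norm (c n) * w n) \<le> B"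
  proof -
    have "(\<Sum>\<^sub>\<infinity>n. norm (c n) * w n) \<le> (\<Sum>\<^sub>\<infinity>n. d n)"
      by (rule infsum_mono[OF cs has_sum_imp_summable[OF D]]) (rule cd)
    also have "\<dots> \<le> B" using infsumI[OF D] B by simp
    finally show ?thesis .
  qed
  have "((\<lambda>n. c n * z powi n) has_sum f z) UNIV" if z: "z \<in> unit_circle" for z
  proof -
    have "((\<lambda>x. a (snd x) * z powi (k (snd x))) has_sum f z) (Sigma UNIV Jn)"
      using has_sum_reindex_bij_betw[OF bij, of "\<lambda>j. a j * z powi k j"] f[OF z] by simp
    then show ?thesis
    proof (rule has_sum_Sigma')
      fix n
      have "((\<lambda>j. a j * z powi n) has_sum c n * z powi n) (Jn n)"
        unfolding c_def by (intro has_sum_cmult_left has_sum_infsum sa)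
      then show "((\<lambda>y. a (snd (n, y)) * z powi k (snd (n, y))) has_sum c n * z powi n) (Jn n)"
        by (rule has_sum_cong[THEN iffD1, rotated]) (auto simp: Jn_def)
    qed
  qed
  with cs cB show ?thesis unfolding wiener_def by blast
qed

text \<open>Completeness of the algebra: the coefficients of all \<open>f i\<close> form one family
  over \<open>I \<times> UNIV\<close> whose weighted sum is at most the sum of the bounds, and
  \<open>wienerI\<close> regroups it by frequency.\<close>

lemma wiener_infsum:
  assumes w: "is_weight w"
    and f: "\<And>i. i \<in> I \<Longrightarrow> wiener w (f i) (B i)"
    and B: "(B has_sum B') I"
    and g: "\<And>z. z \<in> unit_circle \<Longrightarrow> ((\<lambda>i. f i z) has_sum g z) I"
  shows "wiener w g B'"
proof -
  have w0: "w n \<ge> 0" for n using is_weight_pos[OF w, of n] by simp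
  obtain c where c: "\<And>i. i \<in> I \<Longrightarrow> (\<lambda>n. norm (c i n) * w n) summable_on UNIV \<and>
     (\<Sum>\<^sub>\<infinity>n. norm (c i n) * w n) \<le> B i \<and>
     (\<forall>z\<in>unit_circle. ((\<lambda>n. c i n * z powi n) has_sum f i z) UNIV)"
    using f unfolding wiener_def by metis
  define b where "b i = (\<Sum>\<^sub>\<infinity>n. norm (c i n) * w n)" for i
  have b0: "b i \<ge> 0" for i unfolding b_def by (intro infsum_nonneg) (use w0 in auto)
  have bs: "b summable_on I"
    by (rule summable_on_comparison_test[OF has_sum_imp_summable[OF B]]) (use c b0 in \<open>auto simp: b_def\<close>)
  have bi: "((\<lambda>n. norm (c i n) * w n) has_sum b i) UNIV" if "i \<in> I" for i
    unfolding b_def by (intro has_sum_infsum) (use c that in auto)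
  have S: "(\<lambda>x. norm (c (fst x) (snd x)) * w (snd x)) summable_on I \<times> UNIV"
    by (rule summable_on_SigmaI[OF _ bs]) (use bi w0 in auto)
  have "(b has_sum (\<Sum>\<^sub>\<infinity>x\<in>I \<times> UNIV. norm (c (fst x) (snd x)) * w (snd x))) I"
    by (rule has_sum_Sigma'[OF has_sum_infsum[OF S]]) (use bi in simp)
  then have le: "(\<Sum>\<^sub>\<infinity>x\<in>I \<times> UNIV. norm (c (fst x) (snd x)) * w (snd x)) \<le> B'"
    using B by (rule has_sum_mono) (use c in \<open>auto simp: b_def\<close>)
  show ?thesis
  proof (rule wienerI[OF w S le])
    fix z :: complex assume z: "z \<in> unit_circle"
    have "(\<lambda>x. norm (c (fst x) (snd x))) summable_on I \<times> UNIV"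
      by (rule weighted_abs_summable[OF w S])
    then have "(\<lambda>x. norm (c (fst x) (snd x) * z powi snd x)) summable_on I \<times> UNIV"
      using norm_powi_unit[OF z] by (simp add: norm_mult)
    then have "(\<lambda>x. c (fst x) (snd x) * z powi snd x) summable_on I \<times> UNIV"
      by (rule abs_summable_summable)
    then show "((\<lambda>x. c (fst x) (snd x) * z powi snd x) has_sum g z) (I \<times> UNIV)"
      by (intro has_sum_SigmaI[OF _ g[OF z]]) (use c z in auto)
  qed
qed

lemma wiener_mono: "wiener w f B \<Longrightarrow> B \<le> B' \<Longrightarrow> wiener w f B'"
  unfolding wiener_def by (meson order_trans)

lemma wiener_cong:
  "wiener w f B \<Longrightarrow> (\<And>z. z \<in> unit_circle \<Longrightarrow> f z = g z) \<Longrightarrow> wiener w g B"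
  unfolding wiener_def by (elim exE) (rule exI, auto)

lemma wiener_monom:
  assumes "is_weight w" "norm a * w n \<le> B"
  shows "wiener w (\<lambda>z. a * z powi n) B"
proof (rule wienerI[where J = "{()}" and a = "\<lambda>_. a" and k = "\<lambda>_. n", OF assms(1)])
  show "((\<lambda>j. a * z powi n) has_sum a * z powi n) {()}" for z
    using has_sum_finite[of "{()}" "\<lambda>j. a * z powi n"] by simp
qed (use assms in auto)

lemma wiener_const: "is_weight w \<Longrightarrow> norm a * w 0 \<le> B \<Longrightarrow> wiener w (\<lambda>z. a) B"
  using wiener_monom[of w a 0 B] by simp

lemma wiener_nonneg: "is_weight w \<Longrightarrow> wiener w f B \<Longrightarrow> 0 \<le> B"
  unfolding wiener_def
  by (metis (no_types, lifting) infsum_nonneg is_weight_pos less_eq_real_def mult_nonneg_nonneg norm_ge_zero order_trans)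

lemma wiener_sum:
  assumes "is_weight w" "finite I" "\<And>i. i \<in> I \<Longrightarrow> wiener w (f i) (B i)"
  shows "wiener w (\<lambda>z. \<Sum>i\<in>I. f i z) (\<Sum>i\<in>I. B i)"
  by (rule wiener_infsum[where f = f and B = B and I = I])
     (use assms has_sum_finite[OF assms(2)] in auto)

lemma wiener_add:
  assumes w: "is_weight w" and f: "wiener w f B" and g: "wiener w g C"
  shows "wiener w (\<lambda>z. f z + g z) (B + C)"
proof -
  have "wiener w (\<lambda>z. \<Sum>i\<in>{True,False}. (if i then f else g) z) (\<Sum>i\<in>{True,False}. (if i then B else C))"
    by (rule wiener_sum[OF w]) (use f g in auto)
  then show ?thesis by simp
qed

lemma wiener_cmult:
  assumes w: "is_weight w" and f: "wiener w f B"
  shows "wiener w (\<lambda>z. a * f z) (norm a * B)"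
proof -
  obtain c where c: "(\<lambda>n. norm (c n) * w n) summable_on UNIV" "(\<Sum>\<^sub>\<infinity>n. norm (c n) * w n) \<le> B"
     "\<forall>z\<in>unit_circle. ((\<lambda>n. c n * z powi n) has_sum f z) UNIV"
    using f unfolding wiener_def by blast
  show ?thesis
  proof (rule wienerI[OF w, where J = UNIV and k = "\<lambda>n. n" and a = "\<lambda>n. a * c n"])
    have "(\<lambda>n. norm a * (norm (c n) * w n)) summable_on UNIV"
      by (intro summable_on_cmult_right c)
    then show "(\<lambda>n. norm (a * c n) * w n) summable_on UNIV"
      by (simp add: norm_mult mult.assoc)
    have "(\<Sum>\<^sub>\<infinity>n. norm a * (norm (c n) * w n)) = norm a * (\<Sum>\<^sub>\<infinity>n. norm (c n) * w n)"
      by (intro infsum_cmult_right c)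
    also have "\<dots> \<le> norm a * B" by (intro mult_left_mono c) auto
    finally show "(\<Sum>\<^sub>\<infinity>n. norm (a * c n) * w n) \<le> norm a * B"
      by (simp add: norm_mult mult.assoc)
    fix z :: complex assume "z \<in> unit_circle"
    then have "((\<lambda>n. a * (c n * z powi n)) has_sum a * f z) UNIV"
      by (intro has_sum_cmult_right) (use c in blast)
    then show "((\<lambda>n. a * c n * z powi n) has_sum a * f z) UNIV"
      by (simp add: mult.assoc)
  qed
qed

lemma wiener_uminus: "is_weight w \<Longrightarrow> wiener w f B \<Longrightarrow> wiener w (\<lambda>z. - f z) B"
  using wiener_cmult[of w f B "-1"] by simp

lemma wiener_diff:
  "is_weight w \<Longrightarrow> wiener w f B \<Longrightarrow> wiener w g C \<Longrightarrow> wiener w (\<lambda>z. f z - g z) (B + C)"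
  using wiener_add[of w f B "\<lambda>z. - g z" C] wiener_uminus[of w g C] by simp

text \<open>Dilation to the scale of the \<open>N\<close>-th roots of unity. Frequency
  \<open>n\<close> moves to \<open>r + n * N\<close>, so only the comparison of the two weights
  along this progression matters.\<close>

lemma wiener_subst:
  assumes w: "is_weight w" and w': "is_weight w'" and f: "wiener w' f B"
    and C: "\<And>n. w (r + n * N) \<le> C * w' n"
  shows "wiener w (\<lambda>z. z powi r * f (z powi N)) (C * B)"
proof -
  obtain c where c: "(\<lambda>n. norm (c n) * w' n) summable_on UNIV" "(\<Sum>\<^sub>\<infinity>n. norm (c n) * w' n) \<le> B"
     "\<forall>z\<in>unit_circle. ((\<lambda>n. c n * z powi n) has_sum f z) UNIV"
    using f unfolding wiener_def by blast
  have w0: "w n \<ge> 0" for n using is_weight_pos[OF w, of n] by simp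
  have le: "norm (c n) * w (r + n * N) \<le> C * (norm (c n) * w' n)" for n
    using mult_left_mono[OF C[of n], of "norm (c n)"] by (simp add: mult_ac)
  have S: "(\<lambda>n. C * (norm (c n) * w' n)) summable_on UNIV"
    by (intro summable_on_cmult_right c)
  have S': "(\<lambda>n. norm (c n) * w (r + n * N)) summable_on UNIV"
    by (rule summable_on_comparison_test[OF S]) (use le w0 in auto)
  have "0 < C * w' 0" using C[of 0] is_weight_pos[OF w, of r] by simp
  have C0: "C \<ge> 0"
    using C[of 0] is_weight_pos[OF w, of r] is_weight_pos[OF w', of 0]
    by (smt (verit) mult_nonpos_nonneg mult.commute add.right_neutral mult_zero_left)
  show ?thesis
  proof (rule wienerI[OF w S'])
    have "(\<Sum>\<^sub>\<infinity>n. norm (c n) * w (r + n * N)) \<le> (\<Sum>\<^sub>\<infinity>n. C * (norm (c n) * w' n))"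
      by (rule infsum_mono[OF S' S]) (rule le)
    also have "\<dots> = C * (\<Sum>\<^sub>\<infinity>n. norm (c n) * w' n)"
      by (intro infsum_cmult_right c)
    also have "\<dots> \<le> C * B" by (intro mult_left_mono c C0)
    finally show "(\<Sum>\<^sub>\<infinity>n. norm (c n) * w (r + n * N)) \<le> C * B" .
    fix z :: complex assume z: "z \<in> unit_circle"
    then have z': "z powi N \<in> unit_circle" by (simp add: norm_power_int)
    have nz: "z \<noteq> 0" using z by auto
    have "((\<lambda>n. z powi r * (c n * (z powi N) powi n)) has_sum z powi r * f (z powi N)) UNIV"
      by (intro has_sum_cmult_right) (use c z' in blast)
    then show "((\<lambda>n. c n * z powi (r + n * N)) has_sum z powi r * f (z powi N)) UNIV"
      by (simp add: power_int_add nz mult_ac flip: power_int_mult)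
  qed
qed

lemma wiener_weight_mono:
  assumes w: "is_weight w" and w': "is_weight w'" and f: "wiener w' f B"
    and C: "\<And>n. w n \<le> C * w' n"
  shows "wiener w f (C * B)"
  using wiener_subst[OF w w' f, of 0 1 C] C by simp

lemma wiener_shift:
  assumes w: "is_weight w" and f: "wiener w f B"
  shows "wiener w (\<lambda>z. z powi k * f z) (w k * B)"
  using wiener_subst[OF w w f, of k 1 "w k"] is_weight_mult[OF w] by simp

lemma wiener_mult:
  assumes w: "is_weight w" and f: "wiener w f B" and g: "wiener w g C"
  shows "wiener w (\<lambda>z. f z * g z) (B * C)"
proof -
  obtain c where c: "(\<lambda>n. norm (c n) * w n) summable_on UNIV" "(\<Sum>\<^sub>\<infinity>n. norm (c n) * w n) \<le> B"
     "\<forall>z\<in>unit_circle. ((\<lambda>n. c n * z powi n) has_sum f z) UNIV"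
    using f unfolding wiener_def by blast
  have C0: "0 \<le> C" by (rule wiener_nonneg[OF w g])
  have "wiener w (\<lambda>z. f z * g z) ((\<Sum>\<^sub>\<infinity>n. norm (c n) * w n) * C)"
  proof (rule wiener_infsum[OF w, where I = UNIV])
    show "wiener w (\<lambda>z. c n * (z powi n * g z)) (norm (c n) * (w n * C))" for n
      by (intro wiener_cmult wiener_shift w g)
    have "((\<lambda>n. norm (c n) * w n * C) has_sum (\<Sum>\<^sub>\<infinity>n. norm (c n) * w n) * C) UNIV"
      by (intro has_sum_cmult_left has_sum_infsum c)
    then show "((\<lambda>n. norm (c n) * (w n * C)) has_sum (\<Sum>\<^sub>\<infinity>n. norm (c n) * w n) * C) UNIV"
      by (simp add: mult.assoc)
    fix z :: complex assume z: "z \<in> unit_circle"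
    have "((\<lambda>n. (c n * z powi n) * g z) has_sum f z * g z) UNIV"
      by (intro has_sum_cmult_left) (use c z in blast)
    then show "((\<lambda>n. c n * (z powi n * g z)) has_sum f z * g z) UNIV"
      by (simp add: mult.assoc)
  qed
  then show ?thesis
    by (rule wiener_mono) (intro mult_right_mono c C0)
qed

text \<open>The factor \<open>w 0\<close> is the norm of the constant \<open>1\<close>, needed for
  \<open>n = 0\<close> since a weight may exceed \<open>1\<close> there.\<close>

lemma wiener_power:
  assumes w: "is_weight w" and f: "wiener w f B"
  shows "wiener w (\<lambda>z. f z ^ n) (w 0 * B ^ n)"
proof (induction n)
  case 0
  show ?case using wiener_const[OF w, of 1] by simp
next
  case (Suc n)
  have "wiener w (\<lambda>z. f z * f z ^ n) (B * (w 0 * B ^ n))"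
    by (rule wiener_mult[OF w f Suc])
  then show ?case by (simp add: mult_ac)
qed

lemma has_sum_exp_series:
  fixes x :: "'a :: {real_normed_field, banach}"
  shows "((\<lambda>n. x ^ n / fact n) has_sum exp x) UNIV"
  using norm_summable_imp_has_sum[OF summable_norm_exp exp_converges, of x]
  by (simp add: scaleR_conv_of_real divide_inverse mult.commute)

text \<open>The Taylor coefficients of \<open>exp\<close> are positive, so the norm of the tail at
  \<open>f\<close> is dominated by the same tail at the number \<open>B\<close>.\<close>

lemma wiener_exp_remainder:
  assumes w: "is_weight w" and f: "wiener w f B"
  shows "wiener w (\<lambda>z. exp (f z) - (\<Sum>j<L. f z ^ j / fact j))
           (w 0 * (exp B - (\<Sum>j<L. B ^ j / fact j)))"
proof (rule wiener_infsum[OF w, where I = "{L..}"])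
  have B0: "B \<ge> 0" by (rule wiener_nonneg[OF w f])
  show "wiener w (\<lambda>z. inverse (fact n) * (f z) ^ n) (w 0 * (B ^ n / fact n))" for n :: nat
    using wiener_cmult[OF w wiener_power[OF w f, of n], of "inverse (fact n)"]
    by (simp add: norm_inverse divide_inverse mult_ac)
  have *: "((\<lambda>n. x ^ n / fact n) has_sum exp x - (\<Sum>j<L. x ^ j / fact j)) {L..}"
    for x :: "'a :: {real_normed_field, banach}"
  proof -
    have "((\<lambda>n. x ^ n / fact n) has_sum exp x - (\<Sum>j<L. x ^ j / fact j)) (UNIV - {..<L})"
      by (intro has_sum_Diff has_sum_exp_series has_sum_finite) auto
    moreover have "UNIV - {..<L} = {L..}" by auto
    ultimately show ?thesis by simp
  qed
  show "((\<lambda>n. w 0 * (B ^ n / fact n)) has_sum w 0 * (exp B - (\<Sum>j<L. B ^ j / fact j))) {L..}"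
    by (intro has_sum_cmult_right *)
  show "((\<lambda>n. inverse (fact n) * f z ^ n) has_sum exp (f z) - (\<Sum>j<L. f z ^ j / fact j)) {L..}" for z
    using *[of "f z"] by (simp add: divide_inverse mult.commute)
qed

lemma wiener_exp:
  assumes w: "is_weight w" and f: "wiener w f B"
  shows "wiener w (\<lambda>z. exp (f z)) (w 0 * exp B)"
  using wiener_exp_remainder[OF assms, of 0] by simp

lemma exp_remainder_nonneg_le:
  fixes x :: real
  assumes "x \<ge> 0"
  shows "exp x - (\<Sum>j<L. x ^ j / fact j) \<le> x ^ L * exp x"
proof -
  have sm: "(\<lambda>n. x ^ n / fact n) sums exp x"
    using exp_converges[of x] by (simp add: divide_inverse mult.commute)
  have 1: "(\<lambda>n. x ^ (n + L) / fact (n + L)) sums (exp x - (\<Sum>j<L. x ^ j / fact j))"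
    using sums_split_initial_segment[OF sm, of L] .
  have 2: "(\<lambda>n. x ^ L * (x ^ n / fact n)) sums (x ^ L * exp x)"
    by (rule sums_mult[OF sm])
  show ?thesis
    by (rule sums_le[OF _ 1 2])
       (use assms in \<open>auto simp: power_add mult.commute intro!: divide_left_mono mult_left_mono fact_mono\<close>)
qed

lemma wiener_rotate:
  assumes w: "is_weight w" and f: "wiener w f B" and u: "u \<in> unit_circle"
  shows "wiener w (\<lambda>z. f (u * z)) B"
proof -
  obtain c where c: "(\<lambda>n. norm (c n) * w n) summable_on UNIV" "(\<Sum>\<^sub>\<infinity>n. norm (c n) * w n) \<le> B"
     "\<forall>z\<in>unit_circle. ((\<lambda>n. c n * z powi n) has_sum f z) UNIV"
    using f unfolding wiener_def by blast
  have n: "norm (c n * u powi n) = norm (c n)" for n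
    using norm_powi_unit[OF u] by (simp add: norm_mult)
  show ?thesis
  proof (rule wienerI[OF w, where J = UNIV and a = "\<lambda>n. c n * u powi n" and k = "\<lambda>n. n"])
    fix z :: complex assume "z \<in> unit_circle"
    then have "u * z \<in> unit_circle" using u by (simp add: norm_mult)
    then have "((\<lambda>n. c n * (u * z) powi n) has_sum f (u * z)) UNIV" using c by blast
    then show "((\<lambda>n. c n * u powi n * z powi n) has_sum f (u * z)) UNIV"
      by (simp add: power_int_mult_distrib mult.assoc)
  qed (use c n in auto)
qed

lemma wiener_norm_le:
  assumes w: "is_weight w" and f: "wiener w f B" and z: "z \<in> unit_circle"
  shows "norm (f z) \<le> B"
proof -
  obtain c where c: "(\<lambda>n. norm (c n) * w n) summable_on UNIV" "(\<Sum>\<^sub>\<infinity>n. norm (c n) * w n) \<le> B"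
     "\<forall>z\<in>unit_circle. ((\<lambda>n. c n * z powi n) has_sum f z) UNIV"
    using f unfolding wiener_def by blast
  have s: "(\<lambda>n. norm (c n)) summable_on UNIV"
    by (rule weighted_abs_summable[OF w c(1)])
  then have s': "(\<lambda>n. norm (c n * z powi n)) summable_on UNIV"
    using norm_powi_unit[OF z] by (simp add: norm_mult)
  have "norm (f z) = norm (\<Sum>\<^sub>\<infinity>n. c n * z powi n)" using c z infsumI by metis
  also have "\<dots> \<le> (\<Sum>\<^sub>\<infinity>n. norm (c n * z powi n))" by (rule norm_infsum_bound[OF s'])
  also have "\<dots> = (\<Sum>\<^sub>\<infinity>n. norm (c n))" using norm_powi_unit[OF z] by (simp add: norm_mult)
  also have "\<dots> \<le> (\<Sum>\<^sub>\<infinity>n. norm (c n) * w n)"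
    by (rule infsum_mono[OF s c(1)]) (use is_weight_ge1[OF w] mult_left_mono[of 1 _ "norm _"] in auto)
  finally show ?thesis using c by simp
qed

lemma has_sum_powi_uniform_limit:
  assumes s: "(\<lambda>n. norm (c n)) summable_on UNIV"
    and f: "\<And>z. z \<in> unit_circle \<Longrightarrow> ((\<lambda>n. c n * z powi n) has_sum f z) UNIV"
  shows "uniform_limit unit_circle (\<lambda>X z. \<Sum>n\<in>X. c n * z powi n) f (finite_subsets_at_top UNIV)"
  by (rule Weierstrass_m_test_general'[OF _ f s]) (auto simp: norm_mult norm_power_int)

lemma wiener_continuous:
  assumes w: "is_weight w" and f: "wiener w f B"
  shows "continuous_on unit_circle f"
proof -
  obtain c where c: "(\<lambda>n. norm (c n) * w n) summable_on UNIV" 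
     "\<forall>z\<in>unit_circle. ((\<lambda>n. c n * z powi n) has_sum f z) UNIV"
    using f unfolding wiener_def by blast
  have s: "(\<lambda>n. norm (c n)) summable_on UNIV"
    by (rule weighted_abs_summable[OF w c(1)])
  show ?thesis
    by (rule uniform_limit_theorem[OF _ has_sum_powi_uniform_limit[OF s]])
       (use c(2) in \<open>auto intro!: always_eventually continuous_intros\<close>)
qed

section \<open>Uniqueness and the Beurling algebra\<close>

lemma is_weight_one: "is_weight (\<lambda>_. 1)"
  by (simp add: is_weight_def)

lemma continuous_on_circle_param:
  assumes "continuous_on unit_circle g"
  shows "continuous_on A (\<lambda>t. g (cis t))"
  by (rule continuous_on_compose2[OF assms]) (auto intro!: continuous_intros)

lemma integral_cis_int:
  "integral {0..2 * pi} (\<lambda>t. cis (of_int k * t)) = (if k = 0 then of_real (2 * pi) else 0)"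
proof (cases "k = 0")
  case False
  define H where "H w = exp (\<i> * of_int k * w) / (\<i> * of_int k)" for w :: complex
  have d: "(H has_field_derivative exp (\<i> * of_int k * w)) (at w within A)" for w A
    unfolding H_def using False by (auto intro!: derivative_eq_intros)
  have c: "cis (of_int k * t) = exp (\<i> * of_int k * of_real t)" for t
    by (simp add: cis_conv_exp mult_ac)
  have "((\<lambda>t. cis (of_int k * t)) has_integral H (of_real (2 * pi)) - H (of_real 0)) {0..2*pi}"
    unfolding c
    by (intro fundamental_theorem_of_calculus has_vector_derivative_real_field)
       (use d in auto)
  moreover have "H (of_real (2 * pi)) = H (of_real 0)"
  proof -
    have "exp (\<i> * of_int k * of_real (2 * pi)) = 1"
      by (subst exp_eq_1) (auto intro!: exI[of _ k])
    then show ?thesis by (simp add: H_def)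
  qed
  ultimately show ?thesis using False by (simp add: integral_unique)
qed (simp add: scaleR_conv_of_real)

text \<open>Serves two purposes: with \<open>g\<close> a power of \<open>z\<close> it reads off
  coefficients, and with \<open>g\<close> a continuous function whose coefficients vanish it shows
  that \<open>g\<close> is orthogonal to every absolutely convergent series.\<close>

lemma has_sum_integral_series:
  assumes g: "continuous_on unit_circle g"
    and s: "(\<lambda>n. norm (c n)) summable_on UNIV"
    and f: "\<And>z. z \<in> unit_circle \<Longrightarrow> ((\<lambda>n. c n * z powi n) has_sum f z) UNIV"
  shows "((\<lambda>n. c n * integral {0..2*pi} (\<lambda>t. g (cis t) * cis (of_int n * t)))
           has_sum integral {0..2*pi} (\<lambda>t. g (cis t) * f (cis t))) UNIV"
proof -
  have gt: "continuous_on {0..2*pi} (\<lambda>t. g (cis t))"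
    by (rule continuous_on_circle_param[OF g])
  have "compact (g ` unit_circle)"
    by (intro compact_continuous_image g) auto
  then obtain M where M: "\<And>z. z \<in> unit_circle \<Longrightarrow> norm (g z) \<le> M"
    by (meson bounded_iff compact_imp_bounded imageI)
  have u: "uniform_limit {0..2*pi} (\<lambda>X t. \<Sum>n\<in>X. g (cis t) * (c n * cis (of_int n * t)))
             (\<lambda>t. g (cis t) * f (cis t)) (finite_subsets_at_top UNIV)"
  proof (rule Weierstrass_m_test_general'[where M = "\<lambda>n. M * norm (c n)"])
    show "norm (g (cis t) * (c n * cis (of_int n * t))) \<le> M * norm (c n)" for n t
      using M[of "cis t"] by (simp add: norm_mult mult_right_mono)
    show "(\<lambda>n. M * norm (c n)) summable_on UNIV"
      by (intro summable_on_cmult_right s)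
    show "((\<lambda>n. g (cis t) * (c n * cis (of_int n * t))) has_sum g (cis t) * f (cis t)) UNIV" for t
      using f[of "cis t"] by (intro has_sum_cmult_right) (simp add: cis_power_int)
  qed
  obtain I J where IJ:
    "\<And>X. ((\<lambda>t. \<Sum>n\<in>X. g (cis t) * (c n * cis (of_int n * t))) has_integral I X) {0..2*pi}"
    "((\<lambda>t. g (cis t) * f (cis t)) has_integral J) {0..2*pi}"
    "(I \<longlongrightarrow> J) (finite_subsets_at_top UNIV)"
    by (rule uniform_limit_integral[OF u]) (use gt in \<open>auto intro!: continuous_intros\<close>)
  have int1: "(\<lambda>t. g (cis t) * (c n * cis (of_int n * t))) integrable_on {0..2*pi}" for n
    by (intro integrable_continuous_real continuous_intros gt)
  have "I X = (\<Sum>n\<in>X. c n * integral {0..2*pi} (\<lambda>t. g (cis t) * cis (of_int n * t)))" if X: "finite X" for X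
  proof -
    have "I X = integral {0..2*pi} (\<lambda>t. \<Sum>n\<in>X. g (cis t) * (c n * cis (of_int n * t)))"
      by (rule integral_unique[OF IJ(1), symmetric])
    also have "\<dots> = (\<Sum>n\<in>X. integral {0..2*pi} (\<lambda>t. g (cis t) * (c n * cis (of_int n * t))))"
      by (rule integral_sum[OF X int1])
    also have "\<dots> = (\<Sum>n\<in>X. c n * integral {0..2*pi} (\<lambda>t. g (cis t) * cis (of_int n * t)))"
    proof (rule sum.cong[OF refl])
      fix n
      have "integral {0..2*pi} (\<lambda>t. g (cis t) * (c n * cis (of_int n * t)))
          = integral {0..2*pi} (\<lambda>t. c n * (g (cis t) * cis (of_int n * t)))"
        by (simp add: mult_ac)
      then show "integral {0..2*pi} (\<lambda>t. g (cis t) * (c n * cis (of_int n * t)))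
          = c n * integral {0..2*pi} (\<lambda>t. g (cis t) * cis (of_int n * t))"
        by simp
    qed
    finally show ?thesis .
  qed
  then have "\<forall>\<^sub>F X in finite_subsets_at_top UNIV.
      I X = (\<Sum>n\<in>X. c n * integral {0..2*pi} (\<lambda>t. g (cis t) * cis (of_int n * t)))"
    by (intro eventually_finite_subsets_at_top_weakI) auto
  from tendsto_cong[OF this] IJ(3) integral_unique[OF IJ(2)] show ?thesis
    by (simp add: has_sum_def)
qed

lemma fourier_coeff_series:
  assumes s: "(\<lambda>n. norm (c n)) summable_on UNIV"
    and f: "\<And>z. z \<in> unit_circle \<Longrightarrow> ((\<lambda>n. c n * z powi n) has_sum f z) UNIV"
  shows "fourier_coeff f m = c m"
proof -
  have 1: "cis t powi (-m) * cis (of_int n * t) = cis (of_int (n - m) * t)" for n t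
    by (simp add: cis_power_int cis_mult algebra_simps del: power_int_minus)
  have "((\<lambda>n. c n * integral {0..2*pi} (\<lambda>t. cis t powi (-m) * cis (of_int n * t)))
           has_sum integral {0..2*pi} (\<lambda>t. cis t powi (-m) * f (cis t))) UNIV"
    by (rule has_sum_integral_series[OF _ s f]) (auto intro!: continuous_intros)
  then have "((\<lambda>n. c n * (if n - m = 0 then of_real (2 * pi) else 0))
           has_sum integral {0..2*pi} (\<lambda>t. cis t powi (-m) * f (cis t))) UNIV"
    unfolding 1 integral_cis_int .
  moreover have "((\<lambda>n. c n * (if n - m = 0 then of_real (2 * pi) else 0)) has_sum c m * of_real (2 * pi)) UNIV"
  proof -
    have "((\<lambda>n. c n * (if n - m = 0 then of_real (2 * pi) else 0)) has_sum c m * of_real (2 * pi)) {m}"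
      using has_sum_finite[of "{m}" "\<lambda>n. c n * (if n - m = 0 then of_real (2 * pi) else 0)"] by simp
    then show ?thesis
      by (rule has_sum_cong_neutral[THEN iffD1, rotated -1]) auto
  qed
  ultimately have "integral {0..2*pi} (\<lambda>t. cis t powi (-m) * f (cis t)) = c m * of_real (2 * pi)"
    by (rule has_sum_unique)
  then show ?thesis
    by (simp add: fourier_coeff_def cis_power_int mult.commute del: power_int_minus)
qed

lemma wiener_fourier_coeff:
  assumes w: "is_weight w" and f: "wiener w f B"
  shows "(\<lambda>n. norm (fourier_coeff f n) * w n) summable_on UNIV"
    and "(\<Sum>\<^sub>\<infinity>n. norm (fourier_coeff f n) * w n) \<le> B"
    and "z \<in> unit_circle \<Longrightarrow> ((\<lambda>n. fourier_coeff f n * z powi n) has_sum f z) UNIV"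
proof -
  obtain c where c: "(\<lambda>n. norm (c n) * w n) summable_on UNIV" "(\<Sum>\<^sub>\<infinity>n. norm (c n) * w n) \<le> B"
     "\<And>z. z\<in>unit_circle \<Longrightarrow> ((\<lambda>n. c n * z powi n) has_sum f z) UNIV"
    using f unfolding wiener_def by blast
  have s: "(\<lambda>n. norm (c n)) summable_on UNIV"
    by (rule weighted_abs_summable[OF w c(1)])
  have "fourier_coeff f n = c n" for n by (rule fourier_coeff_series[OF s c(3)])
  then have "fourier_coeff f = c" by blast
  then show "(\<lambda>n. norm (fourier_coeff f n) * w n) summable_on UNIV"
    and "(\<Sum>\<^sub>\<infinity>n. norm (fourier_coeff f n) * w n) \<le> B"
    and "z \<in> unit_circle \<Longrightarrow> ((\<lambda>n. fourier_coeff f n * z powi n) has_sum f z) UNIV"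
    using c by auto
qed

text \<open>On the circle \<open>cnj z\<close> is \<open>1 / z\<close>, so a real-linear function is
  a combination of \<open>z powi 1\<close> and \<open>z powi (-1)\<close>; the algebra is closed
  under sums and products. Hence the polynomials of Stone-Weierstrass become trigonometric.\<close>

lemma real_polynomial_wiener:
  fixes p :: "complex \<Rightarrow> real"
  assumes "real_polynomial_function p"
  shows "\<exists>B. wiener (\<lambda>_. 1) (\<lambda>z. of_real (p z)) B"
  using assms
proof induction
  case (linear f)
  interpret bounded_linear f by fact
  let ?a = "complex_of_real (f 1)" and ?b = "complex_of_real (f \<i>)"
  have "wiener (\<lambda>_. 1) (\<lambda>z. (?a - \<i> * ?b) / 2 * z powi 1 + (?a + \<i> * ?b) / 2 * z powi (-1))
          (norm ((?a - \<i> * ?b) / 2) * 1 + norm ((?a + \<i> * ?b) / 2) * 1)"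
    by (intro wiener_add wiener_monom is_weight_one order_refl)
  then have "wiener (\<lambda>_. 1) (\<lambda>z. of_real (f z))
          (norm ((?a - \<i> * ?b) / 2) * 1 + norm ((?a + \<i> * ?b) / 2) * 1)"
  proof (rule wiener_cong)
    fix z assume z: "z \<in> unit_circle"
    then have "z * cnj z = 1" by (simp add: complex_norm_square[symmetric])
    then have i: "inverse z = cnj z" using inverse_unique by blast
    have "z = Re z *\<^sub>R 1 + Im z *\<^sub>R \<i>" by (simp add: complex_eq_iff)
    then have "f z = f (Re z *\<^sub>R 1 + Im z *\<^sub>R \<i>)" by (rule arg_cong)
    also have "\<dots> = Re z * f 1 + Im z * f \<i>" by (simp add: add scaleR)
    finally have "f z = Re z * f 1 + Im z * f \<i>" .
    then show "(?a - \<i> * ?b) / 2 * z powi 1 + (?a + \<i> * ?b) / 2 * z powi (-1) = of_real (f z)"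
      by (simp add: power_int_minus i complex_eq_iff algebra_simps add_divide_distrib diff_divide_distrib)
  qed
  then show ?case by blast
next
  case (const c)
  show ?case using wiener_const[OF is_weight_one order_refl, of "of_real c"] by blast
next
  case (add f g)
  then show ?case using wiener_add[OF is_weight_one] by fastforce
next
  case (mult f g)
  then show ?case using wiener_mult[OF is_weight_one] by fastforce
qed

lemma polynomial_wiener:
  fixes p :: "complex \<Rightarrow> complex"
  assumes "polynomial_function p"
  shows "\<exists>B. wiener (\<lambda>_. 1) p B"
proof -
  have "real_polynomial_function (Re \<circ> p)" "real_polynomial_function (Im \<circ> p)"
    using assms by (auto simp: polynomial_function_def intro: bounded_linear_Re bounded_linear_Im)
  then obtain B C where "wiener (\<lambda>_. 1) (\<lambda>z. of_real ((Re \<circ> p) z)) B" "wiener (\<lambda>_. 1) (\<lambda>z. of_real ((Im \<circ> p) z)) C"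
    using real_polynomial_wiener by meson
  then have "wiener (\<lambda>_. 1) (\<lambda>z. of_real ((Re \<circ> p) z) + \<i> * of_real ((Im \<circ> p) z)) (B + norm \<i> * C)"
    by (intro wiener_add wiener_cmult is_weight_one)
  then have "wiener (\<lambda>_. 1) p (B + norm \<i> * C)"
    by (rule wiener_cong) (simp add: complex_eq_iff)
  then show ?thesis by blast
qed

text \<open>\<open>f\<close> is orthogonal to trigonometric polynomials, and these approximate
  \<open>cnj f\<close> uniformly, so the integral of \<open>f * cnj f\<close> vanishes. Continuity
  then gives the claim at every point.\<close>

lemma fourier_coeff_zero_imp_zero:
  assumes f: "continuous_on unit_circle f"
    and 0: "\<And>n. fourier_coeff f n = 0"
    and z: "z \<in> unit_circle"
  shows "f z = 0"
proof -
  have ft: "continuous_on {0..2*pi} (\<lambda>t. f (cis t))"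
    by (rule continuous_on_circle_param[OF f])
  have orth: "integral {0..2*pi} (\<lambda>t. f (cis t) * h (cis t)) = 0" if h: "wiener (\<lambda>_. 1) h B" for h B
  proof -
    note h' = wiener_fourier_coeff[OF is_weight_one h]
    have i0: "integral {0..2*pi} (\<lambda>t. f (cis t) * cis (of_int n * t)) = 0" for n
      using 0[of "-n"] by (simp add: fourier_coeff_def)
    have "((\<lambda>n. fourier_coeff h n * integral {0..2*pi} (\<lambda>t. f (cis t) * cis (of_int n * t)))
           has_sum integral {0..2*pi} (\<lambda>t. f (cis t) * h (cis t))) UNIV"
      by (rule has_sum_integral_series[OF f]) (use h' in auto)
    then have "((\<lambda>n. 0) has_sum integral {0..2*pi} (\<lambda>t. f (cis t) * h (cis t))) (UNIV :: int set)"
      by (simp add: i0)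
    then show ?thesis by (rule has_sum_unique) simp
  qed
  have "compact (f ` unit_circle)"
    by (intro compact_continuous_image f) auto
  then obtain M where M: "\<And>z. z \<in> unit_circle \<Longrightarrow> norm (f z) \<le> M"
    by (meson bounded_iff compact_imp_bounded imageI)
  have M0: "M \<ge> 0" using M[OF z] norm_ge_zero order_trans by blast
  define J where "J = integral {0..2*pi} (\<lambda>t. f (cis t) * cnj (f (cis t)))"
  have J: "norm J \<le> e" if e: "e > 0" for e
  proof -
    \<comment> \<open>The integral below is at most \<open>M * d * (2 * pi)\<close>; dividing by
      \<open>M + 1\<close> covers \<open>M = 0\<close>.\<close>
    define d where "d = e / (2 * pi * (M + 1))"
    have d: "d > 0" using e M0 by (simp add: d_def)
    have cf: "continuous_on unit_circle (\<lambda>z. cnj (f z))" by (intro continuous_intros f)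
    obtain p where p: "polynomial_function p" "\<And>z. z \<in> unit_circle \<Longrightarrow> norm (cnj (f z) - p z) < d"
      using Stone_Weierstrass_polynomial_function[OF _ cf d] by auto
    obtain B where B: "wiener (\<lambda>_. 1) p B" using polynomial_wiener[OF p(1)] by blast
    have pt: "continuous_on {0..2*pi} (\<lambda>t. p (cis t))"
      by (rule continuous_on_circle_param[OF wiener_continuous[OF is_weight_one B]])
    have "J = J - integral {0..2*pi} (\<lambda>t. f (cis t) * p (cis t))"
      by (simp add: orth[OF B])
    also have "\<dots> = integral {0..2*pi} (\<lambda>t. f (cis t) * cnj (f (cis t)) - f (cis t) * p (cis t))"
      unfolding J_def
      by (intro integral_diff[symmetric] integrable_continuous_real continuous_intros ft pt)
    finally have "J = integral {0..2*pi} (\<lambda>t. f (cis t) * (cnj (f (cis t)) - p (cis t)))"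
      by (simp add: right_diff_distrib)
    also have "norm \<dots> \<le> (M * d) * (2 * pi - 0)"
    proof (rule integral_bound)
      show "norm (f (cis t) * (cnj (f (cis t)) - p (cis t))) \<le> M * d" for t
        unfolding norm_mult using M[of "cis t"] p(2)[of "cis t"]
        by (intro mult_mono) (auto intro: less_imp_le M0)
    qed (auto intro!: continuous_intros ft pt)
    also have "\<dots> = e * (M / (M + 1))" using pi_gt_zero by (simp add: d_def)
    also have "\<dots> \<le> e" using e M0 by (intro mult_left_le) auto
    finally show ?thesis .
  qed
  have "J = 0" using field_le_epsilon[of "norm J" 0] J by simp
  moreover have eq: "f (cis t) * cnj (f (cis t)) = of_real ((norm (f (cis t)))\<^sup>2)" for t
    by (metis complex_norm_square)
  have ct: "continuous_on {0..2*pi} (\<lambda>t. (norm (f (cis t)))\<^sup>2)"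
    by (intro continuous_intros ft)
  moreover have "J = of_real (integral {0..2*pi} (\<lambda>t. (norm (f (cis t)))\<^sup>2))"
    unfolding J_def eq
    by (rule integral_unique[OF has_integral_of_real]) (intro integrable_integral integrable_continuous_real ct)
  ultimately have "integral {0..2*pi} (\<lambda>t. (norm (f (cis t)))\<^sup>2) = 0"
    by simp
  with integrable_integral[OF integrable_continuous_real[OF ct]]
  have "((\<lambda>t. (norm (f (cis t)))\<^sup>2) has_integral 0) (cbox 0 (2*pi))"
    by simp
  moreover have "Arg2pi z \<in> cbox 0 (2*pi)" using Arg2pi[of z] by (auto intro: less_imp_le)
  ultimately have "(norm (f (cis (Arg2pi z))))\<^sup>2 = 0"
    by (intro has_integral_0_cbox_imp_0[of 0 "2*pi" "\<lambda>t. (norm (f (cis t)))\<^sup>2"]) (use ct pi_gt_zero in \<open>auto simp: box_real simp del: pi_gt_zero\<close>)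
  moreover have "cis (Arg2pi z) = z"
    using Arg2pi[of z] z by (simp add: is_Arg_def cis_conv_exp)
  ultimately show ?thesis by simp
qed

text \<open>The series formed with the coefficients of \<open>f\<close> has a continuous sum with
  those same coefficients, so the sum is \<open>f\<close> by uniqueness.\<close>

lemma wiener_of_fourier_coeff:
  assumes w: "is_weight w" and f: "continuous_on unit_circle f"
    and s: "(\<lambda>n. norm (fourier_coeff f n) * w n) summable_on UNIV"
  shows "wiener w f (\<Sum>\<^sub>\<infinity>n. norm (fourier_coeff f n) * w n)"
proof -
  define g where "g z = (\<Sum>\<^sub>\<infinity>n. fourier_coeff f n * z powi n)" for z
  have s1: "(\<lambda>n. norm (fourier_coeff f n)) summable_on UNIV"
    by (rule weighted_abs_summable[OF w s])
  have hs: "((\<lambda>n. fourier_coeff f n * z powi n) has_sum g z) UNIV" if "z \<in> unit_circle" for z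
    unfolding g_def
    by (rule has_sum_infsum, rule abs_summable_summable)
       (use s1 that in \<open>simp add: norm_mult norm_power_int\<close>)
  have g: "wiener w g (\<Sum>\<^sub>\<infinity>n. norm (fourier_coeff f n) * w n)"
    unfolding wiener_def using s hs by blast
  have gc: "continuous_on unit_circle g" by (rule wiener_continuous[OF w g])
  have ft: "continuous_on {0..2*pi} (\<lambda>t. f (cis t))" "continuous_on {0..2*pi} (\<lambda>t. g (cis t))"
    by (intro continuous_on_circle_param f gc)+
  have "fourier_coeff (\<lambda>z. f z - g z) n = 0" for n
  proof -
    have "(\<lambda>t. f (cis t) * cis (- (of_int n * t))) integrable_on {0..2*pi}"
      "(\<lambda>t. g (cis t) * cis (- (of_int n * t))) integrable_on {0..2*pi}"
      by (intro integrable_continuous_real continuous_intros ft)+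
    note ii = integral_diff[OF this]
    have "fourier_coeff (\<lambda>z. f z - g z) n = fourier_coeff f n - fourier_coeff g n"
      unfolding fourier_coeff_def left_diff_distrib
      by (simp add: ii diff_divide_distrib)
    also have "fourier_coeff g n = fourier_coeff f n" by (rule fourier_coeff_series[OF s1 hs])
    finally show ?thesis by simp
  qed
  then have "f z - g z = 0" if "z \<in> unit_circle" for z
    using fourier_coeff_zero_imp_zero[of "\<lambda>z. f z - g z"] that f gc by (auto intro!: continuous_intros)
  then show ?thesis using wiener_cong[OF g, of f] by simp
qed

lemma beurling_algebra_iff_wiener:
  assumes w: "is_weight w"
  shows "f \<in> beurling_algebra w \<longleftrightarrow> (\<exists>B. wiener w f B)"
  using wiener_continuous[OF w] wiener_fourier_coeff[OF w] wiener_of_fourier_coeff[OF w]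
  unfolding beurling_algebra_def by blast

lemma beurling_norm_le:
  assumes "is_weight w" "wiener w f B"
  shows "beurling_norm w f \<le> B"
  unfolding beurling_norm_def by (rule wiener_fourier_coeff[OF assms])

lemma wiener_beurling_norm:
  assumes "is_weight w" "f \<in> beurling_algebra w"
  shows "wiener w f (beurling_norm w f)"
  using assms wiener_of_fourier_coeff unfolding beurling_algebra_def beurling_norm_def by blast

lemma norm_fourier_coeff_le:
  assumes f: "continuous_on unit_circle f"
    and M: "\<And>z. z \<in> unit_circle \<Longrightarrow> norm (f z) \<le> M"
  shows "norm (fourier_coeff f n) \<le> M"
proof -
  have ft: "continuous_on {0..2*pi} (\<lambda>t. f (cis t))"
    by (rule continuous_on_circle_param[OF f])
  have "norm (integral {0..2 * pi} (\<lambda>t. f (cis t) * cis (- (of_int n * t)))) \<le> M * (2 * pi - 0)"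
  proof (rule integral_bound)
    show "continuous_on {0..2*pi} (\<lambda>t. f (cis t) * cis (- (of_int n * t)))"
      by (intro continuous_intros ft)
  qed (auto simp: norm_mult M)
  then show ?thesis by (simp add: fourier_coeff_def norm_divide field_simps)
qed

lemma summable_on_int_of_nat:
  fixes g :: "nat \<Rightarrow> real"
  assumes g: "summable g" and g0: "\<And>n. g n \<ge> 0"
  shows "(\<lambda>n::int. g (nat \<bar>n\<bar>)) summable_on UNIV"
proof -
  have s: "g summable_on UNIV"
    using g g0 by (simp add: summable_on_UNIV_nonneg_real_iff)
  have 1: "(\<lambda>n::int. g (nat \<bar>n\<bar>)) summable_on range int"
    by (subst summable_on_reindex) (auto simp: o_def s)
  have 2: "(\<lambda>n::int. g (nat \<bar>n\<bar>)) summable_on range (\<lambda>n. - int n)"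
    by (subst summable_on_reindex) (auto simp: o_def s inj_on_def)
  have "(UNIV :: int set) = range int \<union> range (\<lambda>n. - int n)"
  proof -
    have "n \<in> range int \<union> range (\<lambda>n. - int n)" for n by (cases n rule: int_cases2) auto
    then show ?thesis by auto
  qed
  then show ?thesis using summable_on_union[OF 1 2] by simp
qed

section \<open>Plateau functions\<close>

text \<open>The 1-periodic extension of \<open>x\<^sup>2 - x\<close> from \<open>[0, 1]\<close>. Its second differences are piecewise linear and
  its Fourier coefficients are \<open>O(1 / n\<^sup>2)\<close>, which makes it the source of all cutoff functions.\<close>

definition parab :: "complex \<Rightarrow> complex" where
  "parab z = of_real ((arccos (Re z) / (2 * pi))\<^sup>2 - arccos (Re z) / (2 * pi))"

lemma parab_cis:
  assumes "\<bar>x\<bar> \<le> 1"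
  shows "parab (cis (2 * pi * x)) = of_real (x\<^sup>2 - \<bar>x\<bar>)"
proof -
  define y where "y = \<bar>x\<bar>"
  have y: "0 \<le> y" "y \<le> 1" using assms by (auto simp: y_def)
  have cy: "cos (2 * pi * x) = cos (2 * pi * y)"
    by (auto simp: y_def abs_if)
  have "parab (cis (2 * pi * x)) = of_real (y\<^sup>2 - y)"
  proof (cases "y \<le> 1/2")
    case True
    then have "arccos (cos (2 * pi * y)) = 2 * pi * y"
      using y by (intro arccos_cos) auto
    then have "arccos (cos (2 * pi * x)) / (2 * pi) = y" unfolding cy by simp
    then show ?thesis unfolding parab_def cis.sel by simp
  next
    case False
    have c: "cos (2 * pi * x) = cos (2 * pi * (1 - y))"
      unfolding cy by (simp add: right_diff_distrib cos_diff)
    have "arccos (cos (2 * pi * (1 - y))) = 2 * pi * (1 - y)"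
      using y False by (intro arccos_cos) auto
    then have "arccos (cos (2 * pi * x)) / (2 * pi) = 1 - y" unfolding c by simp
    have sq: "(1 - y)\<^sup>2 - (1 - y) = y\<^sup>2 - y" by (simp add: power2_eq_square algebra_simps)
    show ?thesis unfolding parab_def cis.sel \<open>arccos _ / _ = _\<close> sq ..
  qed
  then show ?thesis by (simp add: y_def)
qed

lemma wiener_parab: "\<exists>B. wiener (\<lambda>_. 1) parab B"
proof -
  have cont: "continuous_on unit_circle parab"
  proof -
    have "\<bar>Re z\<bar> \<le> 1" if "norm z = 1" for z using abs_Re_le_cmod[of z] that by simp
    then have "\<forall>z\<in>unit_circle. -1 \<le> Re z \<and> Re z \<le> 1" by (simp add: abs_le_iff)
    then have ac: "continuous_on unit_circle (\<lambda>z. arccos (Re z))"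
      by (intro continuous_on_arccos continuous_on_Re continuous_on_id)
    have "continuous_on unit_circle (\<lambda>z. (arccos (Re z) / (2 * pi))\<^sup>2 - arccos (Re z) / (2 * pi))"
      by (rule continuous_on_diff[OF continuous_on_power continuous_on_divide];
          (rule continuous_on_divide)?; (rule ac continuous_on_const)?; simp)
    then show ?thesis
      unfolding parab_def by (rule continuous_on_of_real)
  qed
  have coeff: "fourier_coeff parab n = 1 / (2 * of_real pi ^ 2 * of_int n ^ 2)" if n: "n \<noteq> 0" for n
  proof -
    define a where "a = - (\<i> * of_int n)"
    have a: "a \<noteq> 0" using n by (simp add: a_def)
    define c :: complex where "c = 2 * of_real pi"
    have c: "c \<noteq> 0" by (simp add: c_def)
    define k i where "k = inverse c" and "i = inverse a"
    have ai: "a * i = 1" using a by (simp add: i_def)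
    have ck: "c * k = 1" using c by (simp add: k_def)
    \<comment> \<open>\<open>k\<close> is \<open>1 / (2 * pi)\<close> and \<open>i\<close> is
      \<open>1 / a\<close>. \<open>H\<close> is the antiderivative found by repeated integration by
      parts; keeping both inverses as atoms turns the checks into polynomial identities.\<close>
    define H where "H x = exp (a * x) * ((x^2 * k^2 - x * k) * i - (2 * x * k^2 - k) * i^2 + 2 * k^2 * i^3)" for x
    have d: "(H has_field_derivative exp (a * x) * (x^2 * k^2 - x * k)) (at x within A)" for x A
    proof -
      define E where "E x = (x^2 * k^2 - x * k) * i - (2 * x * k^2 - k) * i^2 + 2 * k^2 * i^3" for x
      have E: "(E has_field_derivative (2 * x * k^2 - k) * i - 2 * k^2 * i^2) (at x within A)"
        unfolding E_def by (auto intro!: derivative_eq_intros)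
      have "((\<lambda>x. exp (a * x)) has_field_derivative a * exp (a * x)) (at x within A)"
        by (auto intro!: derivative_eq_intros)
      from DERIV_mult[OF this E]
      have "(H has_field_derivative a * exp (a * x) * E x
               + ((2 * x * k^2 - k) * i - 2 * k^2 * i^2) * exp (a * x)) (at x within A)"
        unfolding H_def E_def by simp
      moreover have "a * exp (a * x) * E x + ((2 * x * k^2 - k) * i - 2 * k^2 * i^2) * exp (a * x)
          = exp (a * x) * (x^2 * k^2 - x * k)"
        unfolding E_def using ai by algebra
      ultimately show ?thesis by simp
    qed
    have eq: "parab (cis t) * cis (- (of_int n * t)) = exp (a * of_real t) * ((of_real t)^2 * k^2 - of_real t * k)"
      if "t \<in> {0..2*pi}" for t
    proof -
      have "parab (cis t) = of_real ((t / (2*pi))\<^sup>2 - t / (2*pi))"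
        using parab_cis[of "t / (2*pi)"] that by simp
      moreover have "cis (- (of_int n * t)) = exp (a * of_real t)"
        unfolding cis_conv_exp a_def by (simp add: mult.assoc)
      moreover have "of_real t * k = complex_of_real (t / (2*pi))"
        unfolding k_def c_def divide_inverse of_real_mult of_real_inverse of_real_numeral ..
      then have "complex_of_real ((t / (2*pi))\<^sup>2 - t / (2*pi)) = (of_real t * k)^2 - of_real t * k"
        by (simp only: of_real_diff of_real_power)
      ultimately show ?thesis by (simp only: power_mult_distrib mult.commute)
    qed
    have "((\<lambda>t. exp (a * of_real t) * ((of_real t)^2 * k^2 - of_real t * k)) has_integral H (of_real (2 * pi)) - H (of_real 0)) {0..2*pi}"
      by (intro fundamental_theorem_of_calculus has_vector_derivative_real_field) (use d in auto)
    then have "integral {0..2*pi} (\<lambda>t. parab (cis t) * cis (- (of_int n * t))) = H (of_real (2 * pi)) - H (of_real 0)"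
      by (intro integral_unique, subst has_integral_cong[OF eq])
    also have "\<dots> = H c - H 0" by (simp add: c_def)
    also have "exp (a * c) = 1"
      unfolding a_def c_def by (subst exp_eq_1) (auto intro!: exI[of _ "-n"])
    then have "H c - H 0 = - 2 * k * i^2"
      unfolding H_def using ck by simp algebra
    finally show ?thesis
      unfolding fourier_coeff_def using n
      by (simp add: c_def a_def k_def i_def power2_eq_square field_simps)
  qed
  have s: "(\<lambda>n::int. norm (fourier_coeff parab n) * 1) summable_on UNIV"
  proof -
    define g where "g n = (if n = 0 then norm (fourier_coeff parab 0) else 1 / (real n)\<^sup>2)" for n
    have "summable (\<lambda>n. 1 / (real n)\<^sup>2)" using inverse_power_summable[of 2] by (simp add: divide_inverse)
    then have "summable (\<lambda>n. 1 / (real (n+1))\<^sup>2)" by (rule summable_ignore_initial_segment)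
    then have "summable (\<lambda>n. g (n+1))" by (simp add: g_def)
    then have gs: "summable g" by (subst (asm) summable_iff_shift)
    have "(\<lambda>n::int. g (nat \<bar>n\<bar>)) summable_on UNIV"
      by (rule summable_on_int_of_nat[OF gs]) (simp add: g_def)
    then show ?thesis
    proof (rule summable_on_comparison_test)
      fix n :: int
      show "norm (fourier_coeff parab n) * 1 \<le> g (nat \<bar>n\<bar>)"
      proof (cases "n = 0")
        case False
        have "1 \<le> 2 * pi^2"
          using pi_ge_two one_le_power[of pi 2] by linarith
        then show ?thesis
          using False mult_right_mono[of 1 "2 * pi^2" "(real_of_int n)^2"] by (simp add: coeff g_def norm_divide norm_mult norm_power divide_simps)
      qed (simp add: g_def)
    qed auto
  qed
  show ?thesis using wiener_of_fourier_coeff[OF is_weight_one cont s] by blast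
qed


section \<open>Fourier multipliers that reproduce affine functions locally\<close>

definition trig :: "(int \<Rightarrow> complex) \<Rightarrow> real \<Rightarrow> complex" where
  "trig c y = (\<Sum>\<^sub>\<infinity>n. c n * cis (2 * pi * of_int n * y))"

lemma has_sum_trig:
  assumes "(\<lambda>n. norm (c n)) summable_on UNIV"
  shows "((\<lambda>n. c n * cis (2 * pi * of_int n * y)) has_sum trig c y) UNIV"
  unfolding trig_def
  by (rule has_sum_infsum, rule abs_summable_summable) (use assms in \<open>simp add: norm_mult\<close>)

text \<open>Multiplying the coefficients by \<open>m\<close> keeps a function that is affine on an interval the same
  affine function, up to a loss of length \<open>a\<close> at both ends.\<close>

definition local_mult :: "(int \<Rightarrow> real) \<Rightarrow> real \<Rightarrow> bool" where
  "local_mult m a \<longleftrightarrow> (\<forall>n. \<bar>m n\<bar> \<le> 1) \<and>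
     (\<forall>c \<alpha> \<beta> x r. (\<lambda>n. norm (c n)) summable_on UNIV \<longrightarrow>
        (\<forall>y. \<bar>y - x\<bar> \<le> r \<longrightarrow> trig c y = \<alpha> + \<beta> * of_real y) \<longrightarrow>
        (\<forall>y. \<bar>y - x\<bar> \<le> r - a \<longrightarrow> trig (\<lambda>n. c n * of_real (m n)) y = \<alpha> + \<beta> * of_real y))"

lemma local_multI:
  assumes "\<And>n. \<bar>m n\<bar> \<le> 1"
    and "\<And>c \<alpha> \<beta> x r y. (\<lambda>n. norm (c n)) summable_on UNIV \<Longrightarrow>
        (\<And>y. \<bar>y - x\<bar> \<le> r \<Longrightarrow> trig c y = \<alpha> + \<beta> * of_real y) \<Longrightarrow>
        \<bar>y - x\<bar> \<le> r - a \<Longrightarrow> trig (\<lambda>n. c n * of_real (m n)) y = \<alpha> + \<beta> * of_real y"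
  shows "local_mult m a"
  using assms unfolding local_mult_def by blast

lemma local_multD:
  assumes "local_mult m a"
  shows "\<bar>m n\<bar> \<le> 1"
    and "(\<lambda>n. norm (c n)) summable_on UNIV \<Longrightarrow>
        (\<And>y. \<bar>y - x\<bar> \<le> r \<Longrightarrow> trig c y = \<alpha> + \<beta> * of_real y) \<Longrightarrow>
        \<bar>y - x\<bar> \<le> r - a \<Longrightarrow> trig (\<lambda>n. c n * of_real (m n)) y = \<alpha> + \<beta> * of_real y"
  using assms unfolding local_mult_def by blast+

lemma abs_summable_mult_bounded:
  fixes c :: "int \<Rightarrow> complex"
  assumes "(\<lambda>n. norm (c n)) summable_on UNIV" "\<And>n. \<bar>m n\<bar> \<le> 1"
  shows "(\<lambda>n. norm (c n * of_real (m n))) summable_on UNIV"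
  by (rule summable_on_comparison_test[OF assms(1)])
     (use mult_left_mono[OF assms(2), of "norm (c _)"] in \<open>auto simp: norm_mult\<close>)

text \<open>The multiplier averages the translates by \<open>a\<close> and \<open>- a\<close>, and
  the mean of an affine function over two symmetric points is its value at the centre.\<close>

lemma local_mult_cos: "local_mult (\<lambda>n. cos (2 * pi * a * of_int n)) \<bar>a\<bar>"
proof (rule local_multI)
  fix c \<alpha> \<beta> x r y
  assume s: "(\<lambda>n. norm (c n)) summable_on (UNIV :: int set)"
    and af: "\<And>y. \<bar>y - x\<bar> \<le> r \<Longrightarrow> trig c y = \<alpha> + \<beta> * of_real y" and y: "\<bar>y - x\<bar> \<le> r - \<bar>a\<bar>"
  have "((\<lambda>n. 1/2 * (c n * cis (2 * pi * of_int n * (y + a)) + c n * cis (2 * pi * of_int n * (y - a))))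
          has_sum 1/2 * (trig c (y + a) + trig c (y - a))) UNIV"
    by (intro has_sum_cmult_right has_sum_add has_sum_trig s)
  moreover have "1/2 * (c n * cis (2 * pi * of_int n * (y + a)) + c n * cis (2 * pi * of_int n * (y - a)))
      = c n * of_real (cos (2 * pi * a * of_int n)) * cis (2 * pi * of_int n * y)" for n
  proof -
    have 1: "2 * pi * of_int n * (y + a) = 2 * pi * of_int n * y + 2 * pi * a * of_int n"
      and 2: "2 * pi * of_int n * (y - a) = 2 * pi * of_int n * y - 2 * pi * a * of_int n"
      by (simp_all add: algebra_simps)
    have cc: "cis (u + v) + cis (u - v) = 2 * of_real (cos v) * cis u" for u v
      by (simp add: complex_eq_iff cos_add sin_add cos_diff sin_diff)
    show ?thesis unfolding 1 2 distrib_left[symmetric] cc by simp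
  qed
  ultimately have "trig (\<lambda>n. c n * of_real (cos (2 * pi * a * of_int n))) y
      = 1/2 * (trig c (y + a) + trig c (y - a))"
    unfolding trig_def by (simp add: infsumI)
  also have "trig c (y + a) = \<alpha> + \<beta> * of_real (y + a)" using y by (intro af) linarith
  also have "trig c (y - a) = \<alpha> + \<beta> * of_real (y - a)" using y by (intro af) linarith
  finally show "trig (\<lambda>n. c n * of_real (cos (2 * pi * a * of_int n))) y = \<alpha> + \<beta> * of_real y"
    by (simp add: algebra_simps)
qed simp

lemma local_mult_one: "local_mult (\<lambda>_. 1) 0"
  by (rule local_multI) auto

lemma local_mult_mult:
  assumes "local_mult m a" "local_mult m' b"
  shows "local_mult (\<lambda>n. m n * m' n) (a + b)"
proof (rule local_multI)
  show "\<bar>m n * m' n\<bar> \<le> 1" for n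
    using local_multD(1)[OF assms(1), of n] local_multD(1)[OF assms(2), of n]
    by (simp add: abs_mult mult_le_one)
  fix c \<alpha> \<beta> x r y
  assume s: "(\<lambda>n. norm (c n)) summable_on (UNIV :: int set)"
    and af: "\<And>y. \<bar>y - x\<bar> \<le> r \<Longrightarrow> trig c y = \<alpha> + \<beta> * of_real y" and y: "\<bar>y - x\<bar> \<le> r - (a + b)"
  have 1: "trig (\<lambda>n. c n * of_real (m n)) y = \<alpha> + \<beta> * of_real y" if "\<bar>y - x\<bar> \<le> r - a" for y
    using local_multD(2)[OF assms(1) s af that] .
  have "trig (\<lambda>n. (c n * of_real (m n)) * of_real (m' n)) y = \<alpha> + \<beta> * of_real y"
    by (rule local_multD(2)[OF assms(2) abs_summable_mult_bounded[OF s local_multD(1)[OF assms(1)]] 1])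
       (use y in auto)
  then show "trig (\<lambda>n. c n * of_real (m n * m' n)) y = \<alpha> + \<beta> * of_real y"
    by (simp add: mult.assoc)
qed

lemma local_mult_prod:
  fixes K :: nat
  assumes "\<And>k. k < K \<Longrightarrow> local_mult (m k) (a k)"
  shows "local_mult (\<lambda>n. \<Prod>k<K. m k n) (\<Sum>k<K. a k)"
  using assms
proof (induction K)
  case (Suc K)
  then show ?case using local_mult_mult[of "\<lambda>n. \<Prod>k<K. m k n" _ "m K" "a K"] by (simp add: mult.commute)
qed (simp add: local_mult_one)

lemma tendsto_infsum_dominated:
  fixes f :: "nat \<Rightarrow> int \<Rightarrow> 'a :: {real_normed_algebra, banach}"
  assumes lim: "\<And>n. (\<lambda>j. f j n) \<longlonglongrightarrow> h n" and le: "\<And>j n. norm (f j n) \<le> g n"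
    and g: "g summable_on UNIV"
  shows "(\<lambda>j. \<Sum>\<^sub>\<infinity>n. f j n) \<longlonglongrightarrow> (\<Sum>\<^sub>\<infinity>n. h n)"
proof -
  have bij: "bij_betw int_decode UNIV UNIV" by (rule bij_int_decode)
  have g0: "g n \<ge> 0" for n using le[of 0 n] norm_ge_zero order_trans by blast
  have "(\<lambda>k. g (int_decode k)) summable_on UNIV"
    using summable_on_reindex_bij_betw[OF bij, of g] g by simp
  then have gs: "summable (\<lambda>k. g (int_decode k))" by (rule summable_on_imp_summable)
  have hle: "norm (h n) \<le> g n" for n
    by (rule Lim_norm_ubound[OF _ lim]) (use le in auto)
  have eq: "(\<Sum>\<^sub>\<infinity>n. u n) = (\<Sum>k. u (int_decode k))" if "\<And>n. norm (u n) \<le> g n" for u :: "int \<Rightarrow> 'a"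
  proof -
    have su: "summable (\<lambda>k. norm (u (int_decode k)))"
      by (rule summable_comparison_test'[OF gs, of 0]) (use that in auto)
    have "((\<lambda>k. u (int_decode k)) has_sum (\<Sum>k. u (int_decode k))) UNIV"
      by (rule norm_summable_imp_has_sum[OF su summable_sums[OF summable_norm_cancel[OF su]]])
    then show ?thesis
      unfolding has_sum_reindex_bij_betw[OF bij, of u] by (rule infsumI)
  qed
  have "(\<lambda>j. \<Sum>k. f j (int_decode k)) \<longlonglongrightarrow> (\<Sum>k. h (int_decode k))"
  proof -
    have "\<forall>\<^sub>F (k, j) in at_top \<times>\<^sub>F sequentially. norm (f j (int_decode k)) \<le> g (int_decode k)"
      by (rule always_eventually) (use le in auto)
    from tannerys_theorem[OF lim this gs] show ?thesis by simp
  qed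
  then show ?thesis using eq hle le by simp
qed

lemma local_mult_lim:
  assumes lim: "\<And>n. (\<lambda>j. M j n) \<longlonglongrightarrow> m n" and M: "\<And>j. local_mult (M j) (A j)" and A: "\<And>j. A j \<le> a"
  shows "local_mult m a"
proof (rule local_multI)
  have M1: "\<bar>M j n\<bar> \<le> 1" for j n by (rule local_multD(1)[OF M])
  show "\<bar>m n\<bar> \<le> 1" for n
    by (rule Lim_norm_ubound[OF _ lim, unfolded real_norm_def]) (use M1 in auto)
  fix c \<alpha> \<beta> x r y
  assume s: "(\<lambda>n. norm (c n)) summable_on (UNIV :: int set)"
    and af: "\<And>y. \<bar>y - x\<bar> \<le> r \<Longrightarrow> trig c y = \<alpha> + \<beta> * of_real y" and y: "\<bar>y - x\<bar> \<le> r - a"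
  have "trig (\<lambda>n. c n * of_real (M j n)) y = \<alpha> + \<beta> * of_real y" for j
    by (rule local_multD(2)[OF M s af]) (use y A[of j] in auto)
  moreover have "(\<lambda>j. trig (\<lambda>n. c n * of_real (M j n)) y) \<longlonglongrightarrow> trig (\<lambda>n. c n * of_real (m n)) y"
    unfolding trig_def
    by (rule tendsto_infsum_dominated[OF _ _ s])
       (auto intro!: tendsto_intros lim simp: norm_mult mult_left_le M1)
  ultimately show "trig (\<lambda>n. c n * of_real (m n)) y = \<alpha> + \<beta> * of_real y"
    by (simp add: LIMSEQ_const_iff)
qed

section \<open>Cardinal sines and rapidly decreasing multipliers\<close>

definition rsinc :: "real \<Rightarrow> real" where
  "rsinc x = (if x = 0 then 1 else sin x / x)"

lemma abs_rsinc_le: "\<bar>rsinc x\<bar> \<le> 1" "x \<noteq> 0 \<Longrightarrow> \<bar>rsinc x\<bar> \<le> 1 / \<bar>x\<bar>"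
proof -
  show "\<bar>rsinc x\<bar> \<le> 1"
    using abs_sin_x_le_abs_x[of x] by (auto simp: rsinc_def abs_divide divide_le_eq_1)
  show "\<bar>rsinc x\<bar> \<le> 1 / \<bar>x\<bar>" if "x \<noteq> 0"
    using that by (auto simp: rsinc_def abs_divide divide_right_mono)
qed

lemma abs_rsinc_minus_1: "\<bar>rsinc x - 1\<bar> \<le> \<bar>x\<bar>"
proof (cases "x = 0")
  case False
  have "\<bar>sin x - x\<bar> \<le> x\<^sup>2 / 2"
    using Maclaurin_sin_bound[of x 2] by (simp add: numeral_2_eq_2 sin_coeff_def)
  also have "\<dots> \<le> \<bar>x\<bar> * \<bar>x\<bar>" by (simp add: power2_eq_square)
  finally have "\<bar>sin x - x\<bar> \<le> \<bar>x\<bar> * \<bar>x\<bar>" .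
  moreover have "rsinc x - 1 = (sin x - x) / x" using False by (simp add: rsinc_def field_simps)
  ultimately show ?thesis using False by (simp add: abs_divide divide_le_eq)
qed (simp add: rsinc_def)

text \<open>Viete's product, by iterating
  \<open>sin y = 2 * sin (y / 2) * cos (y / 2)\<close>.\<close>

lemma prod_cos_halves_tendsto_rsinc: "(\<lambda>J. \<Prod>j<J. cos (x / 2 ^ Suc j)) \<longlonglongrightarrow> rsinc x"
proof (cases "x = 0")
  case False
  have eq: "(\<Prod>j<J. cos (x / 2 ^ Suc j)) * (2 ^ J * sin (x / 2 ^ J)) = sin x" for J
  proof (induction J)
    case (Suc J)
    have "sin (x / 2 ^ J) = 2 * sin (x / 2 ^ Suc J) * cos (x / 2 ^ Suc J)"
      using sin_double[of "x / 2 ^ Suc J"] by simp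
    then show ?case using Suc by (simp add: mult_ac)
  qed simp
  have "((\<lambda>h. sin (x * h)) has_real_derivative x) (at 0)"
    by (auto intro!: derivative_eq_intros)
  then have "((\<lambda>h. sin (x * h) / h) \<longlongrightarrow> x) (at 0)"
    by (simp add: has_field_derivative_iff)
  moreover have "filterlim (\<lambda>J. 1 / 2 ^ J :: real) (at 0) sequentially" by real_asymp
  ultimately have "(\<lambda>J. sin (x * (1 / 2 ^ J)) / (1 / 2 ^ J)) \<longlonglongrightarrow> x"
    by (rule filterlim_compose)
  then have lim: "(\<lambda>J. 2 ^ J * sin (x / 2 ^ J)) \<longlonglongrightarrow> x" by (simp add: mult.commute)
  have "(\<lambda>J. sin x / (2 ^ J * sin (x / 2 ^ J))) \<longlonglongrightarrow> sin x / x"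
    by (intro tendsto_intros lim False)
  moreover have "\<forall>\<^sub>F J in sequentially. 2 ^ J * sin (x / 2 ^ J) \<noteq> 0"
    by (rule tendsto_imp_eventually_ne[OF lim False])
  then have "\<forall>\<^sub>F J in sequentially. sin x / (2 ^ J * sin (x / 2 ^ J)) = (\<Prod>j<J. cos (x / 2 ^ Suc j))"
  proof eventually_elim
    case (elim J)
    then show ?case using eq[of J] by (simp add: field_simps)
  qed
  ultimately show ?thesis using False by (simp add: rsinc_def Lim_transform_eventually)
qed (simp add: rsinc_def)

text \<open>By Viete's product this is a limit of cosine multipliers with losses
  \<open>a / 2\<close>, \<open>a / 4\<close> and so on. Unlike a cosine it decays, like
  \<open>1 / n\<close>, so that many such factors give rapid decay.\<close>

lemma local_mult_rsinc:
  assumes "a \<ge> 0"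
  shows "local_mult (\<lambda>n. rsinc (2 * pi * a * of_int n)) a"
proof (rule local_mult_lim[OF _ local_mult_prod])
  show "(\<lambda>J. \<Prod>j<J. cos (2 * pi * (a / 2 ^ Suc j) * of_int n)) \<longlonglongrightarrow> rsinc (2 * pi * a * of_int n)" for n
  proof -
    have "2 * pi * (a / 2 ^ Suc j) * of_int n = 2 * pi * a * of_int n / 2 ^ Suc j" for j by simp
    then show ?thesis using prod_cos_halves_tendsto_rsinc[of "2 * pi * a * of_int n"] by (simp only:)
  qed
  show "local_mult (\<lambda>n. cos (2 * pi * (a / 2 ^ Suc j) * of_int n)) (a / 2 ^ Suc j)" for j
    using local_mult_cos[of "a / 2 ^ Suc j"] assms by simp
  show "(\<Sum>j<J. a / 2 ^ Suc j) \<le> a" for J :: nat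
  proof -
    have "(\<Sum>j<J. a / 2 ^ Suc j) = a - a / 2 ^ J" by (induction J) (auto simp: field_simps)
    then show ?thesis using assms by simp
  qed
qed

text \<open>Either \<open>c * x powr (\<theta> - \<sigma>)\<close> is at least \<open>1\<close> and
  the first term suffices, or \<open>x\<close> is bounded in terms of \<open>c\<close>. Used
  throughout to absorb a power into a small multiple of a higher one.\<close>

lemma powr_le_interpolate:
  fixes x c :: real
  assumes "0 < \<sigma>" "\<sigma> < \<theta>" "0 < c" "0 \<le> x"
  shows "x powr \<sigma> \<le> c * x powr \<theta> + (1 / c) powr (\<sigma> / (\<theta> - \<sigma>))"
proof (cases "1 / c \<le> x powr (\<theta> - \<sigma>)")
  case True
  have "1 \<le> c * x powr (\<theta> - \<sigma>)" using True assms by (simp add: field_simps)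
  from mult_left_mono[OF this, of "x powr \<sigma>"]
  have "x powr \<sigma> \<le> x powr \<sigma> * (c * x powr (\<theta> - \<sigma>))" by simp
  also have "\<dots> = c * x powr \<theta>" by (simp add: mult_ac flip: powr_add)
  finally show ?thesis using powr_ge_zero[of "1 / c" "\<sigma> / (\<theta> - \<sigma>)"] by linarith
next
  case False
  have "x powr \<sigma> = (x powr (\<theta> - \<sigma>)) powr (\<sigma> / (\<theta> - \<sigma>))"
    using assms by (simp add: powr_powr)
  also have "\<dots> \<le> (1 / c) powr (\<sigma> / (\<theta> - \<sigma>))"
    using False assms by (intro powr_mono2) auto
  finally show ?thesis using assms by (simp add: add_increasing)
qed

lemma powr_subadditive:
  fixes x y :: real
  assumes "0 \<le> x" "0 \<le> y" "0 < \<sigma>" "\<sigma> \<le> 1"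
  shows "(x + y) powr \<sigma> \<le> x powr \<sigma> + y powr \<sigma>"
proof (cases "x = 0 \<or> y = 0")
  case False
  then have xy: "x > 0" "y > 0" using assms by auto
  have "(x + y) powr \<sigma> = x * (x + y) powr (\<sigma> - 1) + y * (x + y) powr (\<sigma> - 1)"
    using powr_mult_base[of "x + y" "\<sigma> - 1"] xy by (simp add: distrib_right)
  also have "\<dots> \<le> x * x powr (\<sigma> - 1) + y * y powr (\<sigma> - 1)"
    using xy assms by (intro add_mono mult_left_mono powr_mono2') auto
  also have "\<dots> = x powr \<sigma> + y powr \<sigma>"
    using powr_mult_base[of x "\<sigma> - 1"] powr_mult_base[of y "\<sigma> - 1"] xy by simp
  finally show ?thesis .
qed auto

text \<open>A Gevrey weight. For \<open>\<sigma> < 1\<close> it is non-quasianalytic, so its algebra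
  contains cutoff functions.\<close>

definition exp_weight :: "real \<Rightarrow> int \<Rightarrow> real" where
  "exp_weight \<sigma> n = exp (real_of_int \<bar>n\<bar> powr \<sigma>)"

lemma is_weight_exp: "0 < \<sigma> \<Longrightarrow> \<sigma> \<le> 1 \<Longrightarrow> is_weight (exp_weight \<sigma>)"
proof -
  assume s: "0 < \<sigma>" "\<sigma> \<le> 1"
  have "real_of_int \<bar>n + m\<bar> powr \<sigma> \<le> real_of_int \<bar>n\<bar> powr \<sigma> + real_of_int \<bar>m\<bar> powr \<sigma>" for m n :: int
  proof -
    have "real_of_int \<bar>n + m\<bar> powr \<sigma> \<le> (real_of_int \<bar>n\<bar> + real_of_int \<bar>m\<bar>) powr \<sigma>"
      using s by (intro powr_mono2) auto
    also have "\<dots> \<le> real_of_int \<bar>n\<bar> powr \<sigma> + real_of_int \<bar>m\<bar> powr \<sigma>"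
      using s by (intro powr_subadditive) auto
    finally show ?thesis .
  qed
  then show ?thesis by (auto simp: is_weight_def exp_weight_def simp flip: exp_add)
qed

text \<open>The multiplier is an infinite product of cardinal sines with summable step lengths
  \<open>A * (k + 1) powr (- p)\<close>. About \<open>\<bar>n\<bar> powr (1 / p)\<close> of the factors at \<open>n\<close> are at most \<open>1 / e\<close>.\<close>

lemma rapid_local_mult:
  assumes s: "0 < \<sigma>" "\<sigma> < 1" and a: "a > 0"
  shows "\<exists>m C. local_mult m a \<and> (\<forall>n. \<bar>m n\<bar> * exp_weight \<sigma> n \<le> C)"
proof -
  \<comment> \<open>Strictly between \<open>\<sigma>\<close> and \<open>1\<close>: decay of order
    \<open>\<theta>\<close> beats \<open>exp_weight \<sigma>\<close>, and
    \<open>p = 1 / \<theta> > 1\<close> keeps the step lengths summable.\<close>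
  define \<theta> where "\<theta> = (1 + \<sigma>) / 2"
  have th: "0 < \<theta>" "\<sigma> < \<theta>" "\<theta> < 1" using s by (auto simp: \<theta>_def)
  define p where "p = 1 / \<theta>"
  have p: "p > 1" using th by (simp add: p_def)
  have sum0: "summable (\<lambda>k. real (Suc k) powr (- p))"
    using p by (subst summable_Suc_iff[of "\<lambda>k. real k powr (- p)"]) (simp add: summable_real_powr_iff)
  define S where "S = (\<Sum>k. real (Suc k) powr (- p))"
  have S0: "S \<ge> 0" unfolding S_def by (intro suminf_nonneg sum0) auto
  define A where "A = a / (S + 1)"
  have A: "A > 0" using a S0 by (simp add: A_def)
  define ak where "ak k = A * real (Suc k) powr (- p)" for k
  have ak: "ak k > 0" for k using A by (simp add: ak_def)
  have aks: "summable ak" unfolding ak_def by (intro summable_mult sum0)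
  have aksum: "(\<Sum>k<K. ak k) \<le> a" for K
  proof -
    have "(\<Sum>k<K. ak k) \<le> (\<Sum>k. ak k)"
      by (intro sum_le_suminf aks) (use ak in \<open>auto intro: less_imp_le\<close>)
    also have "\<dots> = A * S" unfolding ak_def S_def by (intro suminf_mult sum0)
    also have "\<dots> \<le> a" using a S0 by (simp add: A_def field_simps)
    finally show ?thesis .
  qed
  define f where "f n k = rsinc (2 * pi * ak k * of_int n)" for n :: int and k
  define m where "m n = lim (\<lambda>K. \<Prod>k<K. f n k)" for n
  have conv: "(\<lambda>K. \<Prod>k<K. f n k) \<longlonglongrightarrow> m n" for n
  proof -
    have "summable (\<lambda>k. norm (f n k - 1))"
    proof (rule summable_comparison_test'[where N = 0])
      show "summable (\<lambda>k. 2 * pi * \<bar>of_int n\<bar> * ak k)" by (intro summable_mult aks)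
      show "norm (norm (f n k - 1)) \<le> 2 * pi * \<bar>of_int n\<bar> * ak k" for k
        using abs_rsinc_minus_1[of "2 * pi * ak k * of_int n"] ak[of k]
        by (simp add: f_def abs_mult mult_ac)
    qed
    then have "abs_convergent_prod (f n)" by (rule summable_imp_abs_convergent_prod)
    then have "convergent (\<lambda>K. \<Prod>k\<le>K. f n k)"
      by (intro convergent_prod_imp_convergent abs_convergent_prod_imp_convergent_prod)
    then have "convergent (\<lambda>K. \<Prod>k<Suc K. f n k)" by (simp add: lessThan_Suc_atMost)
    then have "convergent (\<lambda>K. \<Prod>k<K. f n k)" using convergent_Suc_iff[of "\<lambda>K. \<Prod>k<K. f n k"] by simp
    then show ?thesis unfolding m_def by (simp add: convergent_LIMSEQ_iff)
  qed
  have loc: "local_mult m a"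
  proof (rule local_mult_lim[OF conv _ aksum])
    show "local_mult (\<lambda>n. \<Prod>k<K. f n k) (\<Sum>k<K. ak k)" for K
      unfolding f_def by (intro local_mult_prod local_mult_rsinc less_imp_le ak)
  qed
  have f1: "\<bar>f n k\<bar> \<le> 1" for n k unfolding f_def by (rule abs_rsinc_le)
  have mK: "\<bar>m n\<bar> \<le> (\<Prod>k<K. \<bar>f n k\<bar>)" for n K
  proof (rule Lim_norm_ubound[OF _ conv, unfolded real_norm_def])
    show "\<forall>\<^sub>F J in sequentially. \<bar>\<Prod>k<J. f n k\<bar> \<le> (\<Prod>k<K. \<bar>f n k\<bar>)"
      using eventually_ge_at_top[of K]
    proof eventually_elim
      case (elim J)
      have "(\<Prod>k<J. \<bar>f n k\<bar>) = (\<Prod>k<K. \<bar>f n k\<bar>) * (\<Prod>k\<in>{K..<J}. \<bar>f n k\<bar>)"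
        using elim by (subst prod.union_disjoint[symmetric]) (auto intro!: prod.cong)
      also have "\<dots> \<le> (\<Prod>k<K. \<bar>f n k\<bar>)"
        by (intro mult_left_le prod_nonneg prod_le_1) (auto simp: f1)
      finally show ?case by (simp add: abs_prod)
    qed
  qed auto
  \<comment> \<open>A factor is at most \<open>1 / (2 * pi * ak k * \<bar>n\<bar>)\<close>. With
    this \<open>c\<close> that is at most \<open>1 / exp 1\<close> as long as
    \<open>real (Suc k) \<le> (c * \<bar>n\<bar>) powr \<theta>\<close>.\<close>
  define c where "c = 2 * pi * A / exp 1"
  have c: "c > 0" using A by (simp add: c_def)
  define D where "D = (1 / c powr \<theta>) powr (\<sigma> / (\<theta> - \<sigma>))"
  have "\<bar>m n\<bar> * exp_weight \<sigma> n \<le> exp (1 + D)" for n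
  proof -
    define x where "x = real_of_int \<bar>n\<bar>"
    have x: "x \<ge> 0" by (simp add: x_def)
    define K where "K = nat \<lfloor>(c * x) powr \<theta>\<rfloor>"
    have fk: "\<bar>f n k\<bar> \<le> exp (-1)" if k: "k < K" for k
    proof -
      have "real (Suc k) \<le> real K" using k by linarith
      also have "\<dots> \<le> (c * x) powr \<theta>" unfolding K_def by simp
      finally have le: "real (Suc k) \<le> (c * x) powr \<theta>" .
      have x0: "c * x > 0" using le by (cases "c * x = 0") (use c x in auto)
      have "real (Suc k) powr p \<le> ((c * x) powr \<theta>) powr p" using le p by (intro powr_mono2) auto
      also have "\<dots> = c * x" using th x0 by (simp add: powr_powr p_def)
      finally have "real (Suc k) powr p \<le> c * x" .
      then have "exp 1 \<le> 2 * pi * ak k * x"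
        unfolding c_def ak_def by (simp add: powr_minus field_simps)
      then have e: "exp 1 \<le> \<bar>2 * pi * ak k * of_int n\<bar>"
        using ak[of k] by (simp add: abs_mult x_def)
      have "\<bar>f n k\<bar> \<le> 1 / \<bar>2 * pi * ak k * of_int n\<bar>"
        unfolding f_def by (rule abs_rsinc_le) (use e in \<open>auto simp: not_le\<close>)
      also have "\<dots> \<le> 1 / exp 1" using e by (intro divide_left_mono) (auto intro!: mult_pos_pos less_le_trans[OF exp_gt_zero e])
      finally show ?thesis by (simp add: exp_minus inverse_eq_divide)
    qed
    have "\<bar>m n\<bar> \<le> (\<Prod>k<K. \<bar>f n k\<bar>)" by (rule mK)
    also have "\<dots> \<le> (\<Prod>k<K. exp (-1))" by (intro prod_mono) (use fk in auto)
    also have "\<dots> = exp (- real K)" by (simp add: exp_of_nat_mult[symmetric])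
    also have "\<dots> \<le> exp (1 - (c * x) powr \<theta>)" unfolding K_def by simp linarith
    finally have mn: "\<bar>m n\<bar> \<le> exp (1 - (c * x) powr \<theta>)" .
    have "x powr \<sigma> \<le> c powr \<theta> * x powr \<theta> + D"
      unfolding D_def using s th c x by (intro powr_le_interpolate) auto
    then have xs: "x powr \<sigma> \<le> (c * x) powr \<theta> + D" using c x by (simp add: powr_mult)
    have "\<bar>m n\<bar> * exp_weight \<sigma> n \<le> exp (1 - (c * x) powr \<theta>) * exp (x powr \<sigma>)"
      unfolding exp_weight_def x_def[symmetric] by (intro mult_right_mono mn) auto
    also have "\<dots> \<le> exp (1 + D)" using xs by (simp flip: exp_add)
    finally show ?thesis .
  qed
  then show ?thesis using loc by blast
qed

text \<open>Multiplying the coefficients by a rapid local multiplier regularises \<open>f\<close>,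
  while flat and linear pieces survive up to a margin \<open>a\<close>.\<close>

lemma wiener_smoothing:
  assumes s: "0 < \<sigma>" "\<sigma> < 1" and a: "a > 0" and f: "wiener (\<lambda>_. 1) f B"
  obtains g C where "wiener (exp_weight \<sigma>) g C"
    and "\<And>\<alpha> \<beta> x r y. (\<And>y. \<bar>y - x\<bar> \<le> r \<Longrightarrow> f (cis (2 * pi * y)) = \<alpha> + \<beta> * of_real y) \<Longrightarrow>
           \<bar>y - x\<bar> \<le> r - a \<Longrightarrow> g (cis (2 * pi * y)) = \<alpha> + \<beta> * of_real y"
proof -
  obtain m C where m: "local_mult m a" and C: "\<And>n. \<bar>m n\<bar> * exp_weight \<sigma> n \<le> C"
    using rapid_local_mult[OF s a] by blast
  have w: "is_weight (exp_weight \<sigma>)" using s by (intro is_weight_exp) auto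
  note fw = wiener_fourier_coeff[OF is_weight_one f]
  define c where "c = fourier_coeff f"
  have cs: "(\<lambda>n. norm (c n)) summable_on UNIV" using fw(1) by (simp add: c_def)
  define d where "d n = c n * of_real (m n)" for n
  define g where "g z = (\<Sum>\<^sub>\<infinity>n. d n * z powi n)" for z
  have cis_eq: "cis (2 * pi * y) powi n = cis (2 * pi * of_int n * y)" for n y
    by (simp add: cis_power_int mult_ac)
  have fy: "f (cis (2 * pi * y)) = trig c y" for y
    using infsumI[OF fw(3)[of "cis (2 * pi * y)"]] by (simp add: trig_def cis_eq c_def)
  have gy: "g (cis (2 * pi * y)) = trig d y" for y
    by (simp add: trig_def cis_eq g_def)
  have le: "norm (d n) * exp_weight \<sigma> n \<le> norm (c n) * C" for n
    using mult_left_mono[OF C[of n], of "norm (c n)"] by (simp add: d_def norm_mult mult.assoc)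
  have dw: "(\<lambda>n. norm (d n) * exp_weight \<sigma> n) summable_on UNIV"
    by (rule summable_on_comparison_test[OF summable_on_cmult_left[OF cs, of C]])
       (use le is_weight_pos[OF w] in \<open>auto intro!: mult_nonneg_nonneg intro: less_imp_le\<close>)
  have ds: "(\<lambda>n. norm (d n)) summable_on UNIV"
    by (rule weighted_abs_summable[OF w dw])
  have "wiener (exp_weight \<sigma>) g (\<Sum>\<^sub>\<infinity>n. norm (d n) * exp_weight \<sigma> n)"
  proof (rule wienerI[OF w dw order_refl])
    fix z :: complex assume z: "z \<in> unit_circle"
    show "((\<lambda>n. d n * z powi n) has_sum g z) UNIV"
      unfolding g_def by (rule has_sum_infsum, rule abs_summable_summable)
        (use ds norm_powi_unit[OF z] in \<open>simp add: norm_mult\<close>)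
  qed
  then show thesis
  proof (rule that)
    fix \<alpha> \<beta> x r y
    assume "\<And>y. \<bar>y - x\<bar> \<le> r \<Longrightarrow> f (cis (2 * pi * y)) = \<alpha> + \<beta> * of_real y" "\<bar>y - x\<bar> \<le> r - a"
    then show "g (cis (2 * pi * y)) = \<alpha> + \<beta> * of_real y"
      using local_multD(2)[OF m cs, of x r \<alpha> \<beta> y] by (simp add: fy gy d_def[abs_def])
  qed
qed

text \<open>\<open>t\<close> is the coordinate in a cell around a root of unity. The value
  \<open>1\<close> reaches beyond \<open>2/5\<close>, the range needed near \<open>E\<close>; and
  \<open>\<tau>\<close> is correct beyond the support of \<open>\<phi>\<close>, so that next to a
  factor \<open>\<phi>\<close> it may be read as \<open>t\<close>.\<close>

definition plateau :: "(complex \<Rightarrow> complex) \<Rightarrow> (complex \<Rightarrow> complex) \<Rightarrow> bool" where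
  "plateau \<phi> \<tau> \<longleftrightarrow>
     (\<forall>t. \<bar>t\<bar> \<le> 41/100 \<longrightarrow> \<phi> (cis (2 * pi * t)) = 1) \<and>
     (\<forall>t. 45/100 \<le> \<bar>t\<bar> \<longrightarrow> \<bar>t\<bar> \<le> 1/2 \<longrightarrow> \<phi> (cis (2 * pi * t)) = 0) \<and>
     (\<forall>t. \<bar>t\<bar> \<le> 47/100 \<longrightarrow> \<tau> (cis (2 * pi * t)) = of_real t)"

lemma cis_2pi_add_1: "cis (2 * pi * (t + 1)) = cis (2 * pi * t)" "cis (2 * pi * (t - 1)) = cis (2 * pi * t)"
  by (simp_all add: distrib_left right_diff_distrib complex_eq_iff cos_diff sin_diff)

lemma ex_plateau:
  assumes s: "0 < \<sigma>" "\<sigma> < 1"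
  shows "\<exists>\<phi> \<tau> B C. plateau \<phi> \<tau> \<and> wiener (exp_weight \<sigma>) \<phi> B \<and> wiener (exp_weight \<sigma>) \<tau> C"
proof -
  obtain B where B: "wiener (\<lambda>_. 1) parab B" using wiener_parab by blast
  have shift: "wiener (\<lambda>_. 1) (\<lambda>z. parab (cis (2 * pi * h) * z)) B" for h
    by (rule wiener_rotate[OF is_weight_one B]) auto
  have rot: "cis (2 * pi * h) * cis (2 * pi * t) = cis (2 * pi * (t + h))" for h t
    by (simp add: cis_mult distrib_left add.commute)
  \<comment> \<open>\<open>h\<^sup>2\<close> minus half the second difference of the parabola: the
    tent function of height and half-width \<open>h\<close>.\<close>
  define S where "S h z = of_real (h\<^sup>2) - 1/2 * (parab (cis (2 * pi * h) * z) + parab (cis (2 * pi * (-h)) * z) - 2 * parab z)"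
    for h z
  have S: "wiener (\<lambda>_. 1) (S h) (norm (of_real (h\<^sup>2) :: complex) * 1 + norm (1/2 :: complex) * (B + B + norm (2 :: complex) * B))" for h
    unfolding S_def by (intro wiener_diff wiener_cmult wiener_add wiener_const is_weight_one shift B order_refl)
  have S_val: "S h (cis (2 * pi * t)) = of_real (max (h - \<bar>t\<bar>) 0)" if "0 < h" "h < 1/2" "\<bar>t\<bar> \<le> 1/2" for h t
  proof -
    have "S h (cis (2 * pi * t)) = of_real (h\<^sup>2 - 1/2 * (((t + h)\<^sup>2 - \<bar>t + h\<bar>) + ((t - h)\<^sup>2 - \<bar>t - h\<bar>) - 2 * (t\<^sup>2 - \<bar>t\<bar>)))"
      unfolding S_def rot using that by (simp add: parab_cis)
    also have "h\<^sup>2 - 1/2 * (((t + h)\<^sup>2 - \<bar>t + h\<bar>) + ((t - h)\<^sup>2 - \<bar>t - h\<bar>) - 2 * (t\<^sup>2 - \<bar>t\<bar>)) = (\<bar>t + h\<bar> + \<bar>t - h\<bar> - 2 * \<bar>t\<bar>) / 2"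
      by (simp add: power2_eq_square algebra_simps)
    also have "\<dots> = max (h - \<bar>t\<bar>) 0" using that by (simp add: max_def abs_if)
    finally show ?thesis .
  qed
  \<comment> \<open>A difference of tents is a trapezoid, and
    \<open>50 = 1 / (44/100 - 42/100)\<close> gives it height \<open>1\<close>. Smoothing with loss
    \<open>1/100\<close> shrinks its flat parts to the ranges in \<open>plateau\<close>.\<close>
  define \<phi>0 where "\<phi>0 z = 50 * (S (44/100) z - S (42/100) z)" for z
  obtain B\<phi> where B\<phi>: "wiener (\<lambda>_. 1) \<phi>0 B\<phi>"
    using wiener_cmult[OF is_weight_one wiener_diff[OF is_weight_one S S], of 50] unfolding \<phi>0_def by blast
  \<comment> \<open>For \<open>\<bar>t\<bar> \<le> 48/100\<close> both shifts stay on one branch of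
    the parabola, so their difference is linear. It equals \<open>t / 25\<close>, without constant
    term because the shifts are symmetric about \<open>1/2\<close>.\<close>
  define \<tau>0 where "\<tau>0 z = 25 * (parab (cis (2 * pi * (51/100)) * z) - parab (cis (2 * pi * (49/100)) * z))" for z
  obtain B\<tau> where B\<tau>: "wiener (\<lambda>_. 1) \<tau>0 B\<tau>"
    using wiener_cmult[OF is_weight_one wiener_diff[OF is_weight_one shift shift], of 25] unfolding \<tau>0_def by blast
  obtain \<phi> C\<phi> where \<phi>: "wiener (exp_weight \<sigma>) \<phi> C\<phi>"
    "\<And>\<alpha> \<beta> x r y. (\<And>y. \<bar>y - x\<bar> \<le> r \<Longrightarrow> \<phi>0 (cis (2 * pi * y)) = \<alpha> + \<beta> * of_real y) \<Longrightarrow>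
           \<bar>y - x\<bar> \<le> r - 1/100 \<Longrightarrow> \<phi> (cis (2 * pi * y)) = \<alpha> + \<beta> * of_real y"
    using wiener_smoothing[OF s _ B\<phi>, of "1/100"] by auto
  obtain \<tau> C\<tau> where \<tau>: "wiener (exp_weight \<sigma>) \<tau> C\<tau>"
    "\<And>\<alpha> \<beta> x r y. (\<And>y. \<bar>y - x\<bar> \<le> r \<Longrightarrow> \<tau>0 (cis (2 * pi * y)) = \<alpha> + \<beta> * of_real y) \<Longrightarrow>
           \<bar>y - x\<bar> \<le> r - 1/100 \<Longrightarrow> \<tau> (cis (2 * pi * y)) = \<alpha> + \<beta> * of_real y"
    using wiener_smoothing[OF s _ B\<tau>, of "1/100"] by auto
  have \<phi>0_val: "\<phi>0 (cis (2 * pi * t)) = of_real (50 * (max (44/100 - \<bar>t\<bar>) 0 - max (42/100 - \<bar>t\<bar>) 0))"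
    if "\<bar>t\<bar> \<le> 1/2" for t
    unfolding \<phi>0_def using that by (simp add: S_val)
  have 1: "\<phi> (cis (2 * pi * t)) = 1" if "\<bar>t\<bar> \<le> 41/100" for t
  proof -
    have "\<phi>0 (cis (2 * pi * y)) = 1 + 0 * of_real y" if "\<bar>y - 0\<bar> \<le> 42/100" for y
      using that by (subst \<phi>0_val) auto
    from \<phi>(2)[where x = 0 and r = "42/100", OF this, of t] show ?thesis using that by simp
  qed
  \<comment> \<open>The zero region is an interval around \<open>t = 1/2\<close>, so it must be
    treated across the end of the period.\<close>
  have 20: "\<phi> (cis (2 * pi * t)) = 0" if "45/100 \<le> t" "t \<le> 55/100" for t
  proof -
    have "\<phi>0 (cis (2 * pi * y)) = 0 + 0 * of_real y" if "\<bar>y - 1/2\<bar> \<le> 6/100" for y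
    proof (cases "y \<le> 1/2")
      case True
      then show ?thesis using that by (subst \<phi>0_val) auto
    next
      case False
      have "\<phi>0 (cis (2 * pi * (y - 1))) = 0" using that False by (subst \<phi>0_val) auto
      then show ?thesis by (simp add: cis_2pi_add_1)
    qed
    from \<phi>(2)[where x = "1/2" and r = "6/100", OF this, of t] show ?thesis using that by (auto simp: abs_if split: if_splits)
  qed
  have 2: "\<phi> (cis (2 * pi * t)) = 0" if "45/100 \<le> \<bar>t\<bar>" "\<bar>t\<bar> \<le> 1/2" for t
  proof (cases "t \<ge> 0")
    case True
    then show ?thesis using 20[of t] that by simp
  next
    case False
    then show ?thesis using 20[of "t + 1"] that by (simp add: cis_2pi_add_1)
  qed
  have 3: "\<tau> (cis (2 * pi * t)) = of_real t" if "\<bar>t\<bar> \<le> 47/100" for t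
  proof -
    have "\<tau>0 (cis (2 * pi * y)) = 0 + 1 * of_real y" if "\<bar>y - 0\<bar> \<le> 48/100" for y
    proof -
      have "\<tau>0 (cis (2 * pi * y)) = of_real (25 * (((y + 51/100)\<^sup>2 - \<bar>y + 51/100\<bar>) - ((y + 49/100)\<^sup>2 - \<bar>y + 49/100\<bar>)))"
        unfolding \<tau>0_def rot using that by (simp add: parab_cis)
      also have "\<bar>y + 51/100\<bar> = y + 51/100" using that by linarith
      also have "\<bar>y + 49/100\<bar> = y + 49/100" using that by linarith
      also have "25 * (((y + 51/100)\<^sup>2 - (y + 51/100)) - ((y + 49/100)\<^sup>2 - (y + 49/100))) = y"
        by (simp add: power2_eq_square algebra_simps)
      finally show ?thesis by simp
    qed
    from \<tau>(2)[where x = 0 and r = "48/100", OF this, of t] show ?thesis using that by simp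
  qed
  show ?thesis unfolding plateau_def using 1 2 3 \<phi>(1) \<tau>(1) by blast
qed

section \<open>The Cantor set\<close>

locale cantor =
  fixes q :: nat
  assumes q3: "3 \<le> q"
begin

definition digits :: "(nat \<Rightarrow> real) \<Rightarrow> bool" where
  "digits \<epsilon> \<longleftrightarrow> (\<forall>n. \<epsilon> n \<in> {0, 1})"

text \<open>The factor normalises the range to lie in \<open>[0, 1]\<close>, so that
  \<open>X\<close> is a fraction of a full turn. Digits are numbered from \<open>0\<close>
  here.\<close>

definition X :: "(nat \<Rightarrow> real) \<Rightarrow> real" where
  "X \<epsilon> = (1 - 1 / q) * (\<Sum>n. \<epsilon> n * (1 / q) ^ n)"

abbreviation E :: "complex set" where
  "E \<equiv> cantor_set (1 / q)"

lemma q_gt: "1 / real q < 1" "0 < 1 / real q" "1 / real q \<le> 1/3" "0 < real q" "1 < real q"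
  using q3 by (auto simp: field_simps)

lemma digits_shift: "digits \<epsilon> \<Longrightarrow> digits (\<lambda>n. \<epsilon> (n + k))"
  by (simp add: digits_def)

lemma summable_digits: "digits \<epsilon> \<Longrightarrow> summable (\<lambda>n. \<epsilon> n * (1 / q) ^ n)"
proof (rule summable_comparison_test'[where N = 0])
  show "summable (\<lambda>n. (1 / real q) ^ n)" using q_gt by (intro summable_geometric) auto
  show "digits \<epsilon> \<Longrightarrow> norm (\<epsilon> n * (1 / q) ^ n) \<le> (1 / real q) ^ n" for n
    by (cases "\<epsilon> n = 0") (auto simp: digits_def)
qed

lemma X_rec: "digits \<epsilon> \<Longrightarrow> X \<epsilon> = (1 - 1 / q) * \<epsilon> 0 + X (\<lambda>n. \<epsilon> (Suc n)) / q"
proof -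
  assume d: "digits \<epsilon>"
  have s: "summable (\<lambda>n. \<epsilon> (Suc n) * (1 / q) ^ n)"
    using summable_digits[OF digits_shift[OF d, of 1]] by simp
  have "(\<Sum>n. \<epsilon> n * (1 / q) ^ n) = \<epsilon> 0 + (\<Sum>n. \<epsilon> (Suc n) * (1 / q) ^ Suc n)"
    using suminf_split_head[OF summable_digits[OF d]] by simp
  also have "(\<Sum>n. \<epsilon> (Suc n) * (1 / q) ^ Suc n) = (\<Sum>n. (1 / q) * (\<epsilon> (Suc n) * (1 / q) ^ n))"
    by (simp add: mult_ac)
  also have "\<dots> = (1 / q) * (\<Sum>n. \<epsilon> (Suc n) * (1 / q) ^ n)"
    by (rule suminf_mult[OF s])
  finally show ?thesis by (simp add: X_def distrib_left mult.left_commute)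
qed

lemma X_nonneg: "digits \<epsilon> \<Longrightarrow> 0 \<le> X \<epsilon>"
proof -
  assume d: "digits \<epsilon>"
  have "0 \<le> \<epsilon> n" for n using d by (cases "\<epsilon> n = 0") (auto simp: digits_def)
  then show ?thesis
    unfolding X_def using q_gt by (intro mult_nonneg_nonneg suminf_nonneg summable_digits[OF d]) auto
qed

lemma X_le_1: "digits \<epsilon> \<Longrightarrow> X \<epsilon> \<le> 1"
proof -
  assume d: "digits \<epsilon>"
  have g: "(\<lambda>n. (1 / real q) ^ n) sums (1 / (1 - 1 / q))" using q_gt by (intro geometric_sums) auto
  have "(\<Sum>n. \<epsilon> n * (1 / q) ^ n) \<le> (\<Sum>n. (1 / real q) ^ n)"
  proof (rule suminf_le[OF _ summable_digits[OF d] sums_summable[OF g]])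
    show "\<epsilon> n * (1 / q) ^ n \<le> (1 / real q) ^ n" for n
      using d by (cases "\<epsilon> n = 0") (auto simp: digits_def)
  qed
  also have "\<dots> = 1 / (1 - 1 / q)" using g by (simp add: sums_iff)
  finally have "X \<epsilon> \<le> (1 - 1 / q) * (1 / (1 - 1 / q))"
    unfolding X_def using q_gt by (intro mult_left_mono) auto
  then show ?thesis using q_gt by simp
qed

lemma X_const: "X (\<lambda>_. b) = b"
proof -
  have "(\<lambda>n. (1 / real q) ^ n) sums (1 / (1 - 1 / q))" using q_gt by (intro geometric_sums) auto
  then have "(\<lambda>n. b * (1 / real q) ^ n) sums (b * (1 / (1 - 1 / q)))" by (rule sums_mult)
  then show ?thesis unfolding X_def using q_gt by (simp add: sums_iff)
qed

text \<open>Each multiplication by \<open>q\<close> sheds \<open>(q - 1) * \<epsilon> k\<close>, an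
  integer because \<open>q\<close> is one. This is the self-similarity: on the circle, shifting
  digits is a power map.\<close>

lemma X_shift: "digits \<epsilon> \<Longrightarrow> \<exists>m::int. q ^ k * X \<epsilon> = of_int m + X (\<lambda>n. \<epsilon> (n + k))"
proof (induction k)
  case 0
  show ?case by (intro exI[of _ 0]) simp
next
  case (Suc k)
  then obtain m :: int where m: "q ^ k * X \<epsilon> = of_int m + X (\<lambda>n. \<epsilon> (n + k))" by blast
  have "q * X (\<lambda>n. \<epsilon> (n + k)) = (q - 1) * \<epsilon> k + X (\<lambda>n. \<epsilon> (n + Suc k))"
  proof -
    have "real q * (1 - 1 / q) = real (q - 1)" using q3 by (simp add: right_diff_distrib of_nat_diff)
    then have "real q * ((1 - 1 / q) * \<epsilon> k) = real (q - 1) * \<epsilon> k" by (simp add: mult.assoc[symmetric])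
    then show ?thesis
      using X_rec[OF digits_shift[OF Suc.prems, of k]] q_gt by (simp add: distrib_left)
  qed
  moreover have "real q ^ Suc k * X \<epsilon> = q * (q ^ k * X \<epsilon>)" by simp
  ultimately have e: "real q ^ Suc k * X \<epsilon> = q * of_int m + (q - 1) * \<epsilon> k + X (\<lambda>n. \<epsilon> (n + Suc k))"
    unfolding m by (simp add: distrib_left)
  have "\<epsilon> k = 0 \<or> \<epsilon> k = 1" using Suc.prems by (simp add: digits_def)
  then show ?case
  proof
    assume "\<epsilon> k = 0"
    then show ?thesis using e by (intro exI[of _ "int q * m"]) simp
  next
    assume "\<epsilon> k = 1"
    then show ?thesis using e q3 by (intro exI[of _ "int q * m + (int q - 1)"]) (simp add: of_nat_diff)
  qed
qed

lemma X_diff: "digits \<epsilon> \<Longrightarrow> digits \<delta> \<Longrightarrow> (\<And>n. n < k \<Longrightarrow> \<epsilon> n = \<delta> n) \<Longrightarrow>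
    X \<epsilon> - X \<delta> = (X (\<lambda>n. \<epsilon> (n + k)) - X (\<lambda>n. \<delta> (n + k))) / q ^ k"
proof (induction k arbitrary: \<epsilon> \<delta>)
  case (Suc k)
  have d: "digits (\<lambda>n. \<epsilon> (Suc n))" "digits (\<lambda>n. \<delta> (Suc n))"
    using digits_shift[of \<epsilon> 1] digits_shift[of \<delta> 1] Suc.prems by simp_all
  have "X \<epsilon> - X \<delta> = (X (\<lambda>n. \<epsilon> (Suc n)) - X (\<lambda>n. \<delta> (Suc n))) / q"
    using X_rec[OF Suc.prems(1)] X_rec[OF Suc.prems(2)] Suc.prems(3)[of 0] by (simp add: diff_divide_distrib)
  also have "X (\<lambda>n. \<epsilon> (Suc n)) - X (\<lambda>n. \<delta> (Suc n)) =
     (X (\<lambda>n. \<epsilon> (Suc (n + k))) - X (\<lambda>n. \<delta> (Suc (n + k)))) / q ^ k"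
    by (rule Suc.IH[OF d]) (use Suc.prems in auto)
  finally show ?case by simp
qed simp

lemma E_eq: "E = {cis (2 * pi * X \<epsilon>) | \<epsilon>. digits \<epsilon>}"
proof -
  have eq: "exp (2 * \<i> * of_real pi * of_real (1 - 1 / q) * of_real (\<Sum>n. \<epsilon> (Suc n) * (1 / q) ^ n))
      = cis (2 * pi * X (\<lambda>n. \<epsilon> (Suc n)))" for \<epsilon>
    unfolding cis_conv_exp X_def by (simp only: of_real_mult of_real_numeral mult_ac)
  show ?thesis
  proof (intro subset_antisym subsetI)
    fix z assume "z \<in> E"
    then obtain \<epsilon> where "z = cis (2 * pi * X (\<lambda>n. \<epsilon> (Suc n)))" "\<forall>n\<ge>1. \<epsilon> n \<in> {0, 1::real}"
      unfolding cantor_set_def eq by blast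
    then show "z \<in> {cis (2 * pi * X \<epsilon>) | \<epsilon>. digits \<epsilon>}" by (auto simp: digits_def intro!: exI[of _ "\<lambda>n. \<epsilon> (Suc n)"])
  next
    fix z assume "z \<in> {cis (2 * pi * X \<epsilon>) | \<epsilon>. digits \<epsilon>}"
    then obtain \<epsilon> where "z = cis (2 * pi * X \<epsilon>)" "digits \<epsilon>" by blast
    then show "z \<in> E"
      unfolding cantor_set_def eq by (auto simp: digits_def intro!: exI[of _ "\<lambda>n. \<epsilon> (n - 1)"])
  qed
qed

lemma E_circle: "E \<subseteq> unit_circle"
  unfolding E_eq by auto

lemma cis_X_power: "digits \<epsilon> \<Longrightarrow> cis (2 * pi * X \<epsilon>) ^ (q ^ k) = cis (2 * pi * X (\<lambda>n. \<epsilon> (n + k)))"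
proof -
  assume "digits \<epsilon>"
  then obtain m :: int where m: "q ^ k * X \<epsilon> = of_int m + X (\<lambda>n. \<epsilon> (n + k))" using X_shift by blast
  have "cis (2 * pi * X \<epsilon>) ^ (q ^ k) = cis (real (q ^ k) * (2 * pi * X \<epsilon>))" by (rule Complex.DeMoivre)
  also have "real (q ^ k) * (2 * pi * X \<epsilon>) = 2 * pi * (q ^ k * X \<epsilon>)" by simp
  also have "\<dots> = of_int m * (2 * pi) + 2 * pi * X (\<lambda>n. \<epsilon> (n + k))" unfolding m by (simp add: algebra_simps)
  finally show ?thesis by (simp add: cis_mult[symmetric] flip: cis_power_int)
qed

text \<open>A list of \<open>k + 1\<close> digits with the last one repeated for ever encodes an
  endpoint of an interval of level \<open>k\<close>. A constant tail has \<open>X\<close>-value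
  \<open>0\<close> or \<open>1\<close>, which makes these points roots of unity of order dividing
  \<open>q ^ k\<close>.\<close>

definition G :: "nat \<Rightarrow> complex set" where
  "G k = (\<lambda>l. cis (2 * pi * X (\<lambda>n. l ! min n k))) ` {l. set l \<subseteq> {0, 1} \<and> length l = Suc k}"

lemma G_obtain:
  assumes "e \<in> G k"
  obtains l where "e = cis (2 * pi * X (\<lambda>n. l ! min n k))" "set l \<subseteq> {0, 1}" "length l = Suc k"
    "digits (\<lambda>n. l ! min n k)"
proof -
  obtain l where l: "e = cis (2 * pi * X (\<lambda>n. l ! min n k))" "set l \<subseteq> {0, 1}" "length l = Suc k"
    using assms unfolding G_def by auto
  have "l ! min n k \<in> set l" for n using l(3) by (intro nth_mem) auto
  then have "digits (\<lambda>n. l ! min n k)" using l(2) by (auto simp: digits_def)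
  with l that show thesis by blast
qed

lemma finite_G: "finite (G k)"
  unfolding G_def by (intro finite_imageI finite_lists_length_eq) auto

lemma card_G: "card (G k) \<le> 2 ^ Suc k"
proof -
  have "card (G k) \<le> card {l. set l \<subseteq> {0, 1::real} \<and> length l = Suc k}"
    unfolding G_def by (intro card_image_le finite_lists_length_eq) auto
  also have "\<dots> = 2 ^ Suc k" by (subst card_lists_length_eq) (simp_all add: numeral_2_eq_2)
  finally show ?thesis .
qed

lemma G_subset_E: "G k \<subseteq> E"
  unfolding E_eq by (auto elim!: G_obtain)

lemma G_circle: "e \<in> G k \<Longrightarrow> e \<in> unit_circle"
  using G_subset_E E_circle by blast

lemma G_root: "e \<in> G k \<Longrightarrow> e ^ (q ^ k) = 1"
proof (elim G_obtain)
  fix l assume l: "e = cis (2 * pi * X (\<lambda>n. l ! min n k))" "digits (\<lambda>n. l ! min n k)"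
  have "e ^ (q ^ k) = cis (2 * pi * (l ! k))"
    unfolding l(1) cis_X_power[OF l(2)] by (simp add: X_const)
  moreover have "l ! k = 0 \<or> l ! k = 1" using l(2) by (auto simp: digits_def dest: spec[of _ k])
  ultimately show "e ^ (q ^ k) = 1" by auto
qed

text \<open>Raising to the power \<open>q ^ j\<close> drops the first \<open>j\<close>
  digits.\<close>

lemma G_power: "e \<in> G (k + j) \<Longrightarrow> e ^ (q ^ j) \<in> G k"
proof (elim G_obtain)
  fix l assume l: "e = cis (2 * pi * X (\<lambda>n. l ! min n (k + j)))" "set l \<subseteq> {0, 1}" "length l = Suc (k + j)"
     "digits (\<lambda>n. l ! min n (k + j))"
  have "l ! min (n + j) (k + j) = drop j l ! min n k" for n
    using l(3) by (auto simp: min_def add.commute)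
  then have "e ^ (q ^ j) = cis (2 * pi * X (\<lambda>n. drop j l ! min n k))"
    unfolding l(1) cis_X_power[OF l(4)] by simp
  moreover have "set (drop j l) \<subseteq> {0, 1}" using l(2) set_drop_subset by fast
  ultimately show "e ^ (q ^ j) \<in> G k"
    unfolding G_def using l(3) by (intro image_eqI[of _ _ "drop j l"]) auto
qed

text \<open>The grid point takes the first \<open>k + 1\<close> digits of \<open>z\<close> and repeats the last of them.\<close>

lemma G_cover:
  assumes "z \<in> E"
  obtains e t where "e \<in> G k" "\<bar>t\<bar> \<le> 1 / real q" "z = e * cis (2 * pi * t / q ^ k)"
proof -
  obtain \<epsilon> where z: "z = cis (2 * pi * X \<epsilon>)" and d: "digits \<epsilon>" using assms unfolding E_eq by blast
  define l where "l = map \<epsilon> [0..<Suc k]"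
  have l: "l ! min n k = \<epsilon> (min n k)" for n unfolding l_def by (subst nth_map) (auto simp del: upt_Suc)
  define e where "e = cis (2 * pi * X (\<lambda>n. \<epsilon> (min n k)))"
  have "e \<in> G k"
    unfolding G_def e_def
  proof (rule image_eqI[of _ _ l])
    show "cis (2 * pi * X (\<lambda>n. \<epsilon> (min n k))) = cis (2 * pi * X (\<lambda>n. l ! min n k))" by (simp add: l)
    show "l \<in> {l. set l \<subseteq> {0, 1} \<and> length l = Suc k}" using d by (auto simp: digits_def l_def)
  qed
  have d': "digits (\<lambda>n. \<epsilon> (min n k))" using d by (simp add: digits_def)
  define t where "t = X (\<lambda>n. \<epsilon> (n + k)) - \<epsilon> k"
  have "X \<epsilon> - X (\<lambda>n. \<epsilon> (min n k)) = t / q ^ k"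
    using X_diff[OF d d', of k] by (simp add: t_def X_const)
  then have "X \<epsilon> = X (\<lambda>n. \<epsilon> (min n k)) + t / q ^ k" by simp
  then have "2 * pi * X \<epsilon> = 2 * pi * X (\<lambda>n. \<epsilon> (min n k)) + 2 * pi * t / q ^ k"
    by (simp add: distrib_left)
  then have "z = e * cis (2 * pi * t / q ^ k)"
    unfolding z e_def by (simp add: cis_mult)
  moreover have "\<bar>t\<bar> \<le> 1 / q"
  proof -
    define Y where "Y = X (\<lambda>n. \<epsilon> (n + Suc k))"
    have Y: "0 \<le> Y" "Y \<le> 1" unfolding Y_def by (intro X_nonneg X_le_1 digits_shift d)+
    \<comment> \<open>\<open>e\<close> shares the digit \<open>\<epsilon> k\<close> as well, and
      this further digit gains the factor \<open>1 / q\<close>.\<close>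
    have "t = (Y - \<epsilon> k) / q"
      unfolding t_def Y_def using X_rec[OF digits_shift[OF d, of k]] by (simp add: left_diff_distrib diff_divide_distrib)
    moreover have "\<bar>Y - \<epsilon> k\<bar> \<le> 1" using Y d by (cases "\<epsilon> k = 0") (auto simp: digits_def)
    ultimately show ?thesis by (simp add: abs_divide divide_right_mono)
  qed
  ultimately show thesis using that \<open>e \<in> G k\<close> by blast
qed

text \<open>Flipping digit \<open>j\<close> moves the point by \<open>(1 - 1 / q) / q ^ j\<close> of
  a turn, up to sign.\<close>

lemma E_perfect:
  assumes "z \<in> E"
  obtains h :: "nat \<Rightarrow> real" where "\<And>j. h j \<noteq> 0" "\<And>j. z * cis (h j) \<in> E" "h \<longlonglongrightarrow> 0"
proof -
  obtain \<epsilon> where z: "z = cis (2 * pi * X \<epsilon>)" and d: "digits \<epsilon>" using assms unfolding E_eq by blast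
  define \<delta> where "\<delta> j = \<epsilon>(j := 1 - \<epsilon> j)" for j
  have d': "digits (\<delta> j)" for j using d by (auto simp: digits_def \<delta>_def)
  define h where "h j = 2 * pi * (X (\<delta> j) - X \<epsilon>)" for j
  have *: "X (\<delta> j) - X \<epsilon> = (1 - 1 / q) * (1 - 2 * \<epsilon> j) / q ^ j" for j
  proof -
    have "X (\<lambda>n. \<delta> j (n + j)) - X (\<lambda>n. \<epsilon> (n + j)) = (1 - 1 / q) * (1 - 2 * \<epsilon> j)"
      unfolding X_rec[OF digits_shift[OF d'[of j], of j]] X_rec[OF digits_shift[OF d, of j]]
      by (simp add: \<delta>_def) (simp add: algebra_simps diff_divide_distrib)
    moreover have "X (\<delta> j) - X \<epsilon> = (X (\<lambda>n. \<delta> j (n + j)) - X (\<lambda>n. \<epsilon> (n + j))) / q ^ j"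
      by (rule X_diff[OF d' d]) (simp add: \<delta>_def)
    ultimately show ?thesis by simp
  qed
  have e: "\<bar>1 - 2 * \<epsilon> j\<bar> = 1" for j using d by (cases "\<epsilon> j = 0") (auto simp: digits_def)
  show thesis
  proof (rule that)
    show "h j \<noteq> 0" for j using q_gt e[of j] unfolding h_def * by auto
    show "z * cis (h j) \<in> E" for j
    proof -
      have "z * cis (h j) = cis (2 * pi * X (\<delta> j))" unfolding z h_def cis_mult by (simp add: algebra_simps)
      then show ?thesis unfolding E_eq using d' by blast
    qed
    have "(\<lambda>j. 2 * pi * (1 - 1 / q) * (1 / real q) ^ j) \<longlonglongrightarrow> 2 * pi * (1 - 1 / q) * 0"
      using q_gt by (intro tendsto_mult tendsto_const LIMSEQ_realpow_zero) auto
    then have lim: "(\<lambda>j. 2 * pi * (1 - 1 / q) * (1 / real q) ^ j) \<longlonglongrightarrow> 0" by simp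
    have "norm (h j) = 2 * pi * (1 - 1 / q) * (1 / real q) ^ j" for j
    proof -
      have "norm (h j) = 2 * pi * (\<bar>1 - 1 / real q\<bar> * \<bar>1 - 2 * \<epsilon> j\<bar> / real q ^ j)"
        unfolding h_def * by (simp add: abs_mult)
      also have "\<bar>1 - 1 / real q\<bar> = 1 - 1 / real q" using q_gt by simp
      finally show ?thesis unfolding e by (simp add: power_one_over)
    qed
    then have "\<forall>\<^sub>F j in sequentially. norm (h j) \<le> 2 * pi * (1 - 1 / q) * (1 / real q) ^ j"
      by simp
    then show "h \<longlonglongrightarrow> 0" using lim by (rule Lim_null_comparison)
  qed
qed

text \<open>Points near \<open>E\<close> lie well inside the cells of the grid points, because \<open>1 / q < 2 / 5\<close>.\<close>

lemma vanishing_near_E: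
  assumes f: "\<And>e t. e \<in> G k \<Longrightarrow> \<bar>t\<bar> \<le> 2/5 \<Longrightarrow> f (e * cis (2 * pi * t / q ^ k)) = 0"
  shows "\<exists>U. openin (top_of_set unit_circle) U \<and> E \<subseteq> U \<and> (\<forall>z\<in>U. f z = 0)"
proof -
  have "isCont Arg 1" by (rule continuous_at_Arg) simp
  \<comment> \<open>The angle is \<open>1/15\<close> of a cell, and
    \<open>1/3 + 1/15 = 2/5\<close>.\<close>
  then obtain \<delta> where \<delta>: "\<delta> > 0" "\<And>u. dist u 1 < \<delta> \<Longrightarrow> dist (Arg u) (Arg 1) < 2 * pi / (15 * q ^ k)"
    unfolding continuous_at_eps_delta using q_gt
    by (elim allE[of _ "2 * pi / (15 * q ^ k)"]) auto
  define U where "U = unit_circle \<inter> (\<Union>z\<in>E. ball z \<delta>)"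
  have "openin (top_of_set unit_circle) U" unfolding U_def by (intro openin_open_Int) auto
  moreover have "E \<subseteq> U" using E_circle \<delta>(1) by (auto simp: U_def)
  moreover have "f z = 0" if zU: "z \<in> U" for z
  proof -
    obtain z0 where z0: "z0 \<in> E" "dist z0 z < \<delta>" and z: "norm z = 1" using zU by (auto simp: U_def)
    have nz0: "norm z0 = 1" using E_circle z0 by auto
    define u where "u = z / z0"
    have "z0 \<noteq> 0" using nz0 by auto
    then have "u - 1 = (z - z0) / z0" by (simp add: u_def diff_divide_distrib)
    then have "dist u 1 = dist z0 z" using nz0 by (simp add: dist_norm norm_divide norm_minus_commute)
    then have au: "\<bar>Arg u\<bar> < 2 * pi / (15 * q ^ k)" using \<delta>(2)[of u] z0 by (simp add: dist_norm)
    have nu: "norm u = 1" using z nz0 by (simp add: u_def norm_divide)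
    then have "u = cis (Arg u)" using cis_Arg[of u] by (cases "u = 0") (simp_all add: sgn_div_norm)
    obtain e t where et: "e \<in> G k" "\<bar>t\<bar> \<le> 1 / real q" "z0 = e * cis (2 * pi * t / q ^ k)"
      by (rule G_cover[OF z0(1)])
    define s where "s = Arg u * q ^ k / (2 * pi)"
    have "\<bar>s\<bar> = \<bar>Arg u\<bar> * q ^ k / (2 * pi)" using q_gt by (simp add: s_def abs_mult)
    also have "\<dots> < (2 * pi / (15 * q ^ k)) * q ^ k / (2 * pi)"
      using au q_gt by (intro divide_strict_right_mono mult_strict_right_mono) auto
    also have "\<dots> = 1/15" using q_gt by simp
    finally have s: "\<bar>s\<bar> < 1/15" .
    have "Arg u = 2 * pi * s / q ^ k" using q_gt by (simp add: s_def)
    then have "z = e * cis (2 * pi * t / q ^ k) * cis (2 * pi * s / q ^ k)"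
    proof -
      have "z = z0 * u" using \<open>z0 \<noteq> 0\<close> by (simp add: u_def)
      also have "\<dots> = z0 * cis (2 * pi * s / q ^ k)"
        using \<open>u = cis (Arg u)\<close> \<open>Arg u = _\<close> by simp
      finally show ?thesis by (simp add: et(3))
    qed
    also have "\<dots> = e * cis (2 * pi * (t + s) / q ^ k)"
      by (simp add: cis_mult add_divide_distrib distrib_left mult.assoc)
    finally have "z = e * cis (2 * pi * (t + s) / q ^ k)" .
    moreover have "\<bar>t + s\<bar> \<le> 2/5" using et(2) s q_gt(3) by linarith
    ultimately show ?thesis using f[OF et(1)] by simp
  qed
  ultimately show ?thesis by blast
qed

end

lemma circle_grid:
  assumes z: "z \<in> unit_circle" and M: "M > 0"
  obtains e t where "e ^ M = 1" "e \<in> unit_circle" "\<bar>t\<bar> \<le> 1/2" "z = e * cis (2 * pi * t / real M)"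
proof -
  define x where "x = Arg z / (2 * pi)"
  have "z \<noteq> 0" using z by auto
  then have zx: "z = cis (2 * pi * x)" using z cis_Arg[of z] by (simp add: sgn_div_norm x_def)
  define j where "j = round (M * x)"
  define t where "t = M * x - j"
  define e where "e = cis (2 * pi * j / M)"
  have "real M * (2 * pi * of_int j / real M) = 2 * pi * of_int j" using M by simp
  then have "e ^ M = cis (2 * pi * of_int j)" unfolding e_def Complex.DeMoivre by (rule arg_cong)
  then have "e ^ M = 1" by (simp add: cis_multiple_2pi)
  moreover have "\<bar>t\<bar> \<le> 1/2" using of_int_round_abs_le[of "M * x"] by (simp add: t_def j_def abs_minus_commute)
  moreover have "z = e * cis (2 * pi * t / M)"
  proof -
    have "t / M = x - of_int j / M" using M by (simp add: t_def diff_divide_distrib)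
    then have "2 * pi * (of_int j / M) + 2 * pi * (t / M) = 2 * pi * x" by (simp add: right_diff_distrib)
    then show ?thesis unfolding zx e_def cis_mult by simp
  qed
  ultimately show thesis using that[of e t] by (simp add: e_def)
qed

section \<open>Bump functions at grid points\<close>

text \<open>\<open>\<phi> (z powi M)\<close> is a cutoff around all \<open>M\<close>-th roots of
  unity; the mean over the characters \<open>r\<close> of their group isolates the cell of
  \<open>e\<close>. Indeed, in the cell of \<open>e'\<close>, removing the angle
  \<open>2 * pi * t / M\<close> from \<open>z\<close> leaves \<open>e'\<close>, and the mean of
  \<open>(cnj e * e') ^ r\<close> is \<open>1\<close> or \<open>0\<close>.\<close>

definition bump :: "(complex \<Rightarrow> complex) \<Rightarrow> (complex \<Rightarrow> complex) \<Rightarrow> nat \<Rightarrow> complex \<Rightarrow> complex \<Rightarrow> complex" where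
  "bump \<phi> \<tau> M e z = (\<Sum>r<M. (cnj e ^ r / of_nat M) *
      (z powi int r * (\<phi> (z powi int M) * exp (- (2 * pi * \<i> * (of_nat r / of_nat M) * \<tau> (z powi int M))))))"

lemma grid_power:
  assumes "M > 0" "e ^ M = 1"
  shows "(e * cis (2 * pi * t / real M)) ^ M = cis (2 * pi * t)"
proof -
  have "real M * (2 * pi * t / real M) = 2 * pi * t" using assms by simp
  then show ?thesis using assms by (simp only: power_mult_distrib Complex.DeMoivre mult_1_left)
qed

lemma exp_ii_eq_cis: "exp (- (2 * pi * \<i> * x * of_real t)) = cis (- (2 * pi * y * t))"
  if "x = of_real y"
  by (simp add: cis_conv_exp that mult_ac)

lemma bump_value:
  assumes p: "plateau \<phi> \<tau>" and M: "M > 0" and e: "e ^ M = 1" "e \<in> unit_circle"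
    and e': "e' ^ M = 1" "e' \<in> unit_circle" and t: "\<bar>t\<bar> \<le> 1/2"
  shows "bump \<phi> \<tau> M e (e' * cis (2 * pi * t / real M)) = (if e = e' then \<phi> (cis (2 * pi * t)) else 0)"
proof -
  define z where "z = e' * cis (2 * pi * t / real M)"
  have zM: "z powi int M = cis (2 * pi * t)"
    unfolding z_def using grid_power[OF M e'(1)] by simp
  show ?thesis
  proof (cases "\<bar>t\<bar> \<ge> 45/100")
    case True
    then have "\<phi> (cis (2 * pi * t)) = 0" using p t by (simp add: plateau_def)
    then show ?thesis unfolding z_def[symmetric] bump_def zM by simp
  next
    case False
    then have \<tau>: "\<tau> (cis (2 * pi * t)) = of_real t" using p by (simp add: plateau_def)
    define u where "u = cnj e * e'"
    have term_eq: "(cnj e ^ r / of_nat M) * (z powi int r * (\<phi> (z powi int M) * exp (- (2 * pi * \<i> * (of_nat r / of_nat M) * \<tau> (z powi int M)))))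
        = \<phi> (cis (2 * pi * t)) / of_nat M * u ^ r" for r
    proof -
      have "exp (- (2 * pi * \<i> * (of_nat r / of_nat M) * of_real t)) = cis (- (2 * pi * (real r / real M) * t))"
        by (rule exp_ii_eq_cis) simp
      moreover have "z powi int r = e' ^ r * cis (real r * (2 * pi * t / real M))"
        by (simp add: z_def power_mult_distrib Complex.DeMoivre)
      moreover have "cis (real r * (2 * pi * t / real M)) * cis (- (2 * pi * (real r / real M) * t)) = 1"
        by (simp add: cis_mult)
      ultimately have "z powi int r * exp (- (2 * pi * \<i> * (of_nat r / of_nat M) * of_real t)) = e' ^ r"
        by (simp add: mult.assoc)
      then show ?thesis unfolding zM \<tau> u_def
        by (simp add: power_mult_distrib divide_inverse)
    qed
    have "bump \<phi> \<tau> M e z = \<phi> (cis (2 * pi * t)) / of_nat M * (\<Sum>r<M. u ^ r)"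
      unfolding bump_def term_eq by (simp add: sum_distrib_left)
    also have "\<dots> = (if e = e' then \<phi> (cis (2 * pi * t)) else 0)"
    proof (cases "e = e'")
      case True
      then have "u = 1" using e(2) by (simp add: u_def mult.commute complex_norm_square[symmetric])
      then show ?thesis using True M by simp
    next
      case False
      have ee: "e * cnj e = 1" using e(2) by (simp add: complex_norm_square[symmetric])
      have "u \<noteq> 1"
      proof
        assume "u = 1"
        then have "e * (cnj e * e') = e" by (simp add: u_def)
        then show False using ee False by (simp add: mult.assoc[symmetric])
      qed
      moreover have "u ^ M = 1" using e e' by (simp add: u_def power_mult_distrib flip: complex_cnj_power)
      ultimately show ?thesis using False by (simp add: geometric_sum)
    qed
    finally show ?thesis by (simp add: z_def)
  qed
qed

lemma exp_weight_0: "exp_weight \<sigma> 0 = 1"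
  by (simp add: exp_weight_def)

text \<open>The product of \<open>real M powr \<gamma>\<close> and
  \<open>\<bar>n\<bar> powr \<gamma>\<close> is split by \<open>powr_le_interpolate\<close> with
  \<open>c = 1 / real M powr \<gamma>\<close>. The exponent left on \<open>M\<close> is the cost of
  a cutoff at scale \<open>1 / M\<close>.\<close>

lemma exp_weight_subst:
  assumes s: "0 < \<gamma>" "\<gamma> < \<sigma>" "\<sigma> < 1" and M: "r < M"
  shows "exp_weight \<gamma> (int r + n * int M) \<le> exp (2 * real M powr (\<gamma> * \<sigma> / (\<sigma> - \<gamma>))) * exp_weight \<sigma> n"
proof -
  define a where "a = \<gamma> * \<sigma> / (\<sigma> - \<gamma>)"
  define x where "x = real_of_int \<bar>n\<bar>"
  have M1: "1 \<le> real M" using M by simp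
  have x0: "0 \<le> x" by (simp add: x_def)
  have ga: "\<gamma> \<le> a" using s by (simp add: a_def field_simps)
  have "\<bar>int r + n * int M\<bar> \<le> int r + \<bar>n\<bar> * int M"
    using abs_triangle_ineq[of "int r" "n * int M"] by (simp add: abs_mult)
  then have "real_of_int \<bar>int r + n * int M\<bar> \<le> real_of_int (int r + \<bar>n\<bar> * int M)" by linarith
  then have "real_of_int \<bar>int r + n * int M\<bar> \<le> real r + x * real M" by (simp add: x_def)
  then have "real_of_int \<bar>int r + n * int M\<bar> powr \<gamma> \<le> (real r + x * real M) powr \<gamma>"
    using s by (intro powr_mono2) auto
  also have "\<dots> \<le> real r powr \<gamma> + (x * real M) powr \<gamma>"
    using s x0 by (intro powr_subadditive) auto
  also have "real r powr \<gamma> \<le> real M powr \<gamma>" using M s by (intro powr_mono2) auto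
  also have "real M powr \<gamma> \<le> real M powr a" using M1 ga by (intro powr_mono) auto
  also have "(x * real M) powr \<gamma> \<le> x powr \<sigma> + real M powr a"
  proof -
    define c where "c = 1 / real M powr \<gamma>"
    have "x powr \<gamma> \<le> c * x powr \<sigma> + (1 / c) powr (\<gamma> / (\<sigma> - \<gamma>))"
      unfolding c_def using s M1 x0 by (intro powr_le_interpolate) auto
    then have "x powr \<gamma> * real M powr \<gamma> \<le> (c * x powr \<sigma> + (1 / c) powr (\<gamma> / (\<sigma> - \<gamma>))) * real M powr \<gamma>"
      by (rule mult_right_mono) simp
    also have "\<dots> = x powr \<sigma> + real M powr (\<gamma> * (\<gamma> / (\<sigma> - \<gamma>)) + \<gamma>)"
      using M1 by (simp add: c_def distrib_right powr_powr powr_add)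
    also have "\<gamma> * (\<gamma> / (\<sigma> - \<gamma>)) + \<gamma> = a" using s by (simp add: a_def field_simps)
    finally show ?thesis using x0 by (simp add: powr_mult)
  qed
  finally have "real_of_int \<bar>int r + n * int M\<bar> powr \<gamma> \<le> 2 * real M powr a + x powr \<sigma>" by simp
  then show ?thesis by (simp add: exp_weight_def a_def x_def flip: exp_add)
qed

lemma wiener_bump:
  assumes s: "0 < \<gamma>" "\<gamma> < \<sigma>" "\<sigma> < 1"
    and \<phi>: "wiener (exp_weight \<sigma>) \<phi> B" and \<tau>: "wiener (exp_weight \<sigma>) \<tau> C"
    and M: "M > 0" and e: "e \<in> unit_circle"
  shows "wiener (exp_weight \<gamma>) (bump \<phi> \<tau> M e)
           (exp (2 * real M powr (\<gamma> * \<sigma> / (\<sigma> - \<gamma>))) * (B * exp (2 * pi * C)))"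
proof -
  let ?A = "exp (2 * real M powr (\<gamma> * \<sigma> / (\<sigma> - \<gamma>)))"
  have w: "is_weight (exp_weight \<sigma>)" "is_weight (exp_weight \<gamma>)" using s by (auto intro: is_weight_exp)
  have C0: "C \<ge> 0" by (rule wiener_nonneg[OF w(1) \<tau>])
  have B0: "B \<ge> 0" by (rule wiener_nonneg[OF w(1) \<phi>])
  have 1: "wiener (exp_weight \<sigma>) (\<lambda>z. \<phi> z * exp (- (2 * pi * \<i> * (of_nat r / of_nat M) * \<tau> z))) (B * exp (2 * pi * C))"
    if r: "r < M" for r
  proof -
    have "wiener (exp_weight \<sigma>) (\<lambda>z. (- (2 * pi * \<i> * (of_nat r / of_nat M))) * \<tau> z) (norm (- (2 * pi * \<i> * (of_nat r / of_nat M))) * C)"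
      by (rule wiener_cmult[OF w(1) \<tau>])
    moreover have "norm (- (2 * pi * \<i> * (of_nat r / of_nat M))) * C \<le> 2 * pi * C"
    proof -
      have "norm (- (2 * pi * \<i> * (of_nat r / of_nat M))) = 2 * pi * (real r / real M)"
        by (simp add: norm_mult norm_divide)
      also have "\<dots> \<le> 2 * pi * 1" using r by (intro mult_left_mono) auto
      finally show ?thesis using C0 by (simp add: mult_right_mono)
    qed
    ultimately have "wiener (exp_weight \<sigma>) (\<lambda>z. (- (2 * pi * \<i> * (of_nat r / of_nat M))) * \<tau> z) (2 * pi * C)"
      by (rule wiener_mono)
    then have "wiener (exp_weight \<sigma>) (\<lambda>z. exp ((- (2 * pi * \<i> * (of_nat r / of_nat M))) * \<tau> z)) (exp (2 * pi * C))"
      using wiener_exp[OF w(1)] by (simp add: exp_weight_0)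
    then show ?thesis using wiener_mult[OF w(1) \<phi>] by simp
  qed
  have "wiener (exp_weight \<gamma>) (\<lambda>z. z powi int r * (\<phi> (z powi int M) * exp (- (2 * pi * \<i> * (of_nat r / of_nat M) * \<tau> (z powi int M)))))
      (?A * (B * exp (2 * pi * C)))" if "r < M" for r
    using wiener_subst[OF w(2) w(1) 1[OF that] exp_weight_subst[OF s that]] .
  from wiener_cmult[OF w(2) this]
  have 2: "wiener (exp_weight \<gamma>) (\<lambda>z. (cnj e ^ r / of_nat M) * (z powi int r * (\<phi> (z powi int M) * exp (- (2 * pi * \<i> * (of_nat r / of_nat M) * \<tau> (z powi int M))))))
      (norm (cnj e ^ r / of_nat M) * (?A * (B * exp (2 * pi * C))))" if "r < M" for r using that by blast
  have "wiener (exp_weight \<gamma>) (bump \<phi> \<tau> M e) (\<Sum>r<M. norm (cnj e ^ r / of_nat M) * (?A * (B * exp (2 * pi * C))))"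
    unfolding bump_def by (rule wiener_sum[OF w(2)]) (use 2 in auto)
  \<comment> \<open>Each of the \<open>M\<close> terms carries \<open>1 / M\<close>, so their number
    does not enter the bound.\<close>
  moreover have "(\<Sum>r<M. norm (cnj e ^ r / of_nat M) * (?A * (B * exp (2 * pi * C)))) = ?A * (B * exp (2 * pi * C))"
    using e M by (simp add: norm_divide norm_power)
  ultimately show ?thesis by simp
qed

section \<open>Analytic functions that are small near the Cantor set\<close>

lemma powr_times_exp_bounded:
  fixes b c a :: real
  assumes "0 < a" "0 < c" "0 \<le> b"
  obtains K where "K > 0" "\<And>y. 0 < y \<Longrightarrow> y powr b * exp (- (c * y powr a)) \<le> K"
proof -
  define m where "m = nat \<lceil>b / a\<rceil>"
  have m: "b \<le> a * real m"
  proof -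
    have "b / a \<le> real m" unfolding m_def by linarith
    then show ?thesis using assms by (simp add: divide_le_eq mult.commute)
  qed
  show thesis
  proof (rule that[of "1 + fact m / c ^ m"])
    show "1 + fact m / c ^ m > 0" using assms by (intro add_pos_pos divide_pos_pos) auto
    fix y :: real assume y: "0 < y"
    define x where "x = c * y powr a"
    have x: "x > 0" using y assms by (simp add: x_def)
    show "y powr b * exp (- (c * y powr a)) \<le> 1 + fact m / c ^ m"
    proof (cases "y \<le> 1")
      case True
      have "y powr b \<le> 1 powr b" using True y assms by (intro powr_mono2) auto
      moreover have "exp (- x) \<le> 1" using x by simp
      ultimately have "y powr b * exp (- x) \<le> 1 * 1" by (intro mult_mono) auto
      moreover have "0 \<le> fact m / c ^ m" using assms by simp
      ultimately show ?thesis unfolding x_def by linarith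
    next
      case False
      have "y powr b \<le> y powr (a * real m)" using False m by (intro powr_mono) auto
      also have "\<dots> = (y powr a) ^ m" using y by (simp add: powr_realpow[symmetric] powr_powr)
      also have "\<dots> = x ^ m / c ^ m" using assms by (simp add: x_def power_mult_distrib)
      also have "\<dots> \<le> fact m * exp x / c ^ m"
      proof -
        note sm = exp_converges[of x]
        have "(\<Sum>n\<in>{m}. x ^ n /\<^sub>R fact n) \<le> (\<Sum>n. x ^ n /\<^sub>R fact n)"
          using x by (intro sum_le_suminf sums_summable[OF sm]) auto
        also have "\<dots> = exp x" by (rule sums_unique[OF sm, symmetric])
        finally have "x ^ m / fact m \<le> exp x" by (simp add: divide_inverse mult.commute)
        then show ?thesis using assms by (intro divide_right_mono) (auto simp: field_simps)
      qed
      finally have "y powr b * exp (- x) \<le> (fact m * exp x / c ^ m) * exp (- x)"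
        by (intro mult_right_mono) auto
      also have "\<dots> = fact m / c ^ m" by (simp add: exp_minus)
      finally show ?thesis unfolding x_def by simp
    qed
  qed
qed

lemma norm_cis_minus_1: "norm (cis x - 1) \<le> \<bar>x\<bar>"
  using dist_exp_i_1[of x] abs_sin_x_le_abs_x[of "x / 2"] by (simp add: cis_conv_exp)

text \<open>The second assumption means \<open>a < 1 - ln 2 / ln q\<close>, which makes the weights
  of all poles summable.\<close>

locale cantor_poles = cantor +
  fixes a :: real
  assumes a0: "0 < a" and a1: "2 * real q powr (a - 1) < 1"
begin

definition \<rho> :: "nat \<Rightarrow> real" where "\<rho> k = 1 / real q ^ k"

text \<open>Chosen so that a pole of level \<open>k\<close>, seen from distance
  \<open>\<rho> k\<close>, contributes
  \<open>\<eta> k / \<rho> k = \<rho> k powr (- a)\<close>.\<close>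

definition \<eta> :: "nat \<Rightarrow> real" where "\<eta> k = \<rho> k powr (1 - a)"

definition U :: "nat \<Rightarrow> complex \<Rightarrow> complex" where
  "U K z = (\<Sum>k\<le>K. \<Sum>e\<in>G k. of_real (\<eta> k) / (of_real (1 + \<rho> k) - z * cnj e))"

definition F :: "nat \<Rightarrow> complex \<Rightarrow> complex" where
  "F K z = exp (- U K z)"

lemma rho_pos: "0 < \<rho> k" and eta_pos: "0 < \<eta> k"
  using q_gt by (auto simp: \<rho>_def \<eta>_def)

lemma rho_mono: "j \<le> k \<Longrightarrow> \<rho> k \<le> \<rho> j"
  using q_gt by (simp add: \<rho>_def divide_left_mono power_increasing)

lemma rho_le_1: "\<rho> k \<le> 1"
  using rho_mono[of 0 k] by (simp add: \<rho>_def)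

lemma a_less_1: "a < 1"
proof (rule ccontr)
  assume "\<not> a < 1"
  then have "1 \<le> real q powr (a - 1)" using q_gt by (intro ge_one_powr_ge_zero) auto
  then show False using a1 by simp
qed

definition S :: real where "S = 2 / (1 - 2 * real q powr (a - 1))"

text \<open>Two digits per step against a weight ratio \<open>q powr (a - 1)\<close>: the levels are
  dominated by a geometric series of ratio \<open>\<kappa> < 1\<close>, so the bound is independent
  of \<open>K\<close>.\<close>

lemma sum_eta_le: "(\<Sum>k\<le>K. \<Sum>e\<in>G k. \<eta> k) \<le> S"
proof -
  define \<kappa> where "\<kappa> = 2 * real q powr (a - 1)"
  have k: "0 < \<kappa>" "\<kappa> < 1" using a1 q_gt by (auto simp: \<kappa>_def)
  have e: "2 ^ k * \<eta> k = \<kappa> ^ k" for k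
  proof -
    have *: "\<rho> k = real q powr (- real k)"
      unfolding \<rho>_def powr_minus_divide using q_gt by (subst powr_realpow) auto
    have "\<eta> k = (real q powr (- real k)) powr (1 - a)" unfolding \<eta>_def * ..
    also have "\<dots> = real q powr (- real k * (1 - a))" by (rule powr_powr)
    also have "- real k * (1 - a) = (a - 1) * real k" by (simp add: algebra_simps)
    also have "real q powr ((a - 1) * real k) = (real q powr (a - 1)) powr real k" by (simp only: powr_powr)
    also have "\<dots> = (real q powr (a - 1)) ^ k" using q_gt by (intro powr_realpow) auto
    finally have "\<eta> k = (real q powr (a - 1)) ^ k" .
    then show ?thesis by (simp add: \<kappa>_def power_mult_distrib)
  qed
  have "(\<Sum>k\<le>K. \<Sum>e\<in>G k. \<eta> k) \<le> (\<Sum>k\<le>K. 2 * \<kappa> ^ k)"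
  proof (rule sum_mono)
    fix k
    have "(\<Sum>e\<in>G k. \<eta> k) = real (card (G k)) * \<eta> k" by simp
    also have "\<dots> \<le> real (2 ^ Suc k) * \<eta> k"
      by (intro mult_right_mono of_nat_mono card_G less_imp_le[OF eta_pos])
    also have "\<dots> = 2 * \<kappa> ^ k" using e[of k] by simp
    finally show "(\<Sum>e\<in>G k. \<eta> k) \<le> 2 * \<kappa> ^ k" .
  qed
  also have "\<dots> = 2 * (\<Sum>k\<le>K. \<kappa> ^ k)" by (simp add: sum_distrib_left)
  also have "(\<Sum>k\<le>K. \<kappa> ^ k) \<le> (\<Sum>k. \<kappa> ^ k)"
    using k by (intro sum_le_suminf summable_geometric) auto
  also have "(\<Sum>k. \<kappa> ^ k) = 1 / (1 - \<kappa>)" using k by (intro suminf_geometric) auto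
  finally show ?thesis by (simp add: S_def \<kappa>_def)
qed

lemma Re_pole_ge:
  assumes "e \<in> G k" "norm z \<le> R"
  shows "1 + \<rho> k - R \<le> Re (of_real (1 + \<rho> k) - z * cnj e)"
proof -
  have "Re (z * cnj e) \<le> norm (z * cnj e)" by (rule complex_Re_le_cmod)
  also have "\<dots> = norm z" using G_circle[OF assms(1)] by (simp add: norm_mult)
  finally show ?thesis using assms(2) by simp
qed

lemma Re_term_nonneg:
  assumes "0 \<le> Re w" "0 \<le> h"
  shows "0 \<le> Re (of_real h / w)"
  using assms by (simp add: Re_divide)

text \<open>In this disc every denominator has nonnegative real part, hence so has its reciprocal;
  at a pole on the boundary, division by zero gives \<open>0\<close>.\<close>

lemma Re_U_nonneg:
  assumes "norm z \<le> 1 + \<rho> K"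
  shows "0 \<le> Re (U K z)"
  unfolding U_def Re_sum
proof (intro sum_nonneg Re_term_nonneg)
  fix k e assume "k \<in> {..K}" "e \<in> G k"
  then show "0 \<le> Re (of_real (1 + \<rho> k) - z * cnj e)"
    using Re_pole_ge[of e k z "1 + \<rho> K"] assms rho_mono[of k K] by simp
qed (use eta_pos in \<open>auto intro: less_imp_le\<close>)

lemma norm_F_le_1: "norm z \<le> 1 + \<rho> K \<Longrightarrow> norm (F K z) \<le> 1"
  using Re_U_nonneg[of z K] by (simp add: F_def)

lemma F_holomorphic:
  assumes "\<And>z k e. z \<in> A \<Longrightarrow> k \<le> K \<Longrightarrow> e \<in> G k \<Longrightarrow> of_real (1 + \<rho> k) - z * cnj e \<noteq> 0"
  shows "F K holomorphic_on A"
  unfolding F_def U_def using assms by (intro holomorphic_intros) auto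

lemma F_holomorphic_ball: "F K holomorphic_on ball 0 (1 + \<rho> K)"
proof (rule F_holomorphic)
  fix z e :: complex and k assume "z \<in> ball 0 (1 + \<rho> K)" "k \<le> K" "e \<in> G k"
  then show "of_real (1 + \<rho> k) - z * cnj e \<noteq> 0"
    using Re_pole_ge[of e k z "norm z"] rho_mono[of k K] by (auto simp: complex_eq_iff)
qed

lemma norm_F_0_ge: "exp (- S) \<le> norm (F K 0)"
proof -
  have "norm (U K 0) \<le> (\<Sum>k\<le>K. \<Sum>e\<in>G k. \<eta> k)"
    unfolding U_def
  proof (intro order_trans[OF norm_sum] sum_mono)
    fix k e
    have "norm (complex_of_real (\<eta> k) / (complex_of_real (1 + \<rho> k) - 0 * cnj e)) = \<eta> k / (1 + \<rho> k)"
      using rho_pos[of k] eta_pos[of k] by (simp add: norm_divide del: of_real_add)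
    also have "\<dots> \<le> \<eta> k" using rho_pos[of k] eta_pos[of k] by (simp add: divide_le_eq)
    finally show "norm (complex_of_real (\<eta> k) / (complex_of_real (1 + \<rho> k) - 0 * cnj e)) \<le> \<eta> k" .
  qed
  also have "\<dots> \<le> S" by (rule sum_eta_le)
  finally have "Re (U K 0) \<le> S" using complex_Re_le_cmod[of "U K 0"] by linarith
  then show ?thesis by (simp add: F_def)
qed

text \<open>\<open>225 = 25 * 9\<close> collects the losses \<open>norm w \<le> 5 * d\<close> and
  \<open>d \<le> 3 * q * \<rho> j\<close> of the next proof, the latter raised to a power at most
  \<open>2\<close>.\<close>

definition c0 :: real where "c0 = 1 / (225 * real q ^ 2)"

lemma c0_pos: "c0 > 0"
  using q_gt by (simp add: c0_def)

text \<open>The level \<open>j\<close> of the poles is chosen so that \<open>\<rho> j\<close> is comparable to the distance \<open>d\<close>.\<close>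

lemma Re_U_ge:
  assumes z: "z \<in> unit_circle" and k: "k \<le> K" and e: "e \<in> G k"
    and d: "d = norm (of_real (1 + \<rho> k) - z * cnj e)"
  shows "c0 * d powr (- a) \<le> Re (U K z)" and "0 < d" and "d \<le> 3"
proof -
  have nz: "norm z = 1" using z by simp
  have ne: "norm e = 1" using G_circle[OF e] by simp
  have dk: "\<rho> k \<le> d"
    using Re_pole_ge[OF e, of z 1] complex_Re_le_cmod[of "of_real (1 + \<rho> k) - z * cnj e"] nz d by simp
  show d0: "0 < d" using dk rho_pos[of k] by linarith
  have "d \<le> norm (of_real (1 + \<rho> k) :: complex) + norm (z * cnj e)" unfolding d by (rule norm_triangle_ineq4)
  also have "\<dots> = 2 + \<rho> k" using nz ne rho_pos[of k] by (simp add: norm_mult del: of_real_add)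
  finally show d3: "d \<le> 3" using rho_le_1[of k] by linarith
  define j where "j = (LEAST j. \<rho> j \<le> d)"
  have j: "\<rho> j \<le> d" "j \<le> k" unfolding j_def using dk by (auto intro: LeastI Least_le)
  \<comment> \<open>At level \<open>0\<close> the bound \<open>d \<le> 3\<close> suffices; otherwise
    level \<open>j - 1\<close> is already too coarse, and consecutive levels differ by the factor
    \<open>q\<close>.\<close>
  have jq: "d \<le> 3 * real q * \<rho> j"
  proof (cases j)
    case 0
    then have "\<rho> j = 1" by (simp add: \<rho>_def)
    then show ?thesis using d3 q_gt by simp
  next
    case (Suc i)
    have "\<not> \<rho> i \<le> d" using not_less_Least[of i "\<lambda>j. \<rho> j \<le> d"] Suc by (simp add: j_def)
    moreover have "\<rho> i = real q * \<rho> j" using Suc q_gt by (simp add: \<rho>_def)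
    ultimately have "d \<le> real q * \<rho> j" by simp
    also have "\<dots> \<le> 3 * (real q * \<rho> j)" using q_gt rho_pos[of j] by simp
    finally show ?thesis by simp
  qed
  obtain e' t where et: "e' \<in> G j" "\<bar>t\<bar> \<le> 1 / real q" "e = e' * cis (2 * pi * t / q ^ j)"
    using G_cover[of e j] G_subset_E e by blast
  have ne': "norm e' = 1" using G_circle[OF et(1)] by simp
  have "e - e' = e' * (cis (2 * pi * t / q ^ j) - 1)" by (simp add: et(3) right_diff_distrib)
  then have "norm (e - e') = norm (cis (2 * pi * t / q ^ j) - 1)" using ne' by (simp add: norm_mult)
  also have "\<dots> \<le> \<bar>2 * pi * t / q ^ j\<bar>" by (rule norm_cis_minus_1)
  also have "\<dots> = 2 * pi * \<bar>t\<bar> * \<rho> j" by (simp add: abs_mult \<rho>_def)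
  also have "\<dots> \<le> 3 * \<rho> j"
  proof (intro mult_right_mono)
    have "2 * pi * \<bar>t\<bar> \<le> 2 * 4 * (1/3)" using et(2) q_gt(3) pi_less_4 by (intro mult_mono) auto
    then show "2 * pi * \<bar>t\<bar> \<le> 3" by simp
  qed (use rho_pos[of j] in simp)
  finally have ee: "norm (e - e') \<le> 3 * \<rho> j" .
  define w where "w = of_real (1 + \<rho> j) - z * cnj e'"
  \<comment> \<open>Moving from the pole at \<open>e\<close> to the one at \<open>e'\<close> costs
    at most \<open>\<rho> j + 3 * \<rho> j\<close>, hence at most \<open>4 * d\<close>.\<close>
  have "norm w \<le> 5 * d"
  proof -
    have "w = (of_real (1 + \<rho> k) - z * cnj e) + (of_real (\<rho> j - \<rho> k) + z * cnj (e - e'))"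
      by (simp add: w_def algebra_simps)
    then have "norm w \<le> d + norm (complex_of_real (\<rho> j - \<rho> k) + z * cnj (e - e'))"
      unfolding d by (simp only: norm_triangle_ineq)
    also have "norm (complex_of_real (\<rho> j - \<rho> k) + z * cnj (e - e'))
        \<le> norm (complex_of_real (\<rho> j - \<rho> k)) + norm (z * cnj (e - e'))" by (rule norm_triangle_ineq)
    also have "norm (complex_of_real (\<rho> j - \<rho> k)) = \<rho> j - \<rho> k"
      using rho_mono[OF j(2)] by (simp del: of_real_diff)
    also have "norm (z * cnj (e - e')) = norm (e - e')" using nz by (simp add: norm_mult del: complex_cnj_diff)
    finally show ?thesis using ee j(1) rho_pos[of k] by linarith
  qed
  moreover have rw: "\<rho> j \<le> Re w" using Re_pole_ge[OF et(1), of z 1] nz by (simp add: w_def)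
  ultimately have "\<rho> j / (5 * d)\<^sup>2 \<le> Re w / (norm w)\<^sup>2"
    using rho_pos[of j] complex_Re_le_cmod[of w] d0
    by (intro frac_le power_mono) auto
  then have T: "\<eta> j * (\<rho> j / (5 * d)\<^sup>2) \<le> Re (of_real (\<eta> j) / w)"
    using eta_pos[of j] by (simp add: Re_divide cmod_power2[symmetric] mult_left_mono flip: times_divide_eq_right)
  have "\<eta> j * \<rho> j = \<rho> j powr (2 - a)"
    unfolding \<eta>_def using rho_pos[of j] powr_mult_base[of "\<rho> j" "1 - a"] by (simp add: mult.commute)
  moreover have "(d / (3 * real q)) powr (2 - a) \<le> \<rho> j powr (2 - a)"
    using jq d0 q_gt a_less_1 by (intro powr_mono2) (auto simp: divide_le_eq mult.commute)
  moreover have "d powr (2 - a) / (9 * real q ^ 2) \<le> (d / (3 * real q)) powr (2 - a)"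
  proof -
    have "(3 * real q) powr (2 - a) \<le> (3 * real q) powr 2"
      using q_gt a0 by (intro powr_mono) auto
    also have "\<dots> = 9 * real q ^ 2" using q_gt by (simp add: powr_numeral power_mult_distrib)
    finally show ?thesis using q_gt d0 by (simp add: powr_divide divide_left_mono)
  qed
  ultimately have "d powr (2 - a) / (9 * real q ^ 2) \<le> \<eta> j * \<rho> j" by linarith
  then have "d powr (2 - a) / (9 * real q ^ 2) / (5 * d)\<^sup>2 \<le> \<eta> j * \<rho> j / (5 * d)\<^sup>2"
    by (rule divide_right_mono) simp
  moreover have "d powr (2 - a) / (9 * real q ^ 2) / (5 * d)\<^sup>2 = c0 * d powr (- a)"
  proof -
    have "d powr (2 - a) = d\<^sup>2 * d powr (- a)"
      using d0 powr_add[of d 2 "-a"] by (simp add: powr_numeral)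
    then show ?thesis using d0 by (simp add: c0_def power_mult_distrib)
  qed
  ultimately have "c0 * d powr (- a) \<le> Re (of_real (\<eta> j) / w)" using T by simp
  also have "\<dots> \<le> Re (U K z)"
  proof -
    have n: "0 \<le> Re (of_real (\<eta> k) / (of_real (1 + \<rho> k) - z * cnj e))" if "e \<in> G k" for k e
      using Re_pole_ge[OF that, of z 1] nz rho_pos[of k] eta_pos[of k] by (intro Re_term_nonneg) auto
    \<comment> \<open>All terms have nonnegative real part, so the single pole at \<open>e'\<close>
      already gives the lower bound.\<close>
    have "Re (of_real (\<eta> j) / w) \<le> (\<Sum>e\<in>G j. Re (of_real (\<eta> j) / (of_real (1 + \<rho> j) - z * cnj e)))"
      unfolding w_def using et(1) by (intro member_le_sum[where f = "\<lambda>e. Re (of_real (\<eta> j) / (of_real (1 + \<rho> j) - z * cnj e))"] n finite_G) auto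
    also have "\<dots> \<le> (\<Sum>k\<le>K. \<Sum>e\<in>G k. Re (of_real (\<eta> k) / (of_real (1 + \<rho> k) - z * cnj e)))"
      using j(2) k by (intro member_le_sum[where f = "\<lambda>k. \<Sum>e\<in>G k. Re (of_real (\<eta> k) / (of_real (1 + \<rho> k) - z * cnj e))"] sum_nonneg n) auto
    finally show ?thesis by (simp add: U_def)
  qed
  finally show "c0 * d powr (- a) \<le> Re (U K z)" .
qed

text \<open>A point of the cell of \<open>e\<close> is within \<open>5 * \<rho> K\<close> of the
  pole at \<open>e\<close>, namely \<open>\<rho> K\<close> plus at most \<open>4 * \<rho> K\<close>
  along the circle.\<close>

lemma norm_F_near_G:
  assumes e: "e \<in> G K" and t: "\<bar>t\<bar> \<le> 1/2"
  shows "norm (F K (e * cis (2 * pi * t / real q ^ K))) \<le> exp (- (c0 / 5 * (real q ^ K) powr a))"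
proof -
  define z where "z = e * cis (2 * pi * t / real q ^ K)"
  define d where "d = norm (of_real (1 + \<rho> K) - z * cnj e)"
  have ne: "norm e = 1" using G_circle[OF e] by simp
  have z: "z \<in> unit_circle" using ne by (simp add: z_def norm_mult)
  note U = Re_U_ge[OF z order_refl e d_def]
  have "z * cnj e = cis (2 * pi * t / real q ^ K)"
    using ne by (simp add: z_def mult_ac complex_norm_square[symmetric])
  then have "of_real (1 + \<rho> K) - z * cnj e = of_real (\<rho> K) - (cis (2 * pi * t / real q ^ K) - 1)" by simp
  then have "d \<le> norm (of_real (\<rho> K) :: complex) + norm (cis (2 * pi * t / real q ^ K) - 1)"
    unfolding d_def by (simp only: norm_triangle_ineq4)
  also have "\<dots> \<le> \<rho> K + \<bar>2 * pi * t / real q ^ K\<bar>"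
    using norm_cis_minus_1[of "2 * pi * t / real q ^ K"] rho_pos[of K] by simp
  also have "\<bar>2 * pi * t / real q ^ K\<bar> = 2 * pi * \<bar>t\<bar> * \<rho> K" by (simp add: abs_mult \<rho>_def)
  also have "\<dots> \<le> 2 * 4 * (1/2) * \<rho> K" using t pi_less_4 rho_pos[of K] by (intro mult_right_mono mult_mono) auto
  finally have d5: "d \<le> 5 * \<rho> K" by simp
  have "(real q ^ K) powr a / 5 \<le> (real q ^ K) powr a / 5 powr a"
    using a_less_1 powr_mono[of a 1 5] q_gt by (intro divide_left_mono) auto
  also have "\<dots> = (5 * \<rho> K) powr (- a)"
  proof -
    have "(5 * \<rho> K) powr (- a) = 1 / ((5 / real q ^ K) powr a)"
      unfolding powr_minus_divide by (simp add: \<rho>_def)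
    also have "(5 / real q ^ K) powr a = 5 powr a / (real q ^ K) powr a"
      by (rule powr_divide)
    finally show ?thesis by simp
  qed
  also have "\<dots> \<le> d powr (- a)" using d5 U(2) a0 by (intro powr_mono2') auto
  finally have "c0 * ((real q ^ K) powr a / 5) \<le> c0 * d powr (- a)" using c0_pos by (intro mult_left_mono) auto
  also have "\<dots> \<le> Re (U K z)" by (rule U(1))
  finally show ?thesis by (simp add: F_def z_def)
qed

end

lemma fact_add_ge: "fact m * (real m + 1) ^ p \<le> fact (m + p)"
proof (induction p)
  case (Suc p)
  have "fact m * (real m + 1) ^ Suc p = (fact m * (real m + 1) ^ p) * (real m + 1)" by simp
  also have "\<dots> \<le> fact (m + p) * (real m + 1 + real p)"
    using Suc by (intro mult_mono) auto
  also have "\<dots> = fact (m + Suc p)" by (simp add: algebra_simps)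
  finally show ?case .
qed simp

context cantor_poles
begin

lemma G_nonempty: "G k \<noteq> {}"
proof -
  have "replicate (Suc k) 0 \<in> {l. set l \<subseteq> {0, 1::real} \<and> length l = Suc k}" by auto
  then show ?thesis unfolding G_def by blast
qed

text \<open>Cauchy's inequality is applied on a circle of radius \<open>D\<^sup>2 / 6\<close>, where \<open>D\<close> is the distance to the
  poles: on it \<open>U K\<close> varies by at most \<open>S / 3\<close>, while \<open>Re (U K z)\<close> beats every power of \<open>1 / D\<close>.\<close>

lemma higher_deriv_F_bounded:
  obtains C where "C > 0" "\<And>K z. z \<in> unit_circle \<Longrightarrow> norm ((deriv ^^ p) (F K) z) \<le> C"
proof -
  obtain B0 where B0: "B0 > 0" "\<And>y. 0 < y \<Longrightarrow> y powr real (2 * p) * exp (- (c0 * y powr a)) \<le> B0"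
    using powr_times_exp_bounded[OF a0 c0_pos, of "real (2 * p)"] by auto
  show thesis
  proof (rule that[of "fact p * (exp (S / 3) * 6 ^ p * B0)"])
    show "fact p * (exp (S / 3) * 6 ^ p * B0) > 0" using B0 by simp
    fix K and z :: complex assume z: "z \<in> unit_circle"
    define dist_pole where "dist_pole x = norm (of_real (1 + \<rho> (fst x)) - z * cnj (snd x))" for x
    define P where "P = (SIGMA k:{..K}. G k)"
    have fin: "finite (dist_pole ` P)" unfolding P_def by (intro finite_imageI finite_SigmaI finite_G) auto
    obtain e0 where "e0 \<in> G 0" using G_nonempty[of 0] by blast
    then have ne: "dist_pole ` P \<noteq> {}" by (auto simp: P_def)
    define D where "D = Min (dist_pole ` P)"
    have "D \<in> dist_pole ` P" unfolding D_def by (rule Min_in[OF fin ne])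
    then obtain k e where ke: "k \<le> K" "e \<in> G k" "D = norm (of_real (1 + \<rho> k) - z * cnj e)"
      by (auto simp: P_def dist_pole_def)
    have D_le: "D \<le> norm (of_real (1 + \<rho> k) - z * cnj e)" if "k \<le> K" "e \<in> G k" for k e
    proof -
      have "dist_pole (k, e) \<in> dist_pole ` P" using that by (auto simp: P_def)
      then have "D \<le> dist_pole (k, e)" unfolding D_def using fin by simp
      then show ?thesis by (simp add: dist_pole_def)
    qed
    note U = Re_U_ge[OF z ke]
    define r where "r = D\<^sup>2 / 6"
    have r0: "r > 0" using U(2) by (simp add: r_def)
    have rD: "r \<le> D / 2" using U(2,3) by (simp add: r_def power2_eq_square)
    have far: "D / 2 \<le> norm (of_real (1 + \<rho> k) - w * cnj e)"
      if "norm (z - w) \<le> r" "k \<le> K" "e \<in> G k" for w k e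
    proof -
      have "norm ((z - w) * cnj e) \<le> D / 2"
        using that(1) rD G_circle[OF that(3)] by (simp add: norm_mult)
      moreover have eq: "of_real (1 + \<rho> k) - w * cnj e = (of_real (1 + \<rho> k) - z * cnj e) + (z - w) * cnj e"
        by (simp add: algebra_simps)
      ultimately show ?thesis
        unfolding eq
        using D_le[OF that(2,3)] norm_diff_ineq[of "of_real (1 + \<rho> k) - z * cnj e" "(z - w) * cnj e"] by linarith
    qed
    have bnd: "norm (F K w) \<le> exp (S / 3) * exp (- (c0 * D powr (- a)))" if w: "norm (z - w) \<le> r" for w
    proof -
      have "norm (U K z - U K w) \<le> (\<Sum>k\<le>K. \<Sum>e\<in>G k. \<eta> k / 3)"
        unfolding U_def sum_subtractf[symmetric]
      proof (intro order_trans[OF norm_sum] sum_mono)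
        fix k e assume "k \<in> {..K}" "e \<in> G k"
        then have k: "k \<le> K" and e: "e \<in> G k" by auto
        define A B where "A = of_real (1 + \<rho> k) - z * cnj e" and "B = of_real (1 + \<rho> k) - w * cnj e"
        have A: "D \<le> norm A" and B: "D / 2 \<le> norm B"
          unfolding A_def B_def using D_le[OF k e] far[OF w k e] by auto
        then have AB: "A \<noteq> 0" "B \<noteq> 0" using U(2) by auto
        have "B - A = (z - w) * cnj e" by (simp add: A_def B_def algebra_simps)
        then have "norm (B - A) \<le> r" using w G_circle[OF e] by (simp add: norm_mult)
        have "of_real (\<eta> k) / A - of_real (\<eta> k) / B = of_real (\<eta> k) * ((B - A) / (A * B))"
          using AB by (simp add: field_simps)
        then have "norm (of_real (\<eta> k) / A - of_real (\<eta> k) / B) = \<eta> k * (norm (B - A) / (norm A * norm B))"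
          using eta_pos[of k] by (simp add: norm_mult norm_divide)
        also have "\<dots> \<le> \<eta> k * (r / (D * (D / 2)))"
          using eta_pos[of k] A B U(2) r0 \<open>norm (B - A) \<le> r\<close>
          by (intro mult_left_mono frac_le mult_mono) auto
        also have "\<dots> = \<eta> k / 3" using U(2) by (simp add: r_def power2_eq_square)
        finally show "norm (of_real (\<eta> k) / (of_real (1 + \<rho> k) - z * cnj e) - of_real (\<eta> k) / (of_real (1 + \<rho> k) - w * cnj e)) \<le> \<eta> k / 3"
          unfolding A_def B_def .
      qed
      also have "\<dots> = (\<Sum>k\<le>K. \<Sum>e\<in>G k. \<eta> k) / 3" by (simp add: sum_divide_distrib)
      also have "\<dots> \<le> S / 3" using sum_eta_le[of K] by simp
      finally have "Re (U K z) - Re (U K w) \<le> S / 3"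
        using complex_Re_le_cmod[of "U K z - U K w"] by simp
      then have "- Re (U K w) \<le> S / 3 + - (c0 * D powr (- a))" using U(1) by linarith
      then show ?thesis by (simp add: F_def flip: exp_add)
    qed
    have hol: "F K holomorphic_on cball z r"
    proof (rule F_holomorphic)
      fix w k e assume "w \<in> cball z r" "k \<le> K" "e \<in> G k"
      then show "of_real (1 + \<rho> k) - w * cnj e \<noteq> 0"
        using far[of w k e] U(2) by (auto simp: dist_norm)
    qed
    have "norm ((deriv ^^ p) (F K) z) \<le> fact p * (exp (S / 3) * exp (- (c0 * D powr (- a)))) / r ^ p"
    proof (rule Cauchy_inequality[OF _ _ r0])
      show "F K holomorphic_on ball z r" using hol by (rule holomorphic_on_subset) auto
      show "continuous_on (cball z r) (F K)" using hol by (rule holomorphic_on_imp_continuous_on)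
    qed (use bnd in auto)
    also have "\<dots> = fact p * (exp (S / 3) * 6 ^ p * ((1 / D) powr real (2 * p) * exp (- (c0 * (1 / D) powr a))))"
    proof -
      have "(1 / D) powr real (2 * p) = 1 / (D\<^sup>2) ^ p"
        using U(2) by (subst powr_realpow) (auto simp: power_one_over power_mult)
      moreover have "(1 / D) powr a = D powr (- a)" by (simp add: powr_divide powr_minus_divide)
      ultimately show ?thesis by (simp add: r_def power_divide)
    qed
    also have "\<dots> \<le> fact p * (exp (S / 3) * 6 ^ p * B0)"
      using B0(2)[of "1 / D"] U(2) by (intro mult_left_mono) auto
    finally show "norm ((deriv ^^ p) (F K) z) \<le> fact p * (exp (S / 3) * 6 ^ p * B0)" .
  qed
qed

section \<open>Power series coefficients of \<open>F K\<close>\<close>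

definition coef :: "nat \<Rightarrow> nat \<Rightarrow> complex" where
  "coef K n = (deriv ^^ n) (F K) 0 / fact n"

text \<open>Cauchy's inequality halfway to the nearest poles, where \<open>F K\<close> is still
  bounded by \<open>1\<close>.\<close>

lemma norm_coef_le: "norm (coef K n) \<le> 1 / (1 + \<rho> K / 2) ^ n"
proof -
  have sub: "cball 0 (1 + \<rho> K / 2) \<subseteq> ball (0::complex) (1 + \<rho> K)" using rho_pos[of K] by auto
  have "norm ((deriv ^^ n) (F K) 0) \<le> fact n * 1 / (1 + \<rho> K / 2) ^ n"
  proof (rule Cauchy_inequality)
    show "F K holomorphic_on ball 0 (1 + \<rho> K / 2)"
      using F_holomorphic_ball by (rule holomorphic_on_subset) (use sub in auto)
    show "continuous_on (cball 0 (1 + \<rho> K / 2)) (F K)"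
      using F_holomorphic_ball sub by (intro holomorphic_on_imp_continuous_on) (rule holomorphic_on_subset)
    show "0 < 1 + \<rho> K / 2" using rho_pos[of K] by simp
    fix x :: complex assume "norm (0 - x) = 1 + \<rho> K / 2"
    then show "norm (F K x) \<le> 1" using rho_pos[of K] by (intro norm_F_le_1) simp
  qed
  then show ?thesis by (simp add: coef_def norm_divide divide_le_eq mult.commute)
qed

lemma norm_coef_le_1: "norm (coef K n) \<le> 1"
proof -
  have "1 / (1 + \<rho> K / 2) ^ n \<le> 1" using rho_pos[of K] by (simp add: divide_le_eq one_le_power)
  then show ?thesis using norm_coef_le[of K n] by linarith
qed

lemma coef_sums: "z \<in> unit_circle \<Longrightarrow> ((\<lambda>n. coef K n * z ^ n) has_sum F K z) UNIV"
proof -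
  assume z: "z \<in> unit_circle"
  have "(\<lambda>n. coef K n * z ^ n) sums F K z"
    unfolding coef_def using holomorphic_power_series[OF F_holomorphic_ball, of z K] z rho_pos[of K] by simp
  moreover have "summable (\<lambda>n. norm (coef K n * z ^ n))"
  proof (rule summable_comparison_test'[where N = 0])
    show "summable (\<lambda>n. (1 / (1 + \<rho> K / 2)) ^ n)"
      using rho_pos[of K] by (intro summable_geometric) simp
    show "norm (norm (coef K n * z ^ n)) \<le> (1 / (1 + \<rho> K / 2)) ^ n" for n
      using norm_coef_le[of K n] z by (simp add: norm_mult norm_power power_one_over)
  qed
  ultimately show ?thesis by (intro norm_summable_imp_has_sum)
qed

lemma coef_0: "coef K 0 = F K 0"
  by (simp add: coef_def)

text \<open>With \<open>m = n - p\<close>, Cauchy's inequality for the \<open>p\<close>-th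
  derivative bounds the \<open>n\<close>-th derivative at \<open>0\<close> by
  \<open>fact m * C\<close>; dividing by \<open>fact n\<close> gains \<open>p\<close> powers of
  \<open>n\<close>, uniformly in \<open>K\<close>.\<close>

lemma coef_decay:
  obtains C where "C > 0" "\<And>K n. norm (coef K n) * (1 + real n) ^ p \<le> C"
proof -
  obtain C where C: "C > 0" "\<And>K z. z \<in> unit_circle \<Longrightarrow> norm ((deriv ^^ p) (F K) z) \<le> C"
    by (rule higher_deriv_F_bounded[where p = p], rule that) auto
  show thesis
  proof (rule that[of "(max C 1) * (real p + 1) ^ p"])
    show "(max C 1) * (real p + 1) ^ p > 0" using C by (intro mult_pos_pos) auto
    fix K n
    show "norm (coef K n) * (1 + real n) ^ p \<le> max C 1 * (real p + 1) ^ p"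
    proof (cases "n < p")
      case True
      then show ?thesis
        using norm_coef_le_1[of K n] by (intro mult_mono power_mono) auto
    next
      case False
      define m where "m = n - p"
      have n: "n = m + p" using False by (simp add: m_def)
      define g where "g = (deriv ^^ p) (F K)"
      have g: "g holomorphic_on ball 0 (1 + \<rho> K)"
        unfolding g_def by (intro holomorphic_higher_deriv F_holomorphic_ball) auto
      have sub: "cball 0 1 \<subseteq> ball (0::complex) (1 + \<rho> K)" using rho_pos[of K] by auto
      have "norm ((deriv ^^ m) g 0) \<le> fact m * C / 1 ^ m"
      proof (rule Cauchy_inequality)
        show "g holomorphic_on ball 0 1"
          using g by (rule holomorphic_on_subset) (use sub in auto)
        show "continuous_on (cball 0 1) g"
          using g sub by (intro holomorphic_on_imp_continuous_on) (rule holomorphic_on_subset)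
        show "norm (g x) \<le> C" if "norm (0 - x) = 1" for x
          unfolding g_def using that by (intro C) simp
      qed simp
      moreover have "(deriv ^^ m) g = (deriv ^^ n) (F K)" by (simp add: g_def n funpow_add)
      ultimately have "norm (coef K n) \<le> fact m * C / fact n"
        by (simp add: coef_def norm_divide divide_right_mono)
      also have "\<dots> \<le> fact m * C / (fact m * (real m + 1) ^ p)"
        using fact_add_ge[of m p] C by (intro divide_left_mono) (auto simp: n)
      also have "\<dots> = C / (real m + 1) ^ p" by simp
      finally have "norm (coef K n) * (1 + real n) ^ p \<le> C / (real m + 1) ^ p * (1 + real n) ^ p"
        by (rule mult_right_mono) simp
      also have "\<dots> \<le> C / (real m + 1) ^ p * ((real p + 1) * (real m + 1)) ^ p"
        using C by (intro mult_left_mono power_mono) (auto simp: n algebra_simps)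
      also have "\<dots> = C * (real p + 1) ^ p" by (simp add: power_mult_distrib)
      also have "\<dots> \<le> max C 1 * (real p + 1) ^ p" by (intro mult_right_mono) auto
      finally show ?thesis .
    qed
  qed
qed

lemma coef_summable_powr:
  obtains B where "B > 0" "\<And>K. (\<lambda>n. norm (coef K n) * (1 + real n) powr s) summable_on UNIV"
    "\<And>K. (\<Sum>\<^sub>\<infinity>n. norm (coef K n) * (1 + real n) powr s) \<le> B"
proof -
  \<comment> \<open>Two powers beyond \<open>s\<close> make the weighted series converge.\<close>
  define p where "p = nat \<lceil>s + 2\<rceil>"
  have p: "s + 2 \<le> real p" unfolding p_def by linarith
  obtain C where C: "C > 0" "\<And>K n. norm (coef K n) * (1 + real n) ^ p \<le> C"
    by (rule coef_decay[where p = p], rule that) auto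
  have le: "norm (coef K n) * (1 + real n) powr s \<le> C * (1 + real n) powr (-2)" for K n
  proof -
    have "norm (coef K n) * (1 + real n) powr s \<le> norm (coef K n) * (1 + real n) powr (real p - 2)"
      using p by (intro mult_left_mono powr_mono) auto
    also have "\<dots> = (norm (coef K n) * (1 + real n) ^ p) * (1 + real n) powr (-2)"
      by (simp add: powr_diff powr_minus powr_realpow divide_inverse)
    also have "\<dots> \<le> C * (1 + real n) powr (-2)" by (intro mult_right_mono C) auto
    finally show ?thesis .
  qed
  have "summable (\<lambda>n. real (Suc n) powr (-2))"
    by (subst summable_Suc_iff[of "\<lambda>k. real k powr (- 2)"]) (simp add: summable_real_powr_iff)
  then have "summable (\<lambda>n. C * (1 + real n) powr (-2))" by (intro summable_mult) (simp add: add.commute)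
  then have s2: "(\<lambda>n. C * (1 + real n) powr (-2)) summable_on UNIV"
    using C by (subst summable_on_UNIV_nonneg_real_iff) auto
  have s1: "(\<lambda>n. norm (coef K n) * (1 + real n) powr s) summable_on UNIV" for K
    by (rule summable_on_comparison_test[OF s2]) (use le in auto)
  show thesis
  proof (rule that[OF _ s1])
    show "(\<Sum>\<^sub>\<infinity>n. norm (coef K n) * (1 + real n) powr s) \<le> 1 + (\<Sum>\<^sub>\<infinity>n. C * (1 + real n) powr (-2))" for K
      using infsum_mono[OF s1 s2 le] by (simp add: add_increasing)
    show "0 < 1 + (\<Sum>\<^sub>\<infinity>n. C * (1 + real n) powr (-2))"
      using C by (intro add_pos_nonneg infsum_nonneg) auto
  qed
qed

text \<open>Up to a multiple of \<open>F K\<close>, a negative power of \<open>z\<close> is a series in nonnegative powers.\<close>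

lemma wiener_division:
  assumes w: "is_weight \<omega>" and s: "0 \<le> s" and \<omega>: "\<And>n::nat. \<omega> (int n) = (1 + real n) powr s"
    and B: "(\<lambda>n. norm (coef K n) * (1 + real n) powr s) summable_on UNIV"
      "(\<Sum>\<^sub>\<infinity>n. norm (coef K n) * (1 + real n) powr s) \<le> B"
    and r: "r < N"
  shows "wiener \<omega> (\<lambda>z. z powi (int r - int N) - z powi (int r - int N) * (F K (z powi int N) / F K 0))
           (exp S * real N powr s * B)"
proof (rule wienerI[OF w, where J = "UNIV - {0}" and k = "\<lambda>n. int r - int N + int n * int N" and a = "\<lambda>n. - coef K n / F K 0"])
  have F0: "norm (F K 0) > 0" "1 / norm (F K 0) \<le> exp S"
  proof -
    show *: "norm (F K 0) > 0" by (simp add: F_def)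
    have "1 / norm (F K 0) \<le> 1 / exp (- S)" using norm_F_0_ge[of K] by (intro divide_left_mono) (auto simp: F_def)
    then show "1 / norm (F K 0) \<le> exp S" by (simp add: exp_minus inverse_eq_divide)
  qed
  have B0: "0 \<le> B" by (rule order_trans[OF infsum_nonneg B(2)]) auto
  have le: "norm (- coef K n / F K 0) * \<omega> (int r - int N + int n * int N)
      \<le> exp S * real N powr s * (norm (coef K n) * (1 + real n) powr s)" if n: "n \<in> UNIV - {0}" for n
  proof -
    define m where "m = (n - 1) * N + r"
    \<comment> \<open>For \<open>n \<ge> 1\<close> the exponent is nonnegative, which is where
      \<open>\<omega>\<close> is a pure power. The term \<open>n = 0\<close> has cancelled thanks to
      the division by \<open>F K 0\<close>.\<close>
    have m: "int r - int N + int n * int N = int m" using n by (cases n) (auto simp: m_def algebra_simps)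
    have "1 + m \<le> N * (1 + n)" using r n by (cases n) (auto simp: m_def)
    then have "real (1 + m) \<le> real (N * (1 + n))" by (simp only: of_nat_le_iff)
    then have "1 + real m \<le> real N * (1 + real n)" by (simp add: distrib_left)
    then have "(1 + real m) powr s \<le> (real N * (1 + real n)) powr s" by (intro powr_mono2 s) auto
    then have \<omega>m: "\<omega> (int m) \<le> real N powr s * (1 + real n) powr s" by (simp add: \<omega> powr_mult)
    have "norm (- coef K n / F K 0) = (1 / norm (F K 0)) * norm (coef K n)" by (simp add: norm_divide)
    also have "\<dots> \<le> exp S * norm (coef K n)" using F0(2) by (rule mult_right_mono) simp
    finally have "norm (- coef K n / F K 0) * \<omega> (int m) \<le> (exp S * norm (coef K n)) * (real N powr s * (1 + real n) powr s)"
      by (rule mult_mono[OF _ \<omega>m]) (auto simp: \<omega>)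
    then show ?thesis unfolding m by (simp add: mult_ac)
  qed
  have sm: "(\<lambda>n. exp S * real N powr s * (norm (coef K n) * (1 + real n) powr s)) summable_on UNIV - {0}"
    by (intro summable_on_cmult_right summable_on_subset_banach[OF B(1)]) auto
  have pos: "0 \<le> \<omega> n" for n using is_weight_pos[OF w, of n] by simp
  show sm': "(\<lambda>n. norm (- coef K n / F K 0) * \<omega> (int r - int N + int n * int N)) summable_on UNIV - {0}"
    by (rule summable_on_comparison_test[OF sm le]) (auto intro: pos mult_nonneg_nonneg)
  have "(\<Sum>\<^sub>\<infinity>n\<in>UNIV - {0}. norm (- coef K n / F K 0) * \<omega> (int r - int N + int n * int N))
      \<le> (\<Sum>\<^sub>\<infinity>n\<in>UNIV - {0}. exp S * real N powr s * (norm (coef K n) * (1 + real n) powr s))"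
    by (rule infsum_mono[OF sm' sm le])
  also have "\<dots> = exp S * real N powr s * (\<Sum>\<^sub>\<infinity>n\<in>UNIV - {0}. norm (coef K n) * (1 + real n) powr s)"
    by (intro infsum_cmult_right summable_on_subset_banach[OF B(1)]) auto
  also have "\<dots> \<le> exp S * real N powr s * B"
  proof (intro mult_left_mono order_trans[OF _ B(2)])
    show "(\<Sum>\<^sub>\<infinity>n\<in>UNIV - {0}. norm (coef K n) * (1 + real n) powr s) \<le> (\<Sum>\<^sub>\<infinity>n. norm (coef K n) * (1 + real n) powr s)"
      by (rule infsum_mono_neutral[OF summable_on_subset_banach[OF B(1)] B(1)]) auto
  qed auto
  finally show "(\<Sum>\<^sub>\<infinity>n\<in>UNIV - {0}. norm (- coef K n / F K 0) * \<omega> (int r - int N + int n * int N)) \<le> exp S * real N powr s * B" .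
  fix z :: complex assume z: "z \<in> unit_circle"
  have nz: "z \<noteq> 0" using z by auto
  have z': "z powi int N \<in> unit_circle" using z by (simp add: norm_power)
  have "((\<lambda>n. coef K n * (z powi int N) ^ n) has_sum F K (z powi int N) - (\<Sum>n\<in>{0}. coef K n * (z powi int N) ^ n)) (UNIV - {0})"
    by (intro has_sum_Diff coef_sums z' has_sum_finite) auto
  then have "((\<lambda>n. coef K n * (z powi int N) ^ n) has_sum F K (z powi int N) - F K 0) (UNIV - {0})"
    by (simp add: coef_0)
  from has_sum_cmult_right[OF this, of "- (z powi (int r - int N) / F K 0)"]
  have "((\<lambda>n. - (z powi (int r - int N) / F K 0) * (coef K n * (z powi int N) ^ n)) has_sum
      - (z powi (int r - int N) / F K 0) * (F K (z powi int N) - F K 0)) (UNIV - {0})" .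
  moreover have "- (z powi (int r - int N) / F K 0) * (F K (z powi int N) - F K 0)
      = z powi (int r - int N) - z powi (int r - int N) * (F K (z powi int N) / F K 0)"
    using F0(1) by (simp add: field_simps)
  moreover have "- (z powi (int r - int N) / F K 0) * (coef K n * (z powi int N) ^ n)
      = - coef K n / F K 0 * z powi (int r - int N + int n * int N)" for n
  proof -
    have "z powi (int r - int N + int n * int N) = z powi (int r - int N) * z powi (int n * int N)"
      using nz by (simp add: power_int_add)
    also have "z powi (int n * int N) = (z powi int N) ^ n"
      by (simp add: mult.commute power_mult flip: of_nat_mult)
    finally show ?thesis by simp
  qed
  ultimately show "((\<lambda>n. - coef K n / F K 0 * z powi (int r - int N + int n * int N)) has_sum
      z powi (int r - int N) - z powi (int r - int N) * (F K (z powi int N) / F K 0)) (UNIV - {0})"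
    by (simp only:)
qed

end

section \<open>The quotient by the functions vanishing near the Cantor set\<close>

definition pow_weight :: "real \<Rightarrow> int \<Rightarrow> real" where
  "pow_weight s n = (1 + real_of_int \<bar>n\<bar>) powr s"

lemma is_weight_pow: "0 \<le> s \<Longrightarrow> is_weight (pow_weight s)"
proof -
  assume s: "0 \<le> s"
  have "(1 + real_of_int \<bar>n + m\<bar>) powr s \<le> (1 + real_of_int \<bar>n\<bar>) powr s * (1 + real_of_int \<bar>m\<bar>) powr s" for m n :: int
  proof -
    have "1 + real_of_int \<bar>n + m\<bar> \<le> (1 + real_of_int \<bar>n\<bar>) * (1 + real_of_int \<bar>m\<bar>)"
    proof -
      have nn: "0 \<le> \<bar>real_of_int n\<bar> * \<bar>real_of_int m\<bar>" by simp
      have eq: "(1 + \<bar>real_of_int n\<bar>) * (1 + \<bar>real_of_int m\<bar>)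
          = 1 + \<bar>real_of_int n\<bar> + \<bar>real_of_int m\<bar> + \<bar>real_of_int n\<bar> * \<bar>real_of_int m\<bar>"
        by (simp add: algebra_simps)
      show ?thesis
        unfolding of_int_abs of_int_add eq
        using nn abs_triangle_ineq[of "real_of_int n" "real_of_int m"] by linarith
    qed
    then have "(1 + real_of_int \<bar>n + m\<bar>) powr s \<le> ((1 + real_of_int \<bar>n\<bar>) * (1 + real_of_int \<bar>m\<bar>)) powr s"
      using s by (intro powr_mono2) auto
    then show ?thesis by (simp add: powr_mult)
  qed
  then show ?thesis using s by (auto simp: is_weight_def pow_weight_def intro!: ge_one_powr_ge_zero)
qed

lemma exp_decay_summable:
  assumes "0 < \<gamma>" "\<gamma> \<le> 1" "0 < c"
  shows "(\<lambda>n::int. exp (- (c * real_of_int \<bar>n\<bar> powr \<gamma>))) summable_on UNIV"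
proof -
  obtain K where K: "K > 0" "\<And>y. 0 < y \<Longrightarrow> y powr 2 * exp (- (c * y powr \<gamma>)) \<le> K"
    using powr_times_exp_bounded[OF assms(1,3), of 2] by auto
  define g where "g n = exp c * K * (1 + real n) powr (-2)" for n
  have "summable (\<lambda>n. real (Suc n) powr (-2))"
    by (subst summable_Suc_iff[of "\<lambda>k. real k powr (- 2)"]) (simp add: summable_real_powr_iff)
  then have g: "summable g" unfolding g_def by (intro summable_mult) (simp add: add.commute)
  have "(\<lambda>n::int. g (nat \<bar>n\<bar>)) summable_on UNIV"
    by (rule summable_on_int_of_nat[OF g]) (use K in \<open>simp add: g_def\<close>)
  then show ?thesis
  proof (rule summable_on_comparison_test)
    fix n :: int
    define x where "x = real_of_int \<bar>n\<bar>"
    have x: "0 \<le> x" by (simp add: x_def)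
    have "(1 + x) powr \<gamma> \<le> 1 powr \<gamma> + x powr \<gamma>" using x assms by (intro powr_subadditive) auto
    then have "c * (1 + x) powr \<gamma> \<le> c * (1 + x powr \<gamma>)" using assms by (intro mult_left_mono) auto
    then have "exp (- (c * x powr \<gamma>)) \<le> exp (c + - (c * (1 + x) powr \<gamma>))" by (simp add: distrib_left)
    also have "\<dots> = exp c * exp (- (c * (1 + x) powr \<gamma>))" by (rule exp_add)
    also have "exp (- (c * (1 + x) powr \<gamma>)) \<le> K * (1 + x) powr (-2)"
      using K(2)[of "1 + x"] x by (simp add: powr_minus_divide field_simps)
    finally show "exp (- (c * real_of_int \<bar>n\<bar> powr \<gamma>)) \<le> g (nat \<bar>n\<bar>)"
      by (simp add: g_def x_def mult.assoc)
  qed simp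
qed

lemma wiener_infsum_tail:
  assumes w: "is_weight w" and f: "wiener w f B" and e: "0 < \<epsilon>"
  obtains X where "finite X" "wiener w (\<lambda>z. f z - (\<Sum>n\<in>X. fourier_coeff f n * z powi n)) \<epsilon>"
proof -
  note fc = wiener_fourier_coeff[OF w f]
  define d where "d n = norm (fourier_coeff f n) * w n" for n
  have d: "d summable_on UNIV" using fc(1) by (simp add: d_def[abs_def])
  have "(sum d \<longlongrightarrow> (\<Sum>\<^sub>\<infinity>n. d n)) (finite_subsets_at_top UNIV)"
    using has_sum_infsum[OF d] by (simp add: has_sum_def)
  then have "\<forall>\<^sub>F X in finite_subsets_at_top UNIV. (\<Sum>\<^sub>\<infinity>n. d n) - \<epsilon> < sum d X"
    by (rule order_tendstoD) (use e in simp)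
  then obtain X where X: "finite X" "(\<Sum>\<^sub>\<infinity>n. d n) - \<epsilon> < sum d X"
    unfolding eventually_finite_subsets_at_top by blast
  have hd: "(d has_sum (\<Sum>\<^sub>\<infinity>n. d n) - sum d X) (UNIV - X)"
    by (intro has_sum_Diff has_sum_infsum d has_sum_finite X) auto
  have "wiener w (\<lambda>z. f z - (\<Sum>n\<in>X. fourier_coeff f n * z powi n)) \<epsilon>"
  proof (rule wienerI[OF w, where J = "UNIV - X" and a = "fourier_coeff f" and k = "\<lambda>n. n"])
    show "(\<lambda>j. norm (fourier_coeff f j) * w j) summable_on UNIV - X"
      using has_sum_imp_summable[OF hd] by (simp add: d_def[abs_def])
    show "(\<Sum>\<^sub>\<infinity>j\<in>UNIV - X. norm (fourier_coeff f j) * w j) \<le> \<epsilon>"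
      using infsumI[OF hd] X(2) by (simp add: d_def[abs_def])
    show "((\<lambda>j. fourier_coeff f j * z powi j) has_sum f z - (\<Sum>n\<in>X. fourier_coeff f n * z powi n)) (UNIV - X)"
      if "z \<in> unit_circle" for z
      by (intro has_sum_Diff fc(3) that has_sum_finite X) auto
  qed
  then show thesis using that X(1) by blast
qed

text \<open>The hypothesis \<open>\<beta> < cantor_b (1 / q)\<close> is what allows \<open>a\<close> to satisfy both \<open>a_gt\<close> (for \<open>\<sigma>\<close> close to
  \<open>1\<close> it reads \<open>\<gamma> / (1 - \<gamma>) < a\<close>) and \<open>2 * q powr (a - 1) < 1\<close>.\<close>

locale beurling_cantor = cantor_poles +
  fixes \<omega> :: "int \<Rightarrow> real" and s \<beta> \<gamma> \<sigma> C\<omega> D\<omega> :: real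
    and \<phi> \<tau> :: "complex \<Rightarrow> complex" and B\<phi> B\<tau> :: real
  assumes weight: "is_weight \<omega>" and s0: "0 \<le> s"
    and omega_nat: "\<And>n::nat. \<omega> (int n) = (1 + real n) powr s"
    and omega_ge: "\<And>n. pow_weight s n \<le> D\<omega> * \<omega> n"
    and omega_le: "\<And>n. \<omega> n \<le> C\<omega> * exp_weight \<beta> n"
    and order: "0 < \<beta>" "\<beta> < \<gamma>" "\<gamma> < \<sigma>" "\<sigma> < 1"
    and a_gt: "\<gamma> * \<sigma> / (\<sigma> - \<gamma>) < a"
    and plateau: "plateau \<phi> \<tau>"
    and wiener_phi: "wiener (exp_weight \<sigma>) \<phi> B\<phi>" and wiener_tau: "wiener (exp_weight \<sigma>) \<tau> B\<tau>"
begin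

lemma C\<omega>_pos: "0 < C\<omega>"
proof (rule ccontr)
  assume "\<not> 0 < C\<omega>"
  then have "C\<omega> * exp_weight \<beta> 0 \<le> 0" by (simp add: exp_weight_0)
  then show False using omega_le[of 0] is_weight_ge1[OF weight, of 0] by linarith
qed

lemma weights: "is_weight (exp_weight \<gamma>)" "is_weight (exp_weight \<sigma>)" "is_weight (pow_weight s)"
  using order s0 by (auto intro: is_weight_exp is_weight_pow)

text \<open>The class of \<open>f\<close> modulo \<open>ideal_J \<omega> E\<close> has norm at most \<open>B\<close>.\<close>

definition near :: "(complex \<Rightarrow> complex) \<Rightarrow> real \<Rightarrow> bool" where
  "near f B \<longleftrightarrow> (\<exists>g. (\<exists>C. wiener \<omega> g C) \<and>
     (\<exists>V. openin (top_of_set unit_circle) V \<and> E \<subseteq> V \<and> (\<forall>z\<in>V. g z = 0)) \<and>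
     wiener \<omega> (\<lambda>z. f z - g z) B)"

lemma near_of_wiener: "wiener \<omega> f B \<Longrightarrow> near f B"
  unfolding near_def
  by (intro exI[of _ "\<lambda>_. 0"] conjI exI[of _ 0] exI[of _ unit_circle] wiener_const weight)
     (use E_circle in auto)

lemma near_mono: "near f B \<Longrightarrow> B \<le> B' \<Longrightarrow> near f B'"
  unfolding near_def using wiener_mono by blast

lemma near_add:
  assumes "near f B" "near g C"
  shows "near (\<lambda>z. f z + g z) (B + C)"
proof -
  obtain f' V B' where f: "wiener \<omega> f' B'" "openin (top_of_set unit_circle) V" "E \<subseteq> V" "\<forall>z\<in>V. f' z = 0"
      "wiener \<omega> (\<lambda>z. f z - f' z) B"
    using assms(1) unfolding near_def by blast
  obtain g' W C' where g: "wiener \<omega> g' C'" "openin (top_of_set unit_circle) W" "E \<subseteq> W" "\<forall>z\<in>W. g' z = 0"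
      "wiener \<omega> (\<lambda>z. g z - g' z) C"
    using assms(2) unfolding near_def by blast
  have "wiener \<omega> (\<lambda>z. (f z - f' z) + (g z - g' z)) (B + C)" by (intro wiener_add weight f g)
  then have "wiener \<omega> (\<lambda>z. (f z + g z) - (f' z + g' z)) (B + C)" by (simp add: algebra_simps)
  moreover have "wiener \<omega> (\<lambda>z. f' z + g' z) (B' + C')" by (intro wiener_add weight f g)
  moreover have "openin (top_of_set unit_circle) (V \<inter> W)" "E \<subseteq> V \<inter> W" "\<forall>z\<in>V \<inter> W. f' z + g' z = 0"
    using f g by (auto intro: openin_Int)
  ultimately show ?thesis unfolding near_def by blast
qed

lemma near_mult:
  assumes h: "wiener \<omega> h C" and f: "near f B"
  shows "near (\<lambda>z. h z * f z) (C * B)"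
proof -
  obtain f' V B' where f: "wiener \<omega> f' B'" "openin (top_of_set unit_circle) V" "E \<subseteq> V" "\<forall>z\<in>V. f' z = 0"
      "wiener \<omega> (\<lambda>z. f z - f' z) B"
    using f unfolding near_def by blast
  have "wiener \<omega> (\<lambda>z. h z * (f z - f' z)) (C * B)" by (intro wiener_mult weight f h)
  then have "wiener \<omega> (\<lambda>z. h z * f z - h z * f' z) (C * B)" by (simp add: algebra_simps)
  moreover have "wiener \<omega> (\<lambda>z. h z * f' z) (C * B')" by (intro wiener_mult weight f h)
  moreover have "\<forall>z\<in>V. h z * f' z = 0" using f by auto
  ultimately show ?thesis unfolding near_def using f by blast
qed

lemma near_sum:
  assumes "finite I" "\<And>n. n \<in> I \<Longrightarrow> near (f n) (B n)"
  shows "near (\<lambda>z. \<Sum>n\<in>I. f n z) (\<Sum>n\<in>I. B n)"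
  using assms
proof (induction I rule: finite_induct)
  case empty
  show ?case using near_of_wiener[OF wiener_const[OF weight, of 0 0]] by simp
next
  case (insert x I)
  then show ?case using near_add[of "f x" "B x" "\<lambda>z. \<Sum>n\<in>I. f n z" "\<Sum>n\<in>I. B n"] by simp
qed

lemma near_cmult: "near f B \<Longrightarrow> near (\<lambda>z. c * f z) (norm c * B)"
  using near_mult[OF wiener_const[OF weight, of c "norm c * \<omega> 0"], of f B] omega_nat[of 0] by simp

text \<open>For fixed \<open>N\<close> the factor \<open>real N powr \<beta>\<close> is absorbed by
  passing from \<open>\<beta>\<close> to \<open>\<gamma>\<close>. The constant depends on
  \<open>N\<close>, which is harmless where only membership in the algebra is at stake.\<close>

lemma omega_subst_bounded: "\<exists>C. \<forall>n. \<omega> (r + n * int N) \<le> C * exp_weight \<gamma> n"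
proof (intro exI allI)
  fix n :: int
  define x where "x = real_of_int \<bar>n\<bar>"
  have x: "0 \<le> x" by (simp add: x_def)
  define D where "D = (real N powr \<beta>) * (1 / (1 / (1 + real N powr \<beta>))) powr (\<beta> / (\<gamma> - \<beta>))"
  have "\<omega> (r + n * int N) \<le> \<omega> r * \<omega> (n * int N)" by (rule is_weight_mult[OF weight])
  also have "\<omega> (n * int N) \<le> C\<omega> * exp_weight \<beta> (n * int N)" by (rule omega_le)
  also have "exp_weight \<beta> (n * int N) = exp (real N powr \<beta> * x powr \<beta>)"
    using x by (simp add: exp_weight_def x_def abs_mult powr_mult mult.commute)
  also have "real N powr \<beta> * x powr \<beta> \<le> x powr \<gamma> + D"
  proof -
    have "x powr \<beta> \<le> 1 / (1 + real N powr \<beta>) * x powr \<gamma> + (1 / (1 / (1 + real N powr \<beta>))) powr (\<beta> / (\<gamma> - \<beta>))"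
      using order x by (intro powr_le_interpolate) (auto intro: add_pos_nonneg)
    then have "real N powr \<beta> * x powr \<beta> \<le> real N powr \<beta> * (1 / (1 + real N powr \<beta>) * x powr \<gamma>) + D"
      unfolding D_def distrib_left[symmetric] by (rule mult_left_mono) simp
    also have "real N powr \<beta> * (1 / (1 + real N powr \<beta>) * x powr \<gamma>) \<le> 1 * x powr \<gamma>"
      unfolding mult.assoc[symmetric] by (intro mult_right_mono) (auto simp: divide_le_eq add_pos_nonneg)
    finally show ?thesis by simp
  qed
  finally have "\<omega> (r + n * int N) \<le> \<omega> r * (C\<omega> * exp (x powr \<gamma> + D))"
    using C\<omega>_pos is_weight_pos[OF weight, of r] by simp
  then show "\<omega> (r + n * int N) \<le> \<omega> r * C\<omega> * exp D * exp_weight \<gamma> n"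
    by (simp add: exp_weight_def x_def exp_add mult_ac)
qed

lemma wiener_omega_subst:
  assumes "wiener (exp_weight \<gamma>) h A"
  shows "\<exists>C. wiener \<omega> (\<lambda>z. h (z powi int N)) C"
proof -
  obtain C where "\<And>n. \<omega> (0 + n * int N) \<le> C * exp_weight \<gamma> n" using omega_subst_bounded[of 0 N] by blast
  from wiener_subst[OF weight weights(1) assms this] show ?thesis by auto
qed

text \<open>Interpolates the two bounds \<open>\<epsilon>\<close> and \<open>A * exp (- \<bar>n\<bar> powr \<gamma>)\<close> for the Fourier coefficients.\<close>

lemma wiener_of_small_sup:
  obtains C where "C > 0" "\<And>h A \<epsilon>. wiener (exp_weight \<gamma>) h A \<Longrightarrow> (\<And>z. z \<in> unit_circle \<Longrightarrow> norm (h z) \<le> \<epsilon>) \<Longrightarrow>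
      wiener \<omega> (\<lambda>z. h (z powi int N)) (C * sqrt (A * \<epsilon>))"
proof -
  \<comment> \<open>The geometric mean of the two coefficient bounds decays like
    \<open>exp (- \<bar>n\<bar> powr \<gamma> / 2)\<close>. The share \<open>1/4\<close> of the
    exponent pays for \<open>\<omega>\<close>, and the remaining \<open>1/4\<close> makes the series
    converge.\<close>
  define D where "D = (real N powr \<beta>) * (1 / (1 / (4 * (1 + real N powr \<beta>)))) powr (\<beta> / (\<gamma> - \<beta>))"
  have om: "\<omega> (n * int N) \<le> C\<omega> * exp D * exp (1/4 * real_of_int \<bar>n\<bar> powr \<gamma>)" for n
  proof -
    define x where "x = real_of_int \<bar>n\<bar>"
    have x: "0 \<le> x" by (simp add: x_def)
    have "real N powr \<beta> * x powr \<beta> \<le> 1/4 * x powr \<gamma> + D"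
    proof -
      have "x powr \<beta> \<le> 1 / (4 * (1 + real N powr \<beta>)) * x powr \<gamma> + (1 / (1 / (4 * (1 + real N powr \<beta>)))) powr (\<beta> / (\<gamma> - \<beta>))"
        using order x by (intro powr_le_interpolate) (auto intro: add_pos_nonneg)
      then have "real N powr \<beta> * x powr \<beta> \<le> real N powr \<beta> * (1 / (4 * (1 + real N powr \<beta>)) * x powr \<gamma>) + D"
        unfolding D_def distrib_left[symmetric] by (rule mult_left_mono) simp
      also have "real N powr \<beta> * (1 / (4 * (1 + real N powr \<beta>)) * x powr \<gamma>) \<le> 1/4 * x powr \<gamma>"
        unfolding mult.assoc[symmetric] by (intro mult_right_mono) (auto simp: divide_le_eq add_pos_nonneg)
      finally show ?thesis by simp
    qed
    moreover have "exp_weight \<beta> (n * int N) = exp (real N powr \<beta> * x powr \<beta>)"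
      using x by (simp add: exp_weight_def x_def abs_mult powr_mult mult.commute)
    ultimately have "exp_weight \<beta> (n * int N) \<le> exp (1/4 * x powr \<gamma> + D)" by simp
    then have "C\<omega> * exp_weight \<beta> (n * int N) \<le> C\<omega> * exp (1/4 * x powr \<gamma> + D)"
      using C\<omega>_pos by (intro mult_left_mono) auto
    then show ?thesis using omega_le[of "n * int N"] by (simp add: exp_add x_def mult_ac)
  qed
  define g where "g n = exp (- (1/4 * real_of_int \<bar>n\<bar> powr \<gamma>))" for n :: int
  have g: "g summable_on UNIV" unfolding g_def using order by (intro exp_decay_summable) auto
  have g0: "0 \<le> infsum g UNIV" by (intro infsum_nonneg) (simp add: g_def)
  show thesis
  proof (rule that[of "C\<omega> * exp D * (1 + infsum g UNIV)"])
    show "0 < C\<omega> * exp D * (1 + infsum g UNIV)"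
      using C\<omega>_pos g0 by (intro mult_pos_pos add_pos_nonneg) auto
    fix h A \<epsilon>
    assume h: "wiener (exp_weight \<gamma>) h A" and sup: "\<And>z. z \<in> unit_circle \<Longrightarrow> norm (h z) \<le> \<epsilon>"
    have e0: "0 \<le> \<epsilon>" by (rule order_trans[OF norm_ge_zero sup[of 1]]) simp
    have A0: "0 \<le> A" by (rule wiener_nonneg[OF weights(1) h])
    define c where "c = fourier_coeff h"
    note hc = wiener_fourier_coeff[OF weights(1) h, folded c_def]
    have c1: "norm (c n) \<le> \<epsilon>" for n
      unfolding c_def by (rule norm_fourier_coeff_le[OF wiener_continuous[OF weights(1) h] sup])
    have c2: "norm (c n) * exp_weight \<gamma> n \<le> A" for n
    proof -
      have "(\<Sum>\<^sub>\<infinity>n\<in>{n}. norm (c n) * exp_weight \<gamma> n) \<le> (\<Sum>\<^sub>\<infinity>n. norm (c n) * exp_weight \<gamma> n)"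
        by (rule infsum_mono_neutral[OF _ hc(1)]) (simp_all add: exp_weight_def)
      then show ?thesis using hc(2) by simp
    qed
    have c3: "norm (c n) \<le> sqrt (A * \<epsilon>) * exp (- (1/2 * real_of_int \<bar>n\<bar> powr \<gamma>))" for n
    proof -
      define y where "y = real_of_int \<bar>n\<bar> powr \<gamma>"
      have "norm (c n) * exp y \<le> A" using c2[of n] by (simp add: exp_weight_def y_def)
      then have "norm (c n) \<le> A * exp (- y)" by (simp add: exp_minus field_simps)
      then have "norm (c n) * norm (c n) \<le> (A * exp (- y)) * \<epsilon>"
        using c1[of n] A0 by (intro mult_mono) auto
      also have "\<dots> = (A * \<epsilon>) * (exp (- (1/2 * y)))\<^sup>2" by (simp add: power2_eq_square flip: exp_add)
      finally have "sqrt (norm (c n) * norm (c n)) \<le> sqrt ((A * \<epsilon>) * (exp (- (1/2 * y)))\<^sup>2)" by (rule real_sqrt_le_mono)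
      then show ?thesis by (simp add: real_sqrt_mult y_def)
    qed
    have le: "norm (c n) * \<omega> (n * int N) \<le> sqrt (A * \<epsilon>) * (C\<omega> * exp D) * g n" for n
    proof -
      have "norm (c n) * \<omega> (n * int N)
          \<le> (sqrt (A * \<epsilon>) * exp (- (1/2 * real_of_int \<bar>n\<bar> powr \<gamma>))) * (C\<omega> * exp D * exp (1/4 * real_of_int \<bar>n\<bar> powr \<gamma>))"
        using c3 om is_weight_pos[OF weight] A0 e0 by (intro mult_mono) (auto intro: less_imp_le)
      also have "\<dots> = sqrt (A * \<epsilon>) * (C\<omega> * exp D) * g n"
      proof -
        have "exp (- (1/2 * y)) * exp (1/4 * y) = exp (- (1/4 * y))" for y :: real by (simp flip: exp_add)
        then show ?thesis unfolding g_def by (metis (no_types, lifting) mult.assoc mult.left_commute)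
      qed
      finally show ?thesis .
    qed
    have sm: "(\<lambda>n. sqrt (A * \<epsilon>) * (C\<omega> * exp D) * g n) summable_on UNIV" by (intro summable_on_cmult_right g)
    have sm': "(\<lambda>n. norm (c n) * \<omega> (n * int N)) summable_on UNIV"
      by (rule summable_on_comparison_test[OF sm le]) (use is_weight_pos[OF weight] in \<open>auto intro!: mult_nonneg_nonneg intro: less_imp_le\<close>)
    show "wiener \<omega> (\<lambda>z. h (z powi int N)) (C\<omega> * exp D * (1 + infsum g UNIV) * sqrt (A * \<epsilon>))"
    proof (rule wienerI[OF weight sm'])
      have "(\<Sum>\<^sub>\<infinity>n. norm (c n) * \<omega> (n * int N)) \<le> (\<Sum>\<^sub>\<infinity>n. sqrt (A * \<epsilon>) * (C\<omega> * exp D) * g n)"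
        by (rule infsum_mono[OF sm' sm le])
      also have "\<dots> = sqrt (A * \<epsilon>) * (C\<omega> * exp D) * infsum g UNIV" by (intro infsum_cmult_right g)
      also have "\<dots> \<le> sqrt (A * \<epsilon>) * (C\<omega> * exp D) * (1 + infsum g UNIV)"
        using C\<omega>_pos A0 e0 by (intro mult_left_mono) auto
      finally show "(\<Sum>\<^sub>\<infinity>n. norm (c n) * \<omega> (n * int N)) \<le> C\<omega> * exp D * (1 + infsum g UNIV) * sqrt (A * \<epsilon>)"
        by (simp add: mult_ac)
      fix z :: complex assume z: "z \<in> unit_circle"
      then have "z powi int N \<in> unit_circle" by (simp add: norm_power)
      from hc(3)[OF this] show "((\<lambda>j. c j * z powi (j * int N)) has_sum h (z powi int N)) UNIV"
        unfolding mult.commute[of _ "int N"] power_int_mult .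
    qed
  qed
qed

end

context cantor_poles
begin

text \<open>The coefficients are at most \<open>exp (- n / (4 * Q))\<close> with
  \<open>Q = q ^ K\<close>. Half of this rate absorbs \<open>exp_weight \<gamma>\<close> at the cost
  \<open>(8 * Q) powr (\<gamma> / (1 - \<gamma>))\<close>; the other half leaves a geometric series
  of sum at most \<open>1 + 8 * Q\<close>.\<close>

lemma wiener_F:
  assumes g: "0 < \<gamma>" "\<gamma> < 1"
  shows "wiener (exp_weight \<gamma>) (F K) (exp ((8 * real q ^ K) powr (\<gamma> / (1 - \<gamma>))) * (1 + 8 * real q ^ K))"
proof -
  define Q where "Q = real q ^ K"
  have Q: "Q \<ge> 1" using q_gt by (simp add: Q_def)
  have rho: "\<rho> K = 1 / Q" by (simp add: \<rho>_def Q_def)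
  define t where "t = exp (- (1 / (8 * Q)))"
  have t: "0 < t" "t < 1" using Q by (auto simp: t_def)
  define H where "H = exp ((8 * Q) powr (\<gamma> / (1 - \<gamma>)))"
  have w: "is_weight (exp_weight \<gamma>)" using g by (intro is_weight_exp) auto
  have le: "norm (coef K n) * exp_weight \<gamma> (int n) \<le> H * t ^ n" for n
  proof -
    define x where "x = 1 / (4 * Q)"
    have x: "0 \<le> x" "x \<le> 1/4" using Q by (auto simp: x_def field_simps)
    have "exp x \<le> 1 + x + x\<^sup>2" using x by (intro exp_bound) auto
    also have "\<dots> \<le> 1 + 2 * x" using x by (simp add: power2_eq_square mult_left_le)
    finally have "exp x \<le> 1 + \<rho> K / 2" by (simp add: x_def rho)
    then have "exp x ^ n \<le> (1 + \<rho> K / 2) ^ n" by (intro power_mono) auto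
    then have "1 / (1 + \<rho> K / 2) ^ n \<le> 1 / exp x ^ n" by (intro divide_left_mono) (auto simp: rho_pos add_pos_pos)
    then have c: "norm (coef K n) \<le> 1 / exp x ^ n" using norm_coef_le[of K n] by linarith
    have "1 / exp x ^ n = exp (- (real n * x))" by (simp add: exp_minus exp_of_nat_mult inverse_eq_divide)
    then have "norm (coef K n) \<le> exp (- (real n * x))" using c by simp
    moreover have "real n powr \<gamma> \<le> 1 / (8 * Q) * real n + (8 * Q) powr (\<gamma> / (1 - \<gamma>))"
      using powr_le_interpolate[of \<gamma> 1 "1 / (8 * Q)" "real n"] g Q by simp
    then have "exp_weight \<gamma> (int n) \<le> exp (1 / (8 * Q) * real n + (8 * Q) powr (\<gamma> / (1 - \<gamma>)))"
      by (simp add: exp_weight_def)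
    ultimately have "norm (coef K n) * exp_weight \<gamma> (int n)
        \<le> exp (- (real n * x)) * exp (1 / (8 * Q) * real n + (8 * Q) powr (\<gamma> / (1 - \<gamma>)))"
      by (intro mult_mono) (auto simp: exp_weight_def)
    also have "\<dots> = H * t ^ n"
    proof -
      have "t ^ n = exp (real n * (- (1 / (8 * Q))))" by (simp only: t_def exp_of_nat_mult)
      moreover have "- (real n * x) + (1 / (8 * Q) * real n + (8 * Q) powr (\<gamma> / (1 - \<gamma>)))
          = (8 * Q) powr (\<gamma> / (1 - \<gamma>)) + real n * (- (1 / (8 * Q)))"
        using Q by (simp add: x_def field_simps)
      ultimately show ?thesis unfolding H_def by (simp only: exp_add[symmetric])
    qed
    finally show ?thesis .
  qed
  have ge: "(\<lambda>n. H * t ^ n) sums (H * (1 / (1 - t)))" using t by (intro sums_mult geometric_sums) auto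
  have hs: "((\<lambda>n. H * t ^ n) has_sum (H * (1 / (1 - t)))) UNIV"
    using t by (intro norm_summable_imp_has_sum[OF _ ge]) (use sums_summable[OF ge] in \<open>simp add: abs_mult H_def\<close>)
  have t1: "1 / (1 - t) \<le> 1 + 8 * Q"
  proof -
    have "1 + 1 / (8 * Q) \<le> exp (1 / (8 * Q))" by (rule exp_ge_add_one_self)
    then have "t \<le> 1 / (1 + 1 / (8 * Q))"
      unfolding t_def exp_minus inverse_eq_divide using Q by (intro divide_left_mono) (auto intro!: mult_pos_pos add_pos_pos)
    also have "\<dots> = 1 - 1 / (1 + 8 * Q)" using Q by (simp add: field_simps)
    finally have "1 / (1 + 8 * Q) \<le> 1 - t" by simp
    then have "1 / (1 - t) \<le> 1 / (1 / (1 + 8 * Q))" using Q t by (intro divide_left_mono) auto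
    then show ?thesis by simp
  qed
  have H0: "H > 0" by (simp add: H_def)
  have sm: "(\<lambda>n. norm (coef K n) * exp_weight \<gamma> (int n)) summable_on UNIV"
    by (rule summable_on_comparison_test[OF has_sum_imp_summable[OF hs] le]) (simp add: exp_weight_def)
  have "wiener (exp_weight \<gamma>) (F K) (H * (1 + 8 * Q))"
  proof (rule wienerI[OF w sm])
    have "(\<Sum>\<^sub>\<infinity>n. norm (coef K n) * exp_weight \<gamma> (int n)) \<le> (\<Sum>\<^sub>\<infinity>n. H * t ^ n)"
      by (rule infsum_mono[OF sm has_sum_imp_summable[OF hs] le])
    also have "\<dots> = H * (1 / (1 - t))" by (rule infsumI[OF hs])
    also have "\<dots> \<le> H * (1 + 8 * Q)" using t1 H0 by (intro mult_left_mono) auto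
    finally show "(\<Sum>\<^sub>\<infinity>n. norm (coef K n) * exp_weight \<gamma> (int n)) \<le> H * (1 + 8 * Q)" .
    show "((\<lambda>j. coef K j * z powi int j) has_sum F K z) UNIV" if "z \<in> unit_circle" for z
      using coef_sums[OF that] by simp
  qed
  then show ?thesis by (simp add: H_def Q_def)
qed

end

section \<open>Cutting off near the Cantor set and bounding negative powers\<close>

context beurling_cantor
begin

abbreviation b :: "nat \<Rightarrow> complex \<Rightarrow> complex \<Rightarrow> complex" where "b \<equiv> bump \<phi> \<tau>"

text \<open>On the circle, a cutoff that is \<open>1\<close> near \<open>E\<close> and lives in the
  cells of \<open>G K\<close>, where \<open>F K\<close> is small.\<close>

definition chi :: "nat \<Rightarrow> complex \<Rightarrow> complex" where
  "chi K z = (\<Sum>e\<in>G K. b (q ^ K) e z)"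

lemma q_power_pos: "q ^ K > 0"
  using q3 by simp

lemma chi_value:
  assumes "e ^ (q ^ K) = 1" "e \<in> unit_circle" "\<bar>t\<bar> \<le> 1/2"
  shows "chi K (e * cis (2 * pi * t / real q ^ K)) = (if e \<in> G K then \<phi> (cis (2 * pi * t)) else 0)"
proof -
  have "b (q ^ K) e' (e * cis (2 * pi * t / real q ^ K)) = (if e' = e then \<phi> (cis (2 * pi * t)) else 0)" if "e' \<in> G K" for e'
    using bump_value[OF plateau q_power_pos G_root[OF that] G_circle[OF that] assms] by simp
  then show ?thesis unfolding chi_def using finite_G by (simp add: sum.delta)
qed

lemma wiener_chi:
  "wiener (exp_weight \<gamma>) (chi K) (2 * 2 ^ K * (exp (2 * (real q ^ K) powr (\<gamma> * \<sigma> / (\<sigma> - \<gamma>))) * (B\<phi> * exp (2 * pi * B\<tau>))))"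
proof -
  let ?B = "exp (2 * (real q ^ K) powr (\<gamma> * \<sigma> / (\<sigma> - \<gamma>))) * (B\<phi> * exp (2 * pi * B\<tau>))"
  have g0: "0 < \<gamma>" using order by linarith
  have "wiener (exp_weight \<gamma>) (chi K) (\<Sum>e\<in>G K. ?B)"
    unfolding chi_def
  proof (rule wiener_sum[OF weights(1) finite_G])
    fix e assume "e \<in> G K"
    show "wiener (exp_weight \<gamma>) (b (q ^ K) e) ?B"
      using wiener_bump[OF g0 order(3,4) wiener_phi wiener_tau q_power_pos[of K] G_circle[OF \<open>e \<in> G K\<close>]] by simp
  qed
  moreover have "(\<Sum>e\<in>G K. ?B) \<le> 2 * 2 ^ K * ?B"
  proof -
    have "real (card (G K)) \<le> real (2 ^ Suc K)" using card_G of_nat_le_iff by blast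
    then have "real (card (G K)) * ?B \<le> (2 * 2 ^ K) * ?B"
      using wiener_nonneg[OF weights(2) wiener_phi] by (intro mult_right_mono) auto
    then show ?thesis by simp
  qed
  ultimately show ?thesis by (rule wiener_mono)
qed

lemma norm_F_chi_le:
  assumes z: "z \<in> unit_circle"
  shows "norm (F K z * chi K z) \<le> B\<phi> * exp (- (c0 / 5 * (real q ^ K) powr a))"
proof -
  obtain e t where et: "e ^ (q ^ K) = 1" "e \<in> unit_circle" "\<bar>t\<bar> \<le> 1/2" "z = e * cis (2 * pi * t / real (q ^ K))"
    by (rule circle_grid[OF z q_power_pos])
  have z': "z = e * cis (2 * pi * t / real q ^ K)" using et(4) by simp
  have B0: "0 \<le> B\<phi>" by (rule wiener_nonneg[OF weights(2) wiener_phi])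
  show ?thesis
  proof (cases "e \<in> G K")
    case True
    have "norm (chi K z) \<le> B\<phi>"
      unfolding z' chi_value[OF et(1-3)] using True wiener_norm_le[OF weights(2) wiener_phi] by simp
    moreover have "norm (F K z) \<le> exp (- (c0 / 5 * (real q ^ K) powr a))"
      unfolding z' by (rule norm_F_near_G[OF True et(3)])
    ultimately have "norm (F K z) * norm (chi K z) \<le> exp (- (c0 / 5 * (real q ^ K) powr a)) * B\<phi>"
      by (intro mult_mono) auto
    then show ?thesis by (simp add: norm_mult mult.commute)
  next
    case False
    then show ?thesis unfolding z' chi_value[OF et(1-3)] using B0 by simp
  qed
qed

text \<open>The power \<open>q ^ j\<close> carries the cells of \<open>G (K + j)\<close> to those of
  \<open>G K\<close>, and in their inner part \<open>chi K\<close> is \<open>1\<close>. So the part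
  with the factor \<open>1 - chi K\<close> vanishes near \<open>E\<close> and drops out modulo
  \<open>J\<close>.\<close>

lemma near_F_of_product:
  assumes "wiener \<omega> (\<lambda>z. F K (z powi int (q ^ j)) * chi K (z powi int (q ^ j))) B"
  shows "near (\<lambda>z. F K (z powi int (q ^ j))) B"
proof -
  have g0: "0 < \<gamma>" "\<gamma> < 1" using order by linarith+
  obtain C1 where C1: "wiener \<omega> (\<lambda>z. F K (z powi int (q ^ j))) C1"
    using wiener_omega_subst[OF wiener_F[OF g0]] by blast
  define g where "g z = F K (z powi int (q ^ j)) - F K (z powi int (q ^ j)) * chi K (z powi int (q ^ j))" for z
  have "wiener \<omega> g (C1 + B)" unfolding g_def by (intro wiener_diff weight C1 assms)
  moreover have "\<exists>V. openin (top_of_set unit_circle) V \<and> E \<subseteq> V \<and> (\<forall>z\<in>V. g z = 0)"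
  proof (rule vanishing_near_E[where k = "K + j"])
    fix e :: complex and t :: real assume e: "e \<in> G (K + j)" and t: "\<bar>t\<bar> \<le> 2/5"
    define z where "z = e * cis (2 * pi * t / real q ^ (K + j))"
    have "real (q ^ j) * (2 * pi * t / real q ^ (K + j)) = 2 * pi * t / real q ^ K"
      using q_gt by (simp add: power_add)
    then have "z ^ (q ^ j) = e ^ (q ^ j) * cis (2 * pi * t / real q ^ K)"
      unfolding z_def power_mult_distrib Complex.DeMoivre by simp
    moreover have "chi K (e ^ (q ^ j) * cis (2 * pi * t / real q ^ K)) = 1"
    proof -
      have eG: "e ^ (q ^ j) \<in> G K" by (rule G_power[OF e])
      have "\<bar>t\<bar> \<le> 1/2" using t by simp
      then show ?thesis
        using chi_value[OF G_root[OF eG] G_circle[OF eG], of t] eG t plateau by (simp add: plateau_def)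
    qed
    moreover have zz: "e * cis (2 * pi * t / real (q ^ (K + j))) = z" by (simp add: z_def)
    ultimately show "g (e * cis (2 * pi * t / real (q ^ (K + j)))) = 0"
      unfolding g_def zz power_int_of_nat by simp
  qed
  moreover have "wiener \<omega> (\<lambda>z. F K (z powi int (q ^ j)) - g z) B" using assms by (simp add: g_def)
  ultimately show ?thesis unfolding near_def by blast
qed

text \<open>The norm of \<open>F K * chi K\<close> for \<open>exp_weight \<gamma>\<close> grows like
  the exponential of \<open>Q powr a'\<close>, its supremum decays like that of
  \<open>- (Q powr a)\<close>, both up to constants in the exponent, and \<open>a' < a\<close>.
  \<open>wiener_of_small_sup\<close> balances the two.\<close>

lemma near_F:
  assumes \<delta>: "0 < \<delta>"
  shows "\<exists>K. near (\<lambda>z. F K (z powi int (q ^ j))) \<delta>"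
proof -
  have g0: "0 < \<gamma>" "\<gamma> < 1" using order by linarith+
  obtain C where C: "C > 0" "\<And>h A \<epsilon>. wiener (exp_weight \<gamma>) h A \<Longrightarrow> (\<And>z. z \<in> unit_circle \<Longrightarrow> norm (h z) \<le> \<epsilon>) \<Longrightarrow>
      wiener \<omega> (\<lambda>z. h (z powi int (q ^ j))) (C * sqrt (A * \<epsilon>))"
    by (rule wiener_of_small_sup[where N = "q ^ j"], rule that) auto
  define a' where "a' = \<gamma> * \<sigma> / (\<sigma> - \<gamma>)"
  have a': "0 < a'" "a' < a" using a_gt order by (auto simp: a'_def)
  \<comment> \<open>The exponent of the cost of \<open>F K\<close> does not exceed that of the
    cutoff, because \<open>\<sigma> \<le> 1\<close>.\<close>
  have ga: "\<gamma> / (1 - \<gamma>) \<le> a'"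
  proof -
    have "\<gamma> * (\<sigma> - \<gamma>) \<le> \<gamma> * \<sigma> * (1 - \<gamma>)" using order by (simp add: algebra_simps mult_left_le)
    then show ?thesis unfolding a'_def using order g0 by (simp add: divide_le_eq pos_le_divide_eq)
  qed
  define BB where "BB = B\<phi> * exp (2 * pi * B\<tau>)"
  have B0: "0 \<le> B\<phi>" "0 \<le> BB" using wiener_nonneg[OF weights(2) wiener_phi] by (auto simp: BB_def)
  define A where "A K = exp ((8 * real q ^ K) powr (\<gamma> / (1 - \<gamma>))) * (1 + 8 * real q ^ K) *
      (2 * 2 ^ K * (exp (2 * (real q ^ K) powr a') * BB))" for K
  define \<epsilon> where "\<epsilon> K = B\<phi> * exp (- (c0 / 5 * (real q ^ K) powr a))" for K
  have wF: "wiener \<omega> (\<lambda>z. F K (z powi int (q ^ j)) * chi K (z powi int (q ^ j))) (C * sqrt (A K * \<epsilon> K))" for K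
  proof -
    have "wiener (exp_weight \<gamma>) (\<lambda>z. F K z * chi K z) (A K)"
      unfolding A_def a'_def BB_def by (intro wiener_mult weights wiener_F wiener_chi g0)
    moreover have "norm (F K z * chi K z) \<le> \<epsilon> K" if "z \<in> unit_circle" for z
      unfolding \<epsilon>_def by (rule norm_F_chi_le[OF that])
    ultimately show ?thesis by (rule C(2))
  qed
  \<comment> \<open>Half of the rate \<open>c0 / 5\<close>: one half absorbs the growth
    \<open>exp (c1 * Q powr a')\<close>, the other the powers of \<open>Q\<close>.\<close>
  define c2 where "c2 = c0 / 10"
  have c2: "c2 > 0" using c0_pos by (simp add: c2_def)
  define c1 where "c1 = 2 + 8 powr a'"
  have c1: "c1 > 0" by (simp add: c1_def add_pos_nonneg)
  define D where "D = c1 * (1 / (c2 / c1)) powr (a' / (a - a'))"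
  obtain L where L: "L > 0" "\<And>y. 0 < y \<Longrightarrow> y powr 3 * exp (- (c2 * y powr a)) \<le> L"
    using powr_times_exp_bounded[OF a0 c2, of 3] by auto
  have AE: "A K * \<epsilon> K \<le> (18 * BB * B\<phi> * exp D * L) * (1 / real q ^ K)" for K
  proof -
    define Q where "Q = real q ^ K"
    have Q: "Q \<ge> 1" using q_gt by (simp add: Q_def)
    have "(2::real) ^ K \<le> Q" unfolding Q_def using q3 by (intro power_mono) auto
    have "(8 * Q) powr (\<gamma> / (1 - \<gamma>)) \<le> (8 * Q) powr a'" using Q ga by (intro powr_mono) auto
    then have "(8 * Q) powr (\<gamma> / (1 - \<gamma>)) \<le> 8 powr a' * Q powr a'" using Q by (simp add: powr_mult)
    then have "A K \<le> exp (8 powr a' * Q powr a') * (9 * Q) * (2 * Q * (exp (2 * Q powr a') * BB))"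
      unfolding A_def Q_def[symmetric] using Q B0 \<open>2 ^ K \<le> Q\<close>
      by (intro mult_mono) auto
    also have "\<dots> = 18 * BB * Q\<^sup>2 * exp (c1 * Q powr a')"
      by (simp add: c1_def distrib_right exp_add power2_eq_square)
    finally have A: "A K \<le> 18 * BB * Q\<^sup>2 * exp (c1 * Q powr a')" .
    have "Q powr a' \<le> c2 / c1 * Q powr a + (1 / (c2 / c1)) powr (a' / (a - a'))"
      using a' c1 c2 Q by (intro powr_le_interpolate) auto
    then have "c1 * Q powr a' \<le> c1 * (c2 / c1 * Q powr a + (1 / (c2 / c1)) powr (a' / (a - a')))"
      using c1 by (intro mult_left_mono) auto
    then have I: "c1 * Q powr a' \<le> c2 * Q powr a + D" using c1 by (simp add: D_def distrib_left)
    have "A K * \<epsilon> K \<le> (18 * BB * Q\<^sup>2 * exp (c1 * Q powr a')) * \<epsilon> K"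
      using A B0 by (intro mult_right_mono) (auto simp: \<epsilon>_def)
    also have "\<dots> = 18 * BB * B\<phi> * Q\<^sup>2 * exp (c1 * Q powr a' - 2 * (c2 * Q powr a))"
    proof -
      have eps: "\<epsilon> K = B\<phi> * exp (- (2 * (c2 * Q powr a)))" by (simp add: \<epsilon>_def c2_def Q_def)
      have ed: "exp (x - y) = exp x * exp (- y)" for x y :: real
        by (simp add: exp_diff exp_minus divide_inverse)
      show ?thesis unfolding eps ed by (simp only: mult_ac)
    qed
    also have "\<dots> \<le> 18 * BB * B\<phi> * Q\<^sup>2 * exp (D + - (c2 * Q powr a))"
      using I B0 by (intro mult_left_mono) auto
    also have "\<dots> = (18 * BB * B\<phi> * exp D) * ((Q powr 3 * exp (- (c2 * Q powr a))) * (1 / Q))"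
    proof -
      have Q2: "Q\<^sup>2 = Q powr 3 * (1 / Q)" using Q by (simp add: powr_numeral power2_eq_square power3_eq_cube)
      show ?thesis unfolding exp_add Q2 by (simp only: mult_ac)
    qed
    also have "\<dots> \<le> (18 * BB * B\<phi> * exp D) * (L * (1 / Q))"
      using L(2)[of Q] Q B0 by (intro mult_left_mono mult_right_mono) auto
    finally show ?thesis by (simp add: Q_def mult_ac)
  qed
  define M where "M = 18 * BB * B\<phi> * exp D * L"
  have "(\<lambda>K. C * sqrt (M * (1 / real q) ^ K)) \<longlonglongrightarrow> C * sqrt (M * 0)"
    using q_gt by (intro tendsto_intros LIMSEQ_realpow_zero) auto
  then have "\<forall>\<^sub>F K in sequentially. C * sqrt (M * (1 / real q) ^ K) < \<delta>"
    using \<delta> by (intro order_tendstoD) auto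
  then obtain K where K: "C * sqrt (M * (1 / real q) ^ K) < \<delta>"
    using eventually_happens' sequentially_bot by blast
  have "C * sqrt (A K * \<epsilon> K) \<le> C * sqrt (M * (1 / real q) ^ K)"
    using AE[of K] C(1) by (simp add: M_def power_one_over)
  then have "wiener \<omega> (\<lambda>z. F K (z powi int (q ^ j)) * chi K (z powi int (q ^ j))) \<delta>"
    using K by (intro wiener_mono[OF wF[of K]]) linarith
  then show ?thesis using near_F_of_product by blast
qed

text \<open>By self-similarity of \<open>E\<close>, dividing \<open>z powi (-1)\<close> by \<open>F K\<close> and substituting \<open>z ^ (q ^ k)\<close> gives the
  exponents in \<open>{- (q ^ k)..<0}\<close>.\<close>

lemma near_powi: "\<exists>C>0. \<forall>n. near (\<lambda>z. z powi n) (C * pow_weight s n)"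
proof -
  obtain B where B: "B > 0" "\<And>K. (\<lambda>n. norm (coef K n) * (1 + real n) powr s) summable_on UNIV"
    "\<And>K. (\<Sum>\<^sub>\<infinity>n. norm (coef K n) * (1 + real n) powr s) \<le> B"
    by (rule coef_summable_powr[where s = s], rule that) auto
  define C where "C = exp S * real q powr s * B + 1"
  have C1: "C \<ge> 1" using B(1) by (simp add: C_def)
  have "near (\<lambda>z. z powi n) (C * pow_weight s n)" for n
  proof (cases "n \<ge> 0")
    case True
    have "wiener \<omega> (\<lambda>z. 1 * z powi n) (pow_weight s n)"
      using omega_nat[of "nat n"] True by (intro wiener_monom[OF weight]) (simp add: pow_weight_def)
    then have "near (\<lambda>z. z powi n) (pow_weight s n)" using near_of_wiener by simp
    moreover have "pow_weight s n \<le> C * pow_weight s n"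
      using mult_right_mono[OF C1, of "pow_weight s n"] by (simp add: pow_weight_def)
    ultimately show ?thesis by (rule near_mono)
  next
    case False
    define m where "m = nat (- n)"
    have m: "m \<ge> 1" "n = - int m" using False by (auto simp: m_def)
    \<comment> \<open>The least \<open>k\<close> gives \<open>q ^ k \<le> q * m\<close>, so the cost
      \<open>(q ^ k) powr s\<close> is comparable to \<open>(1 + m) powr s\<close>.\<close>
    define k where "k = (LEAST k. m \<le> q ^ k)"
    have "\<exists>k. m \<le> q ^ k"
      using less_exp[of m] q3 power_mono[of 2 q m] by (intro exI[of _ m]) auto
    then have k1: "m \<le> q ^ k" unfolding k_def by (rule LeastI_ex)
    have k2: "q ^ k \<le> q * m"
    proof (cases k)
      case 0
      then show ?thesis using m q3 by simp
    next
      case (Suc i)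
      then have "\<not> m \<le> q ^ i" using not_less_Least[of i "\<lambda>k. m \<le> q ^ k"] by (simp add: k_def)
      then show ?thesis using Suc by simp
    qed
    define r where "r = q ^ k - m"
    have r: "r < q ^ k" "int r - int (q ^ k) = n" using k1 m by (auto simp: r_def of_nat_diff)
    \<comment> \<open>Multiplying by \<open>z powi n / F K 0\<close> costs at most
      \<open>\<omega> n * exp S\<close>; this \<open>\<delta>\<close> reduces the contribution to at
      most \<open>1\<close>. Here \<open>K\<close> depends on \<open>n\<close>, but the final
      constant does not.\<close>
    define \<delta> where "\<delta> = exp (- S) / \<omega> n"
    have \<delta>: "\<delta> > 0" using is_weight_pos[OF weight] by (simp add: \<delta>_def)
    obtain K where K: "near (\<lambda>z. F K (z powi int (q ^ k))) \<delta>" using near_F[OF \<delta>] by blast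
    have Fn: "exp (- S) \<le> norm (F K 0)" "0 < norm (F K 0)" using norm_F_0_ge[of K] by (auto simp: F_def)
    have "wiener \<omega> (\<lambda>z. z powi n - z powi n * (F K (z powi int (q ^ k)) / F K 0)) (exp S * real (q ^ k) powr s * B)"
      using wiener_division[OF weight s0 omega_nat B(2) B(3) r(1)] r(2) by simp
    from near_of_wiener[OF this]
    have 1: "near (\<lambda>z. z powi n - z powi n * (F K (z powi int (q ^ k)) / F K 0)) (exp S * real (q ^ k) powr s * B)" .
    have "wiener \<omega> (\<lambda>z. (1 / F K 0) * z powi n) (\<omega> n / norm (F K 0))"
      by (intro wiener_monom[OF weight]) (simp add: norm_divide)
    from near_mult[OF this K]
    have 2: "near (\<lambda>z. (1 / F K 0) * z powi n * F K (z powi int (q ^ k))) (\<omega> n / norm (F K 0) * \<delta>)" .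
    have 3: "near (\<lambda>z. z powi n) (exp S * real (q ^ k) powr s * B + \<omega> n / norm (F K 0) * \<delta>)"
      using near_add[OF 1 2] by simp
    have "\<omega> n / norm (F K 0) * \<delta> = exp (- S) / norm (F K 0)"
      using is_weight_pos[OF weight, of n] by (simp add: \<delta>_def)
    also have "\<dots> \<le> 1" using Fn by (simp add: divide_le_eq)
    finally have t2: "\<omega> n / norm (F K 0) * \<delta> \<le> 1" .
    define p where "p = pow_weight s n"
    have p1: "1 \<le> p" unfolding p_def by (rule is_weight_ge1[OF weights(3)])
    have "real (q ^ k) \<le> real q * (1 + real m)"
    proof -
      have "real (q ^ k) \<le> real (q * m)" using k2 by (simp only: of_nat_le_iff)
      also have "\<dots> \<le> real q * (1 + real m)" using q_gt by (simp add: distrib_left)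
      finally show ?thesis .
    qed
    then have "real (q ^ k) powr s \<le> (real q * (1 + real m)) powr s" by (intro powr_mono2 s0) auto
    also have "\<dots> = real q powr s * p" by (simp add: powr_mult p_def pow_weight_def m)
    finally have "exp S * real (q ^ k) powr s * B \<le> exp S * (real q powr s * p) * B"
      using B(1) by (intro mult_right_mono mult_left_mono) auto
    then have "exp S * real (q ^ k) powr s * B + \<omega> n / norm (F K 0) * \<delta> \<le> exp S * real q powr s * B * p + 1 * p"
      using t2 p1 by (simp add: mult_ac)
    also have "\<dots> = C * p" by (simp add: C_def distrib_right)
    finally show ?thesis using near_mono[OF 3] by (simp add: p_def)
  qed
  then show ?thesis using C1 by (intro exI[of _ C]) auto
qed

text \<open>\<open>near_powi\<close> is summed over finitely many frequencies; the remaining tail is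
  small for \<open>\<omega>\<close> itself and goes into \<open>\<epsilon>\<close>. So modulo
  \<open>J\<close> the symmetric weight \<open>pow_weight s\<close> controls the algebra.\<close>

lemma near_of_pow_weight:
  obtains C where "C > 0" "\<And>f B D \<epsilon>. wiener \<omega> f B \<Longrightarrow> wiener (pow_weight s) f D \<Longrightarrow> \<epsilon> > 0 \<Longrightarrow> near f (C * D + \<epsilon>)"
proof -
  obtain C where C: "C > 0" "\<And>n. near (\<lambda>z. z powi n) (C * pow_weight s n)" using near_powi by blast
  show thesis
  proof (rule that[OF C(1)])
    fix f B D and \<epsilon> :: real
    assume f: "wiener \<omega> f B" and g: "wiener (pow_weight s) f D" and e: "\<epsilon> > 0"
    obtain I where I: "finite I" "wiener \<omega> (\<lambda>z. f z - (\<Sum>n\<in>I. fourier_coeff f n * z powi n)) \<epsilon>"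
      by (rule wiener_infsum_tail[OF weight f e])
    note gc = wiener_fourier_coeff[OF weights(3) g]
    have "near (\<lambda>z. \<Sum>n\<in>I. fourier_coeff f n * z powi n) (\<Sum>n\<in>I. norm (fourier_coeff f n) * (C * pow_weight s n))"
      by (intro near_sum near_cmult C I)
    moreover have "(\<Sum>n\<in>I. norm (fourier_coeff f n) * (C * pow_weight s n)) \<le> C * D"
    proof -
      have "(\<Sum>n\<in>I. norm (fourier_coeff f n) * (C * pow_weight s n)) = C * (\<Sum>n\<in>I. norm (fourier_coeff f n) * pow_weight s n)"
        by (simp add: sum_distrib_left mult_ac)
      also have "(\<Sum>n\<in>I. norm (fourier_coeff f n) * pow_weight s n) \<le> (\<Sum>\<^sub>\<infinity>n. norm (fourier_coeff f n) * pow_weight s n)"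
        by (rule finite_sum_le_infsum[OF gc(1) I(1)]) (auto simp: pow_weight_def)
      also have "\<dots> \<le> D" by (rule gc(2))
      finally show ?thesis using C(1) by simp
    qed
    ultimately have "near (\<lambda>z. \<Sum>n\<in>I. fourier_coeff f n * z powi n) (C * D)" by (rule near_mono)
    from near_add[OF this near_of_wiener[OF I(2)]] show "near f (C * D + \<epsilon>)" by simp
  qed
qed

end

section \<open>Taylor interpolation at grid points\<close>

definition taylor_exp :: "nat \<Rightarrow> complex \<Rightarrow> complex" where
  "taylor_exp L u = (\<Sum>j<Suc L. u ^ j / fact j)"

lemma exp_minus_taylor_exp: "1 - exp (- u) * taylor_exp L u = exp (- u) * (exp u - (\<Sum>j<Suc L. u ^ j / fact j))"
  by (simp add: taylor_exp_def right_diff_distrib del: sum.lessThan_Suc flip: exp_add)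

lemma wiener_scaled_exp:
  assumes w: "is_weight w" "w 0 = 1" and v: "wiener w v C" and t: "\<bar>\<theta>\<bar> \<le> 1"
  shows "wiener w (\<lambda>z. exp (- (of_real \<theta> * v z))) (exp C)"
proof -
  have C0: "0 \<le> C" by (rule wiener_nonneg[OF w(1) v])
  have "wiener w (\<lambda>z. of_real (- \<theta>) * v z) (norm (of_real (- \<theta>) :: complex) * C)"
    by (rule wiener_cmult[OF w(1) v])
  moreover have "norm (of_real (- \<theta>) :: complex) * C \<le> C"
    using mult_right_mono[OF t C0] by simp
  ultimately have "wiener w (\<lambda>z. of_real (- \<theta>) * v z) C" by (rule wiener_mono)
  from wiener_exp[OF w(1) this] show ?thesis by (simp add: w(2))
qed

text \<open>To be used with \<open>\<theta> = n / N\<close> for \<open>\<bar>n\<bar> < N\<close>.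
  The bracket is \<open>exp (- u)\<close> times the tail of the exponential series at
  \<open>u = \<theta> * v\<close>, hence of order
  \<open>\<bar>\<theta>\<bar> ^ Suc L\<close>.\<close>

lemma wiener_taylor_error:
  assumes w: "is_weight w" "w 0 = 1" and \<phi>: "wiener w \<phi> B" and v: "wiener w v C" and t: "\<bar>\<theta>\<bar> \<le> 1"
  shows "wiener w (\<lambda>z. \<phi> z * (1 - exp (- (of_real \<theta> * v z)) * taylor_exp L (of_real \<theta> * v z)))
           (B * (exp C * (C ^ Suc L * exp C)) * \<bar>\<theta>\<bar> ^ Suc L)"
proof -
  have C0: "0 \<le> C" by (rule wiener_nonneg[OF w(1) v])
  have B0: "0 \<le> B" by (rule wiener_nonneg[OF w(1) \<phi>])
  have "wiener w (\<lambda>z. of_real \<theta> * v z) (\<bar>\<theta>\<bar> * C)"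
    using wiener_cmult[OF w(1) v, of "of_real \<theta>"] by simp
  from wiener_exp_remainder[OF w(1) this, of "Suc L"]
  have "wiener w (\<lambda>z. exp (of_real \<theta> * v z) - (\<Sum>j<Suc L. (of_real \<theta> * v z) ^ j / fact j))
      (exp (\<bar>\<theta>\<bar> * C) - (\<Sum>j<Suc L. (\<bar>\<theta>\<bar> * C) ^ j / fact j))"
    unfolding w(2) mult_1_left .
  moreover have "exp (\<bar>\<theta>\<bar> * C) - (\<Sum>j<Suc L. (\<bar>\<theta>\<bar> * C) ^ j / fact j) \<le> \<bar>\<theta>\<bar> ^ Suc L * (C ^ Suc L * exp C)"
  proof -
    have "exp (\<bar>\<theta>\<bar> * C) - (\<Sum>j<Suc L. (\<bar>\<theta>\<bar> * C) ^ j / fact j) \<le> (\<bar>\<theta>\<bar> * C) ^ Suc L * exp (\<bar>\<theta>\<bar> * C)"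
      using C0 by (intro exp_remainder_nonneg_le) auto
    also have "\<dots> \<le> (\<bar>\<theta>\<bar> * C) ^ Suc L * exp C"
      using mult_right_mono[OF t C0] C0 by (intro mult_left_mono) auto
    finally show ?thesis by (simp only: power_mult_distrib mult.assoc)
  qed
  ultimately have "wiener w (\<lambda>z. exp (of_real \<theta> * v z) - (\<Sum>j<Suc L. (of_real \<theta> * v z) ^ j / fact j))
      (\<bar>\<theta>\<bar> ^ Suc L * (C ^ Suc L * exp C))" by (rule wiener_mono)
  from wiener_mult[OF w(1) \<phi> wiener_mult[OF w(1) wiener_scaled_exp[OF w v t] this]]
  show ?thesis unfolding exp_minus_taylor_exp by (simp only: mult_ac)
qed

text \<open>To be used for frequencies beyond \<open>N\<close>. Only the residue
  \<open>\<theta>\<close> sits in the exponential, while the large quotient \<open>x = n / N\<close>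
  enters a polynomial of degree \<open>L\<close>; so the growth is a power of \<open>x\<close>, not
  exponential.\<close>

lemma wiener_taylor_exp:
  assumes w: "is_weight w" "w 0 = 1" and \<phi>: "wiener w \<phi> B" and v: "wiener w v C"
    and t: "\<bar>\<theta>\<bar> \<le> 1" and x: "1 \<le> \<bar>x\<bar>"
  shows "wiener w (\<lambda>z. \<phi> z * (exp (- (of_real \<theta> * v z)) * taylor_exp L (of_real x * v z)))
           (B * (exp C * exp C) * \<bar>x\<bar> ^ L)"
proof -
  have C0: "0 \<le> C" by (rule wiener_nonneg[OF w(1) v])
  have B0: "0 \<le> B" by (rule wiener_nonneg[OF w(1) \<phi>])
  have "wiener w (\<lambda>z. taylor_exp L (of_real x * v z)) (\<Sum>j<Suc L. \<bar>x\<bar> ^ j / fact j * (1 * C ^ j))"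
    unfolding taylor_exp_def
  proof (rule wiener_sum[OF w(1)])
    fix j assume "j \<in> {..<Suc L}"
    have "wiener w (\<lambda>z. (of_real x ^ j / fact j) * v z ^ j) (norm (of_real x ^ j / fact j :: complex) * (1 * C ^ j))"
      using wiener_cmult[OF w(1) wiener_power[OF w(1) v], of "of_real x ^ j / fact j" j] unfolding w(2) .
    then show "wiener w (\<lambda>z. (of_real x * v z) ^ j / fact j) (\<bar>x\<bar> ^ j / fact j * (1 * C ^ j))"
      by (simp add: power_mult_distrib norm_divide norm_power)
  qed simp
  moreover have "(\<Sum>j<Suc L. \<bar>x\<bar> ^ j / fact j * (1 * C ^ j)) \<le> exp C * \<bar>x\<bar> ^ L"
  proof -
    have "(\<Sum>j<Suc L. \<bar>x\<bar> ^ j / fact j * (1 * C ^ j)) \<le> (\<Sum>j<Suc L. \<bar>x\<bar> ^ L * (C ^ j / fact j))"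
    proof (rule sum_mono)
      fix j assume "j \<in> {..<Suc L}"
      then have "\<bar>x\<bar> ^ j \<le> \<bar>x\<bar> ^ L" using x by (intro power_increasing) auto
      then have "\<bar>x\<bar> ^ j * (C ^ j / fact j) \<le> \<bar>x\<bar> ^ L * (C ^ j / fact j)"
        using C0 by (intro mult_right_mono) auto
      then show "\<bar>x\<bar> ^ j / fact j * (1 * C ^ j) \<le> \<bar>x\<bar> ^ L * (C ^ j / fact j)" by simp
    qed
    also have "\<dots> = \<bar>x\<bar> ^ L * (\<Sum>j<Suc L. C ^ j / fact j)" by (simp only: sum_distrib_left)
    also have "(\<Sum>j<Suc L. C ^ j / fact j) \<le> exp C"
    proof -
      have "(\<lambda>n. C ^ n / fact n) sums exp C"
        using exp_converges[of C] by (simp add: divide_inverse mult.commute)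
      then show ?thesis
        using C0 sum_le_suminf[of "\<lambda>n. C ^ n / fact n" "{..<Suc L}"] by (simp add: sums_iff del: sum.lessThan_Suc)
    qed
    finally show ?thesis using mult_left_mono[of _ _ "\<bar>x\<bar> ^ L"] by (simp add: mult.commute)
  qed
  ultimately have "wiener w (\<lambda>z. taylor_exp L (of_real x * v z)) (exp C * \<bar>x\<bar> ^ L)" by (rule wiener_mono)
  from wiener_mult[OF w(1) \<phi> wiener_mult[OF w(1) wiener_scaled_exp[OF w v t] this]]
  show ?thesis by (simp only: mult_ac)
qed

lemma pow_weight_subst:
  assumes s: "0 \<le> s" and r: "\<bar>r\<bar> < int N"
  shows "pow_weight s (r + n * int N) \<le> real N powr s * pow_weight s n"
proof -
  have "\<bar>r + n * int N\<bar> \<le> \<bar>r\<bar> + \<bar>n\<bar> * int N"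
    using abs_triangle_ineq[of r "n * int N"] by (simp add: abs_mult)
  then have "1 + \<bar>r + n * int N\<bar> \<le> int N * (1 + \<bar>n\<bar>)"
    using r by (simp add: algebra_simps)
  then have "real_of_int (1 + \<bar>r + n * int N\<bar>) \<le> real_of_int (int N * (1 + \<bar>n\<bar>))" by (simp only: of_int_le_iff)
  then have "1 + real_of_int \<bar>r + n * int N\<bar> \<le> real N * (1 + real_of_int \<bar>n\<bar>)" by simp
  then have "(1 + real_of_int \<bar>r + n * int N\<bar>) powr s \<le> (real N * (1 + real_of_int \<bar>n\<bar>)) powr s"
    by (intro powr_mono2 s) auto
  then show ?thesis by (simp add: pow_weight_def powr_mult)
qed

context beurling_cantor
begin

lemma exp_weight_mono: "exp_weight \<gamma> n \<le> 1 * exp_weight \<sigma> n"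
proof (cases "n = 0")
  case False
  then have "1 \<le> real_of_int \<bar>n\<bar>" by linarith
  then have "real_of_int \<bar>n\<bar> powr \<gamma> \<le> real_of_int \<bar>n\<bar> powr \<sigma>" using order by (intro powr_mono) auto
  then show ?thesis by (simp add: exp_weight_def)
qed (simp add: exp_weight_def)

text \<open>A logarithm of \<open>z\<close> on the support of \<open>\<phi>\<close>, where
  \<open>\<tau>\<close> is the angle in turns.\<close>

definition v :: "complex \<Rightarrow> complex" where
  "v z = 2 * pi * \<i> * \<tau> z"

lemma wiener_gamma: "\<exists>C. wiener (exp_weight \<gamma>) \<phi> C" "\<exists>C. wiener (exp_weight \<gamma>) \<tau> C"
  using wiener_weight_mono[OF weights(1,2) wiener_phi exp_weight_mono]
    wiener_weight_mono[OF weights(1,2) wiener_tau exp_weight_mono] by blast+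

lemma wiener_pow: "\<exists>C. wiener (pow_weight s) \<phi> C" "\<exists>C. wiener (pow_weight s) v C"
proof -
  obtain K where K: "\<And>n. \<omega> (0 + n * int 1) \<le> K * exp_weight \<gamma> n" using omega_subst_bounded by blast
  have D: "0 < D\<omega>"
  proof (rule ccontr)
    assume "\<not> 0 < D\<omega>"
    then have "D\<omega> * \<omega> 0 \<le> 0" using is_weight_pos[OF weight, of 0] by (simp add: mult_nonpos_nonneg)
    then show False using omega_ge[of 0] is_weight_ge1[OF weights(3), of 0] by linarith
  qed
  have le: "pow_weight s n \<le> (D\<omega> * K) * exp_weight \<gamma> n" for n
  proof -
    have "\<omega> n \<le> K * exp_weight \<gamma> n" using K[of n] by simp
    then have "D\<omega> * \<omega> n \<le> D\<omega> * (K * exp_weight \<gamma> n)" using D by (intro mult_left_mono) auto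
    then show ?thesis using omega_ge[of n] by (simp add: mult.assoc)
  qed
  obtain C1 C2 where "wiener (exp_weight \<gamma>) \<phi> C1" "wiener (exp_weight \<gamma>) \<tau> C2" using wiener_gamma by blast
  from this[THEN wiener_weight_mono[OF weights(3,1) _ le]]
  have "wiener (pow_weight s) \<phi> (D\<omega> * K * C1)" "wiener (pow_weight s) \<tau> (D\<omega> * K * C2)" by auto
  from this(1) wiener_cmult[OF weights(3) this(2), of "2 * pi * \<i>"]
  show "\<exists>C. wiener (pow_weight s) \<phi> C" "\<exists>C. wiener (pow_weight s) v C" unfolding v_def by blast+
qed

text \<open>In the cell of a root \<open>e\<close>, wherever \<open>\<phi>\<close> does not vanish,
  \<open>z powi n\<close> times the exponential is \<open>e powi n\<close>. So this is
  \<open>\<phi>\<close> times the Taylor polynomial of degree \<open>L\<close> of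
  \<open>z powi n\<close> at \<open>e\<close>, in the angle.\<close>

definition P :: "nat \<Rightarrow> nat \<Rightarrow> int \<Rightarrow> complex \<Rightarrow> complex" where
  "P L N n z = \<phi> (z powi int N) * (z powi n * (exp (- (of_real (of_int n / real N) * v (z powi int N))) *
      taylor_exp L (of_real (of_int n / real N) * v (z powi int N))))"

text \<open>Where \<open>\<phi> (z powi int N)\<close> does not vanish, \<open>exp (v (z powi int N)) = z powi int N\<close>, so that only
  the residue of \<open>n\<close> modulo \<open>N\<close> matters outside the Taylor polynomial.\<close>

lemma P_mod:
  assumes N: "N > 0" and z: "z \<in> unit_circle"
  shows "P L N n z = z powi (n mod int N) * (\<phi> (z powi int N) *
      (exp (- (of_real (of_int (n mod int N) / real N) * v (z powi int N))) *
       taylor_exp L (of_real (of_int n / real N) * v (z powi int N))))"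
proof -
  obtain e t where et: "e ^ N = 1" "e \<in> unit_circle" "\<bar>t\<bar> \<le> 1/2" "z = e * cis (2 * pi * t / real N)"
    by (rule circle_grid[OF z N])
  have zN: "z powi int N = cis (2 * pi * t)" unfolding et(4) power_int_of_nat by (rule grid_power[OF N et(1)])
  show ?thesis
  proof (cases "45/100 \<le> \<bar>t\<bar>")
    case True
    then have "\<phi> (cis (2 * pi * t)) = 0" using plateau et(3) by (simp add: plateau_def)
    then show ?thesis unfolding P_def zN by simp
  next
    case False
    then have "\<tau> (cis (2 * pi * t)) = of_real t" using plateau by (simp add: plateau_def)
    then have v: "v (cis (2 * pi * t)) = 2 * pi * \<i> * of_real t" by (simp add: v_def)
    have nz: "z \<noteq> 0" using z by auto
    define r m where "r = n mod int N" and "m = n div int N"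
    have n: "n = r + int N * m" by (simp add: r_def m_def)
    have ec: "exp (- (of_real x * v (cis (2 * pi * t)))) = cis (- (2 * pi * x * t))" for x :: real
      unfolding v by (simp add: cis_conv_exp mult_ac)
    have "z powi n = z powi r * z powi (int N * m)"
      using nz by (simp add: n power_int_add)
    also have "z powi (int N * m) = (z powi int N) powi m" by (rule power_int_mult)
    also have "(z powi int N) powi m = cis (2 * pi * t * of_int m)"
      unfolding zN cis_power_int by (simp add: mult.commute)
    finally have zn: "z powi n = z powi r * cis (2 * pi * t * of_int m)" .
    have "real_of_int n / real N = of_int r / real N + of_int m" using N by (simp add: n add_divide_distrib)
    then have "- (2 * pi * (real_of_int n / real N) * t) = - (2 * pi * (of_int r / real N) * t) + - (2 * pi * t * of_int m)"
      by (simp add: algebra_simps)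
    then have "z powi n * cis (- (2 * pi * (real_of_int n / real N) * t)) = z powi r * cis (- (2 * pi * (of_int r / real N) * t))"
      unfolding zn by (simp add: cis_mult[symmetric]) (simp add: cis_mult)
    then show ?thesis unfolding P_def zN ec r_def[symmetric] by (simp add: mult.assoc[symmetric])
  qed
qed

text \<open>\<open>real N powr s\<close> is the price of the dilation by \<open>N\<close>. For small
  \<open>n\<close> the Taylor error counts, for large \<open>n\<close> only the size of the
  polynomial.\<close>

lemma wiener_P_errors:
  obtains C where "C > 0"
    and "\<And>N n. \<bar>n\<bar> < int N \<Longrightarrow> wiener (pow_weight s) (\<lambda>z. \<phi> (z powi int N) * z powi n - P L N n z)
           (C * (real N powr s * \<bar>of_int n / real N\<bar> ^ Suc L))"
    and "\<And>N n. N > 0 \<Longrightarrow> int N \<le> \<bar>n\<bar> \<Longrightarrow> wiener (pow_weight s) (P L N n)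
           (C * (real N powr s * \<bar>of_int n / real N\<bar> ^ L))"
proof -
  obtain B C where B: "wiener (pow_weight s) \<phi> B" and C: "wiener (pow_weight s) v C" using wiener_pow by blast
  have w0: "pow_weight s 0 = 1" by (simp add: pow_weight_def)
  have B0: "0 \<le> B" and C0: "0 \<le> C" using wiener_nonneg[OF weights(3)] B C by auto
  define K1 K2 where "K1 = B * (exp C * (C ^ Suc L * exp C))" and "K2 = B * (exp C * exp C)"
  have K: "0 \<le> K1" "0 \<le> K2" using B0 C0 by (auto simp: K1_def K2_def)
  show thesis
  proof (rule that[of "1 + K1 + K2"])
    show "0 < 1 + K1 + K2" using K by linarith
  next
    fix N :: nat and n :: int assume n: "\<bar>n\<bar> < int N"
    define \<theta> where "\<theta> = of_int n / real N"
    have "real_of_int \<bar>n\<bar> \<le> real N" using n by linarith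
    then have t: "\<bar>\<theta>\<bar> \<le> 1" using n by (simp add: \<theta>_def abs_divide divide_le_eq)
    have "wiener (pow_weight s) (\<lambda>z. \<phi> z * (1 - exp (- (of_real \<theta> * v z)) * taylor_exp L (of_real \<theta> * v z))) (K1 * \<bar>\<theta>\<bar> ^ Suc L)"
      unfolding K1_def by (rule wiener_taylor_error[OF weights(3) w0 B C t])
    from wiener_subst[OF weights(3) weights(3) this pow_weight_subst[OF s0 n]]
    have "wiener (pow_weight s) (\<lambda>z. z powi n * (\<phi> (z powi int N) * (1 - exp (- (of_real \<theta> * v (z powi int N))) *
        taylor_exp L (of_real \<theta> * v (z powi int N))))) (real N powr s * (K1 * \<bar>\<theta>\<bar> ^ Suc L))" .
    moreover have "z powi n * (\<phi> (z powi int N) * (1 - exp (- (of_real \<theta> * v (z powi int N))) *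
        taylor_exp L (of_real \<theta> * v (z powi int N)))) = \<phi> (z powi int N) * z powi n - P L N n z" for z
      unfolding P_def \<theta>_def[symmetric] by (simp only: right_diff_distrib mult_1_right mult_1_left mult_ac)
    ultimately have "wiener (pow_weight s) (\<lambda>z. \<phi> (z powi int N) * z powi n - P L N n z) (real N powr s * (K1 * \<bar>\<theta>\<bar> ^ Suc L))"
      by (simp only:)
    moreover have "real N powr s * (K1 * \<bar>\<theta>\<bar> ^ Suc L) \<le> (1 + K1 + K2) * (real N powr s * \<bar>\<theta>\<bar> ^ Suc L)"
    proof -
      have "K1 * (real N powr s * \<bar>\<theta>\<bar> ^ Suc L) \<le> (1 + K1 + K2) * (real N powr s * \<bar>\<theta>\<bar> ^ Suc L)"
        using K by (intro mult_right_mono) auto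
      then show ?thesis by (simp only: mult_ac)
    qed
    ultimately show "wiener (pow_weight s) (\<lambda>z. \<phi> (z powi int N) * z powi n - P L N n z)
        ((1 + K1 + K2) * (real N powr s * \<bar>of_int n / real N\<bar> ^ Suc L))"
      unfolding \<theta>_def by (rule wiener_mono)
  next
    fix N :: nat and n :: int assume N: "N > 0" and n: "int N \<le> \<bar>n\<bar>"
    define x r where "x = of_int n / real N" and "r = n mod int N"
    have "real N \<le> real_of_int \<bar>n\<bar>" using n by linarith
    then have x: "1 \<le> \<bar>x\<bar>" using N by (simp add: x_def abs_divide le_divide_eq)
    have r: "0 \<le> r" "r < int N" using N by (auto simp: r_def)
    then have r': "\<bar>r\<bar> < int N" by simp
    have "real_of_int r \<le> real N" using r by linarith
    then have t: "\<bar>of_int r / real N\<bar> \<le> 1" using r N by (simp add: abs_divide divide_le_eq)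
    have "wiener (pow_weight s) (\<lambda>z. \<phi> z * (exp (- (of_real (of_int r / real N) * v z)) * taylor_exp L (of_real x * v z))) (K2 * \<bar>x\<bar> ^ L)"
      unfolding K2_def by (rule wiener_taylor_exp[OF weights(3) w0 B C t x])
    from wiener_subst[OF weights(3) weights(3) this pow_weight_subst[OF s0 r']]
    have "wiener (pow_weight s) (P L N n) (real N powr s * (K2 * \<bar>x\<bar> ^ L))"
      by (rule wiener_cong) (simp only: P_mod[OF N] r_def x_def)
    moreover have "real N powr s * (K2 * \<bar>x\<bar> ^ L) \<le> (1 + K1 + K2) * (real N powr s * \<bar>x\<bar> ^ L)"
    proof -
      have "K2 * (real N powr s * \<bar>x\<bar> ^ L) \<le> (1 + K1 + K2) * (real N powr s * \<bar>x\<bar> ^ L)"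
        using K by (intro mult_right_mono) auto
      then show ?thesis by (simp only: mult_ac)
    qed
    ultimately show "wiener (pow_weight s) (P L N n) ((1 + K1 + K2) * (real N powr s * \<bar>of_int n / real N\<bar> ^ L))"
      unfolding x_def by (rule wiener_mono)
  qed
qed

end

section \<open>Interpolating functions that vanish on the Cantor set\<close>

context beurling_cantor
begin

text \<open>Since \<open>E\<close> is perfect, a function of the algebra that vanishes on \<open>E\<close> vanishes there with
  its derivatives along the circle, up to the order \<open>s\<close>.\<close>

lemma derivatives_vanish:
  assumes c: "(\<lambda>n. norm (c n) * pow_weight s n) summable_on UNIV"
    and f: "\<And>z. z \<in> E \<Longrightarrow> (\<Sum>\<^sub>\<infinity>n. c n * z powi n) = 0"
  shows "real l \<le> s \<Longrightarrow> z \<in> E \<Longrightarrow> (\<Sum>\<^sub>\<infinity>n. c n * of_int n ^ l * z powi n) = 0"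
proof (induction l arbitrary: z)
  case 0
  then show ?case using f by simp
next
  case (Suc l)
  have ls: "real l \<le> s" using Suc.prems by simp
  have sm: "(\<lambda>n. norm (c n) * \<bar>of_int n\<bar> ^ k) summable_on UNIV" if k: "real k \<le> s" for k
  proof (rule summable_on_comparison_test[OF c])
    fix n :: int
    have "\<bar>real_of_int n\<bar> ^ k \<le> (1 + real_of_int \<bar>n\<bar>) ^ k" by (intro power_mono) auto
    also have "\<dots> = (1 + real_of_int \<bar>n\<bar>) powr real k" by (simp add: powr_realpow)
    also have "\<dots> \<le> pow_weight s n" unfolding pow_weight_def using k by (intro powr_mono) auto
    finally show "norm (c n) * \<bar>of_int n\<bar> ^ k \<le> norm (c n) * pow_weight s n" by (intro mult_left_mono) auto
  qed auto
  have zc: "z \<in> unit_circle" using Suc.prems E_circle by blast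
  obtain h :: "nat \<Rightarrow> real" where h: "\<And>j. h j \<noteq> 0" "\<And>j. z * cis (h j) \<in> E" "h \<longlonglongrightarrow> 0"
    by (rule E_perfect[OF Suc.prems(2)], rule that) auto
  have ac: "(\<lambda>n. c n * of_int n ^ l * y powi n) summable_on UNIV" if "y \<in> unit_circle" for y
    by (rule abs_summable_summable)
       (use sm[OF ls] norm_powi_unit[OF that] in \<open>simp add: norm_mult norm_power\<close>)
  \<comment> \<open>Difference quotients in the angle along points of \<open>E\<close> tending to
    \<open>z\<close>. They are dominated by \<open>\<bar>n\<bar> ^ Suc l\<close>, summable against
    the coefficients because \<open>Suc l \<le> s\<close>.\<close>
  define T where "T j n = c n * of_int n ^ l * z powi n * ((cis (of_int n * h j) - 1) / of_real (h j))" for j n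
  have T0: "(\<Sum>\<^sub>\<infinity>n. T j n) = 0" for j
  proof -
    have zh: "z * cis (h j) \<in> unit_circle" using h(2) E_circle by blast
    have "((\<lambda>n. (c n * of_int n ^ l * (z * cis (h j)) powi n + (-1) * (c n * of_int n ^ l * z powi n)) * inverse (of_real (h j)))
        has_sum (0 + (-1) * 0) * inverse (of_real (h j))) UNIV"
    proof (intro has_sum_cmult_left has_sum_cmult_right has_sum_add)
      show "((\<lambda>n. c n * of_int n ^ l * (z * cis (h j)) powi n) has_sum 0) UNIV"
        using has_sum_infsum[OF ac[OF zh]] Suc.IH[OF ls h(2)] by simp
      show "((\<lambda>n. c n * of_int n ^ l * z powi n) has_sum 0) UNIV"
        using has_sum_infsum[OF ac[OF zc]] Suc.IH[OF ls Suc.prems(2)] by simp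
    qed
    moreover have "(c n * of_int n ^ l * (z * cis (h j)) powi n + (-1) * (c n * of_int n ^ l * z powi n)) * inverse (of_real (h j)) = T j n" for n
      unfolding T_def power_int_mult_distrib cis_power_int by (simp add: divide_inverse algebra_simps)
    ultimately have "((\<lambda>n. T j n) has_sum (0 + (-1) * 0) * inverse (of_real (h j))) UNIV" by (simp only:)
    then show ?thesis using infsumI by fastforce
  qed
  have "(\<lambda>j. \<Sum>\<^sub>\<infinity>n. T j n) \<longlonglongrightarrow> (\<Sum>\<^sub>\<infinity>n. c n * of_int n ^ l * z powi n * (\<i> * of_int n))"
  proof (rule tendsto_infsum_dominated[OF _ _ sm[OF Suc.prems(1)]])
    fix n :: int
    have "((\<lambda>w. exp (\<i> * of_int n * w)) has_field_derivative \<i> * of_int n) (at 0)"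
      by (auto intro!: derivative_eq_intros)
    then have "((\<lambda>w. (exp (\<i> * of_int n * w) - 1) / w) \<longlongrightarrow> \<i> * of_int n) (at 0)"
      by (simp add: has_field_derivative_iff)
    moreover have "filterlim (\<lambda>j. complex_of_real (h j)) (at 0) sequentially"
      using tendsto_of_real[OF h(3)] h(1) by (auto simp: filterlim_at intro!: always_eventually)
    ultimately have "(\<lambda>j. (exp (\<i> * of_int n * of_real (h j)) - 1) / of_real (h j)) \<longlonglongrightarrow> \<i> * of_int n"
      by (rule filterlim_compose)
    moreover have "exp (\<i> * of_int n * of_real (h j)) = cis (of_int n * h j)" for j
      by (simp add: cis_conv_exp mult.assoc)
    ultimately have "(\<lambda>j. (cis (of_int n * h j) - 1) / of_real (h j)) \<longlonglongrightarrow> \<i> * of_int n" by simp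
    then show "(\<lambda>j. T j n) \<longlonglongrightarrow> c n * of_int n ^ l * z powi n * (\<i> * of_int n)"
      unfolding T_def by (intro tendsto_mult tendsto_const)
  next
    fix j n
    have "norm ((cis (of_int n * h j) - 1) / of_real (h j)) \<le> \<bar>of_int n * h j\<bar> / \<bar>h j\<bar>"
      using norm_cis_minus_1[of "of_int n * h j"] by (simp add: norm_divide divide_right_mono)
    also have "\<dots> = \<bar>of_int n\<bar>" using h(1)[of j] by (simp add: abs_mult)
    finally have "norm (c n * of_int n ^ l * z powi n) * norm ((cis (of_int n * h j) - 1) / of_real (h j))
        \<le> (norm (c n) * \<bar>of_int n\<bar> ^ l) * \<bar>of_int n\<bar>"
      using norm_powi_unit[OF zc] by (intro mult_mono) (auto simp: norm_mult norm_power)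
    then show "norm (T j n) \<le> norm (c n) * \<bar>of_int n\<bar> ^ Suc l"
      unfolding T_def norm_mult[of _ "(cis (of_int n * h j) - 1) / of_real (h j)"] by (simp only: power_Suc mult_ac)
  qed
  then have "(\<Sum>\<^sub>\<infinity>n. c n * of_int n ^ l * z powi n * (\<i> * of_int n)) = 0"
    unfolding T0 by (simp add: LIMSEQ_const_iff)
  moreover have "c n * of_int n ^ l * z powi n * (\<i> * of_int n) = \<i> * (c n * of_int n ^ Suc l * z powi n)" for n
    by (simp add: mult_ac)
  ultimately have "\<i> * (\<Sum>\<^sub>\<infinity>n. c n * of_int n ^ Suc l * z powi n) = 0"
    by (simp only: infsum_cmult_right')
  then show ?case by simp
qed

text \<open>The inner series is, up to the factor \<open>\<i> ^ l\<close>, the \<open>l\<close>-th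
  angular derivative at \<open>e\<close> of the function with coefficients \<open>c\<close>. This
  finite patchwork of Taylor polynomials at the \<open>N\<close>-th roots of unity lies in the
  algebra, and vanishing derivatives can be inserted directly.\<close>

definition interp :: "nat \<Rightarrow> nat \<Rightarrow> (int \<Rightarrow> complex) \<Rightarrow> complex \<Rightarrow> complex" where
  "interp L N c z = (\<Sum>e | e ^ N = 1. \<Sum>l<Suc L.
      ((2 * pi * \<i> / of_nat N) ^ l / fact l * (\<Sum>\<^sub>\<infinity>n. c n * of_int n ^ l * e powi n)) *
      (\<tau> (z powi int N) ^ l * b N e z))"

lemma wiener_interp:
  assumes "N > 0"
  shows "\<exists>C. wiener \<omega> (interp L N c) C"
proof -
  have fin: "finite {e::complex. e ^ N = 1}" using assms by (intro finite_roots_unity) auto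
  obtain K where K: "\<And>n. \<omega> (0 + n * int 1) \<le> K * exp_weight \<gamma> n" using omega_subst_bounded by blast
  then have K': "\<omega> n \<le> K * exp_weight \<gamma> n" for n using K[of n] by simp
  obtain Ct where "wiener (exp_weight \<gamma>) \<tau> Ct" using wiener_gamma(2) by blast
  then obtain C1 where C1: "wiener \<omega> (\<lambda>z. \<tau> (z powi int N)) C1" using wiener_omega_subst by blast
  have g0: "0 < \<gamma>" using order by linarith
  define C2 where "C2 = K * (exp (2 * real N powr (\<gamma> * \<sigma> / (\<sigma> - \<gamma>))) * (B\<phi> * exp (2 * pi * B\<tau>)))"
  have C2: "wiener \<omega> (b N e) C2" if e: "e ^ N = 1" for e
  proof -
    have "norm e = 1" using power_eq_1_iff[OF e] assms by auto
    then have "e \<in> unit_circle" by simp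
    then show ?thesis
      unfolding C2_def
      by (intro wiener_weight_mono[OF weight weights(1) _ K'] wiener_bump[OF g0 order(3,4) wiener_phi wiener_tau assms])
  qed
  define M where "M e l = (2 * pi * \<i> / of_nat N) ^ l / fact l * (\<Sum>\<^sub>\<infinity>n. c n * of_int n ^ l * e powi n)" for e l
  have "wiener \<omega> (\<lambda>z. M e l * (\<tau> (z powi int N) ^ l * b N e z)) (norm (M e l) * (\<omega> 0 * C1 ^ l * C2))"
    if "e ^ N = 1" for e l
    by (intro wiener_cmult wiener_mult wiener_power weight C1 C2 that)
  then have "wiener \<omega> (\<lambda>z. \<Sum>l<Suc L. M e l * (\<tau> (z powi int N) ^ l * b N e z)) (\<Sum>l<Suc L. norm (M e l) * (\<omega> 0 * C1 ^ l * C2))"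
    if "e ^ N = 1" for e
    using that by (intro wiener_sum[OF weight]) auto
  then have "wiener \<omega> (\<lambda>z. \<Sum>e | e ^ N = 1. \<Sum>l<Suc L. M e l * (\<tau> (z powi int N) ^ l * b N e z))
      (\<Sum>e | e ^ N = 1. \<Sum>l<Suc L. norm (M e l) * (\<omega> 0 * C1 ^ l * C2))"
    by (intro wiener_sum[OF weight fin]) simp
  then show ?thesis unfolding interp_def[abs_def] M_def by blast
qed

lemma interp_value:
  assumes N: "N > 0" and e: "e ^ N = 1" "e \<in> unit_circle" and t: "\<bar>t\<bar> \<le> 1/2"
  shows "interp L N c (e * cis (2 * pi * t / real N)) =
    \<phi> (cis (2 * pi * t)) * (\<Sum>l<Suc L. (2 * pi * \<i> * of_real t / of_nat N) ^ l / fact l * (\<Sum>\<^sub>\<infinity>n. c n * of_int n ^ l * e powi n))"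
proof -
  define z where "z = e * cis (2 * pi * t / real N)"
  have fin: "finite {e::complex. e ^ N = 1}" using N by (intro finite_roots_unity) auto
  have zN: "z powi int N = cis (2 * pi * t)" unfolding z_def power_int_of_nat by (rule grid_power[OF N e(1)])
  have b: "b N e' z = (if e' = e then \<phi> (cis (2 * pi * t)) else 0)" if e': "e' ^ N = 1" for e'
  proof -
    have "norm e' = 1" using power_eq_1_iff[OF e'] N by auto
    then show ?thesis unfolding z_def using bump_value[OF plateau N e' _ e t] by simp
  qed
  define M where "M e' l = (2 * pi * \<i> / of_nat N) ^ l / fact l * (\<Sum>\<^sub>\<infinity>n. c n * of_int n ^ l * e' powi n)" for e' l
  have "interp L N c z = (\<Sum>e' | e' ^ N = 1. \<Sum>l<Suc L. M e' l * (\<tau> (cis (2 * pi * t)) ^ l * b N e' z))"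
    unfolding interp_def M_def zN ..
  also have "\<dots> = (\<Sum>e' | e' ^ N = 1. if e' = e then \<Sum>l<Suc L. M e' l * (\<tau> (cis (2 * pi * t)) ^ l * \<phi> (cis (2 * pi * t))) else 0)"
    by (rule sum.cong[OF refl]) (auto simp: b simp del: sum.lessThan_Suc)
  also have "\<dots> = (\<Sum>l<Suc L. M e l * (\<tau> (cis (2 * pi * t)) ^ l * \<phi> (cis (2 * pi * t))))"
    using fin e(1) by (simp add: sum.delta del: sum.lessThan_Suc)
  also have "\<dots> = (\<Sum>l<Suc L. \<phi> (cis (2 * pi * t)) * ((2 * pi * \<i> * of_real t / of_nat N) ^ l / fact l * (\<Sum>\<^sub>\<infinity>n. c n * of_int n ^ l * e powi n)))"
  proof (rule sum.cong[OF refl])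
    fix l
    show "M e l * (\<tau> (cis (2 * pi * t)) ^ l * \<phi> (cis (2 * pi * t))) =
      \<phi> (cis (2 * pi * t)) * ((2 * pi * \<i> * of_real t / of_nat N) ^ l / fact l * (\<Sum>\<^sub>\<infinity>n. c n * of_int n ^ l * e powi n))"
    proof (cases "45/100 \<le> \<bar>t\<bar>")
      case True
      then have "\<phi> (cis (2 * pi * t)) = 0" using plateau t by (simp add: plateau_def)
      then show ?thesis by simp
    next
      case False
      then have "\<tau> (cis (2 * pi * t)) = of_real t" using plateau by (simp add: plateau_def)
      then show ?thesis unfolding M_def by (simp add: power_mult_distrib power_divide)
    qed
  qed
  also have "\<dots> = \<phi> (cis (2 * pi * t)) * (\<Sum>l<Suc L. (2 * pi * \<i> * of_real t / of_nat N) ^ l / fact l * (\<Sum>\<^sub>\<infinity>n. c n * of_int n ^ l * e powi n))"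
    by (simp only: sum_distrib_left)
  finally show ?thesis by (simp only: z_def)
qed

text \<open>The Taylor polynomial is linear in the function: exchanging it with the series over
  \<open>n\<close> turns the patchwork into the sum of the \<open>P L N n\<close>.
  \<open>L \<le> s\<close> makes the derivative series converge.\<close>

lemma has_sum_interp:
  assumes N: "N > 0" and z: "z \<in> unit_circle" and L: "real L \<le> s"
    and c: "(\<lambda>n. norm (c n) * pow_weight s n) summable_on UNIV"
  shows "((\<lambda>n. c n * P L N n z) has_sum interp L N c z) UNIV"
proof -
  obtain e t where et: "e ^ N = 1" "e \<in> unit_circle" "\<bar>t\<bar> \<le> 1/2" "z = e * cis (2 * pi * t / real N)"
    by (rule circle_grid[OF z N])
  have zN: "z powi int N = cis (2 * pi * t)" unfolding et(4) power_int_of_nat by (rule grid_power[OF N et(1)])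
  have hs: "((\<lambda>n. c n * of_int n ^ l * e powi n) has_sum (\<Sum>\<^sub>\<infinity>n. c n * of_int n ^ l * e powi n)) UNIV" if l: "l \<le> L" for l
  proof (rule has_sum_infsum, rule abs_summable_summable, rule summable_on_comparison_test[OF c])
    fix n :: int
    have "\<bar>real_of_int n\<bar> ^ l \<le> (1 + real_of_int \<bar>n\<bar>) ^ l" by (intro power_mono) auto
    also have "\<dots> = (1 + real_of_int \<bar>n\<bar>) powr real l" by (simp add: powr_realpow)
    also have "\<dots> \<le> pow_weight s n" unfolding pow_weight_def using l L by (intro powr_mono) auto
    finally show "norm (c n * of_int n ^ l * e powi n) \<le> norm (c n) * pow_weight s n"
      using norm_powi_unit[OF et(2)] by (simp add: norm_mult norm_power mult_left_mono)
  qed simp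
  have Pn: "P L N n z = \<phi> (cis (2 * pi * t)) * (e powi n * taylor_exp L (2 * pi * \<i> * of_real t / of_nat N * of_int n))" for n
  proof (cases "45/100 \<le> \<bar>t\<bar>")
    case True
    then have "\<phi> (cis (2 * pi * t)) = 0" using plateau et(3) by (simp add: plateau_def)
    then show ?thesis unfolding P_def zN by simp
  next
    case False
    then have "\<tau> (cis (2 * pi * t)) = of_real t" using plateau by (simp add: plateau_def)
    then have v: "of_real (of_int n / real N) * v (cis (2 * pi * t)) = 2 * pi * \<i> * of_real t / of_nat N * of_int n"
      by (simp add: v_def)
    have ec: "exp (- (2 * pi * \<i> * of_real t / of_nat N * of_int n)) = cis (- (of_int n * (2 * pi * t / real N)))"
      by (simp add: cis_conv_exp mult_ac)
    have "z powi n = e powi n * cis (of_int n * (2 * pi * t / real N))"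
      unfolding et(4) by (simp only: power_int_mult_distrib cis_power_int)
    then have "z powi n * cis (- (of_int n * (2 * pi * t / real N))) = e powi n"
      by (simp only: mult.assoc cis_mult) simp
    then show ?thesis unfolding P_def zN v ec by (simp only: mult.assoc[symmetric])
  qed
  have "((\<lambda>n. \<Sum>l<Suc L. (2 * pi * \<i> * of_real t / of_nat N) ^ l / fact l * (c n * of_int n ^ l * e powi n)) has_sum
      (\<Sum>l<Suc L. (2 * pi * \<i> * of_real t / of_nat N) ^ l / fact l * (\<Sum>\<^sub>\<infinity>n. c n * of_int n ^ l * e powi n))) UNIV"
  proof -
    have "((\<lambda>n. \<Sum>l<K. (2 * pi * \<i> * of_real t / of_nat N) ^ l / fact l * (c n * of_int n ^ l * e powi n)) has_sum
      (\<Sum>l<K. (2 * pi * \<i> * of_real t / of_nat N) ^ l / fact l * (\<Sum>\<^sub>\<infinity>n. c n * of_int n ^ l * e powi n))) UNIV"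
      if "K \<le> Suc L" for K
      using that
    proof (induction K)
      case (Suc K)
      then show ?case unfolding sum.lessThan_Suc by (intro has_sum_add has_sum_cmult_right hs) auto
    qed simp
    then show ?thesis by blast
  qed
  from has_sum_cmult_right[OF this, of "\<phi> (cis (2 * pi * t))"]
  have "((\<lambda>n. \<phi> (cis (2 * pi * t)) * (\<Sum>l<Suc L. (2 * pi * \<i> * of_real t / of_nat N) ^ l / fact l * (c n * of_int n ^ l * e powi n)))
      has_sum interp L N c z) UNIV"
    unfolding et(4) interp_value[OF N et(1-3)] .
  moreover have "\<phi> (cis (2 * pi * t)) * (\<Sum>l<Suc L. (2 * pi * \<i> * of_real t / of_nat N) ^ l / fact l * (c n * of_int n ^ l * e powi n))
      = c n * P L N n z" for n
    unfolding Pn taylor_exp_def sum_distrib_left power_mult_distrib by (intro sum.cong refl) (simp add: mult_ac)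
  ultimately show ?thesis by simp
qed

end

context beurling_cantor
begin

text \<open>Near \<open>E\<close> the interpolation uses only derivatives at points of
  \<open>E\<close>, which vanish. The error for \<open>pow_weight s\<close> tends to
  \<open>0\<close> by dominated convergence, and modulo \<open>J\<close> this norm is
  enough.\<close>

lemma near_of_vanishing:
  assumes f: "wiener \<omega> f B" and f0: "\<And>z. z \<in> E \<Longrightarrow> f z = 0" and \<epsilon>: "\<epsilon> > 0"
  shows "near f \<epsilon>"
proof -
  define c where "c = fourier_coeff f"
  note fc = wiener_fourier_coeff[OF weight f, folded c_def]
  have fp: "wiener (pow_weight s) f (D\<omega> * B)" by (rule wiener_weight_mono[OF weights(3) weight f omega_ge])
  note fpc = wiener_fourier_coeff[OF weights(3) fp, folded c_def]
  have cs: "(\<lambda>n. norm (c n) * pow_weight s n) summable_on UNIV" by (rule fpc(1))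
  define L where "L = nat \<lfloor>s\<rfloor>"
  have L: "real L \<le> s" "s < real L + 1" using s0 by (auto simp: L_def)
  have van: "(\<Sum>\<^sub>\<infinity>n. c n * of_int n ^ l * z powi n) = 0" if "l \<le> L" "z \<in> E" for l z
  proof (rule derivatives_vanish[OF cs])
    show "(\<Sum>\<^sub>\<infinity>n. c n * z powi n) = 0" if "z \<in> E" for z
      using infsumI[OF fc(3)[of z]] f0[OF that] E_circle that by auto
  qed (use that L in auto)
  obtain C where C: "C > 0"
    "\<And>N n. \<bar>n\<bar> < int N \<Longrightarrow> wiener (pow_weight s) (\<lambda>z. \<phi> (z powi int N) * z powi n - P L N n z)
           (C * (real N powr s * \<bar>of_int n / real N\<bar> ^ Suc L))"
    "\<And>N n. N > 0 \<Longrightarrow> int N \<le> \<bar>n\<bar> \<Longrightarrow> wiener (pow_weight s) (P L N n)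
           (C * (real N powr s * \<bar>of_int n / real N\<bar> ^ L))"
    by (rule wiener_P_errors[where L = L], rule that) auto
  obtain C' where C': "C' > 0" "\<And>f B D \<epsilon>. wiener \<omega> f B \<Longrightarrow> wiener (pow_weight s) f D \<Longrightarrow> \<epsilon> > 0 \<Longrightarrow> near f (C' * D + \<epsilon>)"
    by (rule near_of_pow_weight, rule that) auto
  \<comment> \<open>Bounds for the \<open>n\<close>-th term of \<open>f - g\<close>: the Taylor
    error below \<open>N\<close>, the power and its polynomial separately beyond.\<close>
  define bd where "bd N n = (if \<bar>n\<bar> < int N then C * (real N powr s * \<bar>of_int n / real N\<bar> ^ Suc L)
      else pow_weight s n + C * (real N powr s * \<bar>of_int n / real N\<bar> ^ L))" for N :: nat and n :: int
  have bd0: "0 \<le> bd N n" for N n using C(1) by (simp add: bd_def pow_weight_def)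
  \<comment> \<open>Here \<open>L \<le> s < L + 1\<close> is decisive:
    \<open>x ^ Suc L \<le> x powr s\<close> for \<open>x \<le> 1\<close> and
    \<open>x ^ L \<le> x powr s\<close> for \<open>x \<ge> 1\<close>, while
    \<open>real N powr s * x powr s = \<bar>n\<bar> powr s\<close>, a majorant free of
    \<open>N\<close>.\<close>
  have bd_le: "bd N n \<le> (1 + C) * pow_weight s n" if N: "N > 0" for N n
  proof -
    define x where "x = \<bar>of_int n / real N\<bar>"
    have x0: "0 \<le> x" by (simp add: x_def)
    have xs: "real N powr s * x powr s \<le> pow_weight s n"
    proof -
      have "real N powr s * x powr s = (real N * x) powr s" using x0 by (simp add: powr_mult)
      also have "real N * x = \<bar>of_int n\<bar>" using N by (simp add: x_def abs_divide)
      also have "\<bar>real_of_int n\<bar> powr s \<le> pow_weight s n" unfolding pow_weight_def by (intro powr_mono2 s0) auto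
      finally show ?thesis .
    qed
    have p0: "0 \<le> pow_weight s n" by (simp add: pow_weight_def)
    show ?thesis
    proof (cases "\<bar>n\<bar> < int N")
      case True
      have "x ^ Suc L \<le> x powr s"
      proof (cases "x = 0")
        case False
        have "real_of_int \<bar>n\<bar> \<le> real N" using True by linarith
        then have "x \<le> 1" using N by (simp add: x_def abs_divide divide_le_eq)
        then have "x powr real (Suc L) \<le> x powr s" using L x0 by (intro powr_mono') auto
        then show ?thesis using x0 False by (subst (asm) powr_realpow) auto
      qed simp
      then have "real N powr s * x ^ Suc L \<le> pow_weight s n"
        using mult_left_mono[of "x ^ Suc L" "x powr s" "real N powr s"] xs by simp
      then have "C * (real N powr s * x ^ Suc L) \<le> C * pow_weight s n" using C(1) by (intro mult_left_mono) auto
      moreover have "bd N n = C * (real N powr s * x ^ Suc L)" using True by (simp add: bd_def x_def)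
      ultimately show ?thesis using p0 by (simp add: distrib_right)
    next
      case False
      have "real N \<le> real_of_int \<bar>n\<bar>" using False by linarith
      then have x1: "1 \<le> x" using N by (simp add: x_def abs_divide le_divide_eq)
      then have "x powr real L \<le> x powr s" using L by (intro powr_mono) auto
      then have "x ^ L \<le> x powr s" using x1 by (subst (asm) powr_realpow) auto
      then have "real N powr s * x ^ L \<le> pow_weight s n"
        using mult_left_mono[of "x ^ L" "x powr s" "real N powr s"] xs by simp
      then have "C * (real N powr s * x ^ L) \<le> C * pow_weight s n" using C(1) by (intro mult_left_mono) auto
      moreover have "bd N n = pow_weight s n + C * (real N powr s * x ^ L)" using False by (simp add: bd_def x_def)
      ultimately show ?thesis by (simp add: distrib_right)
    qed
  qed
  have qk: "q ^ k > 0" for k using q3 by simp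
  \<comment> \<open>Once \<open>q ^ k > \<bar>n\<bar>\<close> the bound is a constant times a
    negative power of \<open>q ^ k\<close>, of exponent \<open>s - real (Suc L)\<close>.\<close>
  have lim0: "(\<lambda>k. bd (q ^ k) n) \<longlonglongrightarrow> 0" for n
  proof -
    have sl: "s - real (Suc L) < 0" using L by simp
    have "filterlim (\<lambda>k. real q ^ k) at_top sequentially"
    proof (rule filterlim_at_top_mono[OF filterlim_real_sequentially], rule always_eventually, rule allI)
      fix k
      have "real k \<le> 2 ^ k" using of_nat_less_two_power[of k] by (simp add: less_imp_le)
      also have "\<dots> \<le> real q ^ k" using q3 by (intro power_mono) auto
      finally show "real k \<le> real q ^ k" .
    qed
    then have "(\<lambda>k. (real q ^ k) powr (s - real (Suc L))) \<longlonglongrightarrow> 0"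
      by (rule tendsto_neg_powr[OF sl])
    then have "(\<lambda>k. C * \<bar>of_int n\<bar> ^ Suc L * (real q ^ k) powr (s - real (Suc L))) \<longlonglongrightarrow> C * \<bar>of_int n\<bar> ^ Suc L * 0"
      by (intro tendsto_mult tendsto_const)
    moreover have "\<forall>\<^sub>F k in sequentially. C * \<bar>of_int n\<bar> ^ Suc L * (real q ^ k) powr (s - real (Suc L)) = bd (q ^ k) n"
      using eventually_gt_at_top[of "nat \<bar>n\<bar>"]
    proof eventually_elim
      case (elim k)
      have "2 ^ k \<le> q ^ k" using q3 by (intro power_mono) auto
      then have "k < q ^ k" using less_exp[of k] by (rule order_less_le_trans[rotated])
      then have "int k < int (q ^ k)" by (simp only: of_nat_less_iff)
      then have "\<bar>n\<bar> < int (q ^ k)" using elim by linarith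
      then have "bd (q ^ k) n = C * (real (q ^ k) powr s * \<bar>of_int n / real (q ^ k)\<bar> ^ Suc L)" by (simp add: bd_def)
      also have "\<bar>of_int n / real (q ^ k)\<bar> ^ Suc L = \<bar>of_int n\<bar> ^ Suc L / (real q ^ k) ^ Suc L"
        by (simp add: abs_divide power_divide)
      also have "(real q ^ k) ^ Suc L = (real q ^ k) powr real (Suc L)"
        using q_gt by (intro powr_realpow[symmetric]) auto
      finally show ?case by (simp add: powr_diff)
    qed
    ultimately show ?thesis by (simp add: Lim_transform_eventually)
  qed
  have lim: "(\<lambda>k. \<Sum>\<^sub>\<infinity>n. norm (c n) * bd (q ^ k) n) \<longlonglongrightarrow> (\<Sum>\<^sub>\<infinity>n::int. 0::real)"
  proof (rule tendsto_infsum_dominated)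
    show "(\<lambda>k. norm (c n) * bd (q ^ k) n) \<longlonglongrightarrow> 0" for n
      using tendsto_mult[OF tendsto_const[of "norm (c n)"] lim0[of n]] by simp
    show "norm (norm (c n) * bd (q ^ k) n) \<le> (1 + C) * (norm (c n) * pow_weight s n)" for k n
      using mult_left_mono[OF bd_le[OF qk[of k], of n], of "norm (c n)"] bd0 by (simp add: abs_mult mult_ac)
    show "(\<lambda>n. (1 + C) * (norm (c n) * pow_weight s n)) summable_on UNIV" by (intro summable_on_cmult_right cs)
  qed
  define \<delta> where "\<delta> = \<epsilon> / (2 * C')"
  have \<delta>: "\<delta> > 0" using \<epsilon> C'(1) by (simp add: \<delta>_def)
  have "\<forall>\<^sub>F k in sequentially. (\<Sum>\<^sub>\<infinity>n. norm (c n) * bd (q ^ k) n) < \<delta>"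
    using order_tendstoD(2)[OF lim, of \<delta>] \<delta> by simp
  then obtain k where k: "(\<Sum>\<^sub>\<infinity>n. norm (c n) * bd (q ^ k) n) < \<delta>"
    using eventually_happens' sequentially_bot by blast
  define N where "N = q ^ k"
  have N: "N > 0" using qk by (simp add: N_def)
  define I where "I = {n::int. \<bar>n\<bar> < int N}"
  have "I = {- int N<..<int N}" by (auto simp: I_def)
  then have fin: "finite I" by simp
  \<comment> \<open>Away from the roots of unity a partial sum of \<open>f\<close>, near them its
    Taylor polynomials. Near \<open>E\<close> the factor \<open>1 - \<phi>\<close> and the
    interpolation both vanish.\<close>
  define g where "g z = (1 - \<phi> (z powi int N)) * (\<Sum>n\<in>I. c n * z powi n) + interp L N c z" for z
  obtain Cg where g: "wiener \<omega> g Cg"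
  proof -
    obtain C1 where C1: "wiener (exp_weight \<gamma>) \<phi> C1" using wiener_gamma(1) by blast
    obtain C2 where C2: "wiener \<omega> (\<lambda>z. \<phi> (z powi int N)) C2" using wiener_omega_subst[OF C1] by blast
    obtain C3 where C3: "wiener \<omega> (interp L N c) C3" using wiener_interp[OF N] by blast
    have "wiener \<omega> (\<lambda>z. \<Sum>n\<in>I. c n * z powi n) (\<Sum>n\<in>I. norm (c n) * \<omega> n)"
      by (intro wiener_sum[OF weight fin] wiener_monom[OF weight]) simp
    from wiener_add[OF weight wiener_mult[OF weight wiener_diff[OF weight wiener_const[OF weight order_refl, of 1] C2] this] C3]
    show thesis using that unfolding g_def[abs_def] by blast
  qed
  have gV: "\<exists>V. openin (top_of_set unit_circle) V \<and> E \<subseteq> V \<and> (\<forall>z\<in>V. g z = 0)"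
  proof (rule vanishing_near_E[where k = k])
    fix e :: complex and t :: real assume e: "e \<in> G k" and t: "\<bar>t\<bar> \<le> 2/5"
    have eN: "e ^ N = 1" "e \<in> unit_circle" "e \<in> E"
      using G_root[OF e] G_circle[OF e] G_subset_E e by (auto simp: N_def)
    have t2: "\<bar>t\<bar> \<le> 1/2" using t by simp
    have "(e * cis (2 * pi * t / real N)) powi int N = cis (2 * pi * t)"
      unfolding power_int_of_nat by (rule grid_power[OF N eN(1)])
    moreover have "\<phi> (cis (2 * pi * t)) = 1" using plateau t by (simp add: plateau_def)
    moreover have "interp L N c (e * cis (2 * pi * t / real N)) = 0"
      unfolding interp_value[OF N eN(1,2) t2] using van eN(3) by (simp del: sum.lessThan_Suc add: less_Suc_eq_le)
    ultimately show "g (e * cis (2 * pi * t / real (q ^ k))) = 0"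
      unfolding g_def N_def[symmetric] by simp
  qed
  have fg: "wiener (pow_weight s) (\<lambda>z. f z - g z) (\<Sum>\<^sub>\<infinity>n. norm (c n) * bd N n)"
  proof (rule wiener_infsum[OF weights(3), where I = UNIV])
    define Q where "Q n z = (if n \<in> I then \<phi> (z powi int N) * z powi n - P L N n z else z powi n - P L N n z)" for n z
    show "wiener (pow_weight s) (\<lambda>z. c n * Q n z) (norm (c n) * bd N n)" for n
    proof (rule wiener_cmult[OF weights(3)])
      show "wiener (pow_weight s) (\<lambda>z. Q n z) (bd N n)"
      proof (cases "\<bar>n\<bar> < int N")
        case True
        then show ?thesis using C(2)[OF True] by (simp add: Q_def I_def bd_def)
      next
        case False
        have "wiener (pow_weight s) (\<lambda>z. 1 * z powi n) (pow_weight s n)" by (intro wiener_monom[OF weights(3)]) simp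
        from wiener_diff[OF weights(3) this C(3)[OF N]] False show ?thesis by (simp add: Q_def I_def bd_def)
      qed
    qed
    have "(\<lambda>n. norm (c n) * bd N n) summable_on UNIV"
    proof (rule summable_on_comparison_test[OF summable_on_cmult_right[OF cs, of "1 + C"]])
      show "norm (c n) * bd N n \<le> (1 + C) * (norm (c n) * pow_weight s n)" for n
        using mult_left_mono[OF bd_le[OF N, of n], of "norm (c n)"] by (simp add: mult_ac)
    qed (use bd0 in auto)
    then show "((\<lambda>n. norm (c n) * bd N n) has_sum (\<Sum>\<^sub>\<infinity>n. norm (c n) * bd N n)) UNIV" by (rule has_sum_infsum)
    fix z :: complex assume z: "z \<in> unit_circle"
    have 1: "((\<lambda>n. c n * z powi n) has_sum f z) UNIV" by (rule fc(3)[OF z])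
    have 2: "((\<lambda>n. c n * P L N n z) has_sum interp L N c z) UNIV" by (rule has_sum_interp[OF N z L(1) cs])
    have "((\<lambda>n. (1 - \<phi> (z powi int N)) * (c n * z powi n)) has_sum (\<Sum>n\<in>I. (1 - \<phi> (z powi int N)) * (c n * z powi n))) I"
      by (rule has_sum_finite[OF fin])
    then have 3: "((\<lambda>n. if n \<in> I then (1 - \<phi> (z powi int N)) * (c n * z powi n) else 0) has_sum
        (1 - \<phi> (z powi int N)) * (\<Sum>n\<in>I. c n * z powi n)) UNIV"
      unfolding sum_distrib_left by (rule has_sum_cong_neutral[THEN iffD1, rotated -1]) auto
    have "((\<lambda>n. c n * z powi n + (-1) * ((if n \<in> I then (1 - \<phi> (z powi int N)) * (c n * z powi n) else 0) + c n * P L N n z))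
        has_sum f z + (-1) * ((1 - \<phi> (z powi int N)) * (\<Sum>n\<in>I. c n * z powi n) + interp L N c z)) UNIV"
      by (intro has_sum_add has_sum_cmult_right 1 2 3)
    moreover have "c n * z powi n + (-1) * ((if n \<in> I then (1 - \<phi> (z powi int N)) * (c n * z powi n) else 0) + c n * P L N n z) = c n * Q n z" for n
      by (simp add: Q_def algebra_simps)
    moreover have "f z + (-1) * ((1 - \<phi> (z powi int N)) * (\<Sum>n\<in>I. c n * z powi n) + interp L N c z) = f z - g z"
      by (simp add: g_def)
    ultimately show "((\<lambda>n. c n * Q n z) has_sum f z - g z) UNIV" by (simp only:)
  qed
  then have "wiener (pow_weight s) (\<lambda>z. f z - g z) \<delta>" by (rule wiener_mono) (use k in \<open>simp add: N_def\<close>)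
  moreover have "wiener \<omega> (\<lambda>z. f z - g z) (B + Cg)" by (intro wiener_diff weight f g)
  ultimately have "near (\<lambda>z. f z - g z) (C' * \<delta> + \<epsilon> / 2)" by (intro C') (use \<epsilon> in auto)
  moreover have "C' * \<delta> + \<epsilon> / 2 = \<epsilon>" using C'(1) by (simp add: \<delta>_def)
  ultimately have n1: "near (\<lambda>z. f z - g z) \<epsilon>" by simp
  \<comment> \<open>\<open>g\<close> vanishes near \<open>E\<close> and represents itself.\<close>
  have "near g 0"
    unfolding near_def
    by (intro exI[of _ g] conjI gV exI[of _ Cg] g) (use wiener_const[OF weight, of 0 0] in simp)
  from near_add[OF n1 this] show ?thesis by simp
qed

lemma spectral_synthesis_E: "spectral_synthesis \<omega> E"
  unfolding spectral_synthesis_def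
proof (intro subset_antisym subsetI)
  fix f assume f: "f \<in> ideal_I \<omega> E"
  then have fA: "f \<in> beurling_algebra \<omega>" and f0: "\<And>z. z \<in> E \<Longrightarrow> f z = 0" by (auto simp: ideal_I_def)
  note fw = wiener_beurling_norm[OF weight fA]
  have "\<exists>g\<in>vanishing_near \<omega> E. beurling_norm \<omega> (\<lambda>z. f z - g z) < \<epsilon>" if \<epsilon>: "\<epsilon> > 0" for \<epsilon>
  proof -
    have "near f (\<epsilon> / 2)" by (rule near_of_vanishing[OF fw f0]) (use \<epsilon> in auto)
    then obtain g V C where g: "wiener \<omega> g C" "openin (top_of_set unit_circle) V" "E \<subseteq> V" "\<forall>z\<in>V. g z = 0"
        "wiener \<omega> (\<lambda>z. f z - g z) (\<epsilon> / 2)"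
      unfolding near_def by blast
    have "g \<in> vanishing_near \<omega> E"
      unfolding vanishing_near_def beurling_algebra_iff_wiener[OF weight] using g by blast
    moreover have "beurling_norm \<omega> (\<lambda>z. f z - g z) < \<epsilon>"
      using beurling_norm_le[OF weight g(5)] \<epsilon> by simp
    ultimately show ?thesis by blast
  qed
  then show "f \<in> ideal_J \<omega> E" using fA by (simp add: ideal_J_def)
next
  \<comment> \<open>The norm dominates the supremum on the circle, so vanishing on \<open>E\<close>
    passes to the closure.\<close>
  fix f assume f: "f \<in> ideal_J \<omega> E"
  then have fA: "f \<in> beurling_algebra \<omega>" by (simp add: ideal_J_def)
  have "f z = 0" if z: "z \<in> E" for z
  proof -
    have zc: "z \<in> unit_circle" using z E_circle by blast
    have "norm (f z) \<le> \<epsilon>" if \<epsilon>: "\<epsilon> > 0" for \<epsilon>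
    proof -
      obtain g where g: "g \<in> vanishing_near \<omega> E" "beurling_norm \<omega> (\<lambda>z. f z - g z) < \<epsilon>"
        using f \<epsilon> unfolding ideal_J_def by blast
      have gz: "g z = 0" and gA: "g \<in> beurling_algebra \<omega>" using g(1) z by (auto simp: vanishing_near_def)
      have "(\<lambda>z. f z - g z) \<in> beurling_algebra \<omega>"
        unfolding beurling_algebra_iff_wiener[OF weight]
        using wiener_diff[OF weight wiener_beurling_norm[OF weight fA] wiener_beurling_norm[OF weight gA]] by blast
      from wiener_norm_le[OF weight wiener_beurling_norm[OF weight this] zc]
      show ?thesis using g(2) gz by simp
    qed
    then have "norm (f z) \<le> 0" by (meson dense_ge)
    then show ?thesis by simp
  qed
  then show "f \<in> ideal_I \<omega> E" using fA by (simp add: ideal_I_def)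
qed

end

section \<open>Choice of the exponents\<close>

theorem theorem3p6:
  fixes s :: real and q :: nat and \<omega> :: "int \<Rightarrow> real"
  assumes "s \<ge> 0"
    and "q \<ge> 3"
    and "is_weight \<omega>"
    and "\<And>n::nat. \<omega> (int n) = (1 + real n) powr s"
    and "\<exists>c>0. \<forall>n::nat. \<omega> (- int n) \<ge> c * (1 + real n) powr s"
    and "\<exists>\<beta><cantor_b (1 / real q).
           (\<lambda>n::nat. \<omega> (- int n)) \<in> O(\<lambda>n. exp (real n powr \<beta>))"
  shows "spectral_synthesis \<omega> (cantor_set (1 / real q))"
proof -
  \<comment> \<open>One minus the dimension of \<open>E\<close>. Then
    \<open>cantor_b (1 / q) = d / (1 + d)\<close>, and an exponent \<open>\<gamma>\<close> lies
    below it just when \<open>\<gamma> / (1 - \<gamma>) < d\<close>.\<close>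
  define d where "d = 1 - ln 2 / ln (real q)"
  have lq: "0 < ln (2::real)" "ln 2 < ln (real q)" using assms(2) by auto
  have lq0: "0 < ln (real q)" using lq by linarith
  have d: "0 < d" "d < 1" using lq lq0 by (simp_all add: d_def divide_less_eq)
  define bq where "bq = d / (1 + d)"
  have bd: "cantor_b (1 / real q) = bq"
  proof -
    have "cantor_b (1 / real q) = (ln (real q) - ln 2) / (2 * ln (real q) - ln 2)"
      using assms(2) by (simp add: cantor_b_def ln_div)
    also have "\<dots> = d / (1 + d)" using lq lq0 by (simp add: d_def field_simps)
    finally show ?thesis by (simp only: bq_def)
  qed
  obtain \<beta>0 where \<beta>0: "\<beta>0 < bq" "(\<lambda>n::nat. \<omega> (- int n)) \<in> O(\<lambda>n. exp (real n powr \<beta>0))"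
    using assms(6) bd by auto
  \<comment> \<open>The given exponent may be nonpositive; enlarging it keeps it below
    \<open>bq\<close> and makes it positive.\<close>
  define \<beta> where "\<beta> = max \<beta>0 (bq / 2)"
  have b0: "0 < bq" "bq < 1" using d by (simp_all add: bq_def)
  have \<beta>: "0 < \<beta>" "\<beta> < bq" "\<beta>0 \<le> \<beta>" using \<beta>0(1) b0 by (simp_all add: \<beta>_def less_max_iff_disj)
  define \<gamma> where "\<gamma> = (\<beta> + bq) / 2"
  have \<gamma>: "\<beta> < \<gamma>" "\<gamma> < bq" "0 < \<gamma>" using \<beta> by (auto simp: \<gamma>_def)
  have \<gamma>1: "\<gamma> < 1" using \<gamma>(2) b0 by linarith
  have g1: "\<gamma> / (1 - \<gamma>) < d"
  proof -
    have "\<gamma> * (1 + d) < d" using \<gamma>(2) d by (simp add: bq_def less_divide_eq)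
    then show ?thesis using \<gamma>1 by (simp add: divide_less_eq algebra_simps)
  qed
  obtain a' where a'1: "\<gamma> / (1 - \<gamma>) < a'" "a' < d" using dense[OF g1] by blast
  obtain a where a: "a' < a" "a < d" using dense[OF a'1(2)] by blast
  note a' = a'1(1) a
  have ga: "\<gamma> < a'" 
  proof -
    have "\<gamma> * (1 - \<gamma>) \<le> \<gamma> * 1" using \<gamma> \<gamma>1 by (intro mult_left_mono) auto
    then have "\<gamma> \<le> \<gamma> / (1 - \<gamma>)" using \<gamma>1 by (simp add: le_divide_eq)
    then show ?thesis using a'(1) by linarith
  qed
  \<comment> \<open>The solution of \<open>\<gamma> * \<sigma> / (\<sigma> - \<gamma>) = a'\<close>.
    It is less than \<open>1\<close> because \<open>\<gamma> / (1 - \<gamma>) < a'\<close>, and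
    \<open>a' < a\<close> then provides the strict gap \<open>a_gt\<close>.\<close>
  define \<sigma> where "\<sigma> = \<gamma> * a' / (a' - \<gamma>)"
  have \<sigma>1: "\<sigma> < 1"
  proof -
    have "\<gamma> < a' * (1 - \<gamma>)" using a'(1) \<gamma>1 by (simp add: divide_less_eq)
    then show ?thesis using ga by (simp add: \<sigma>_def divide_less_eq algebra_simps)
  qed
  have \<sigma>\<gamma>: "\<sigma> - \<gamma> = \<gamma> * \<gamma> / (a' - \<gamma>)" using ga by (simp add: \<sigma>_def field_simps)
  have \<gamma>\<sigma>: "\<gamma> < \<sigma>" using \<sigma>\<gamma> \<gamma> ga by (smt (verit) divide_pos_pos mult_pos_pos)
  have a_eq: "\<gamma> * \<sigma> / (\<sigma> - \<gamma>) = a'"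
    unfolding \<sigma>\<gamma> using \<gamma> ga by (simp add: \<sigma>_def field_simps)
  have a1: "2 * real q powr (a - 1) < 1"
  proof -
    have "(a - 1) * ln (real q) < (d - 1) * ln (real q)" using a'(3) lq0 by (intro mult_strict_right_mono) auto
    also have "\<dots> = - ln 2" using lq0 by (simp add: d_def)
    finally have "exp ((a - 1) * ln (real q)) < exp (- ln 2)" by simp
    then show ?thesis using assms(2) by (simp add: powr_def exp_minus)
  qed
  obtain \<phi> \<tau> B C where pl: "plateau \<phi> \<tau>" "wiener (exp_weight \<sigma>) \<phi> B" "wiener (exp_weight \<sigma>) \<tau> C"
    using ex_plateau[of \<sigma>] \<gamma>\<sigma> \<gamma> \<sigma>1 by auto
  obtain c where c: "c > 0" "\<And>n::nat. c * (1 + real n) powr s \<le> \<omega> (- int n)" using assms(5) by blast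
  have ge: "pow_weight s n \<le> max 1 (1 / c) * \<omega> n" for n
  proof (cases n rule: int_cases2)
    case (nonneg m)
    have "1 * \<omega> (int m) \<le> max 1 (1 / c) * \<omega> (int m)"
      using is_weight_pos[OF assms(3)] by (intro mult_right_mono) (auto intro: less_imp_le)
    then show ?thesis using nonneg assms(4) by (simp add: pow_weight_def)
  next
    case (nonpos m)
    have "pow_weight s n = (1 / c) * (c * (1 + real m) powr s)" using nonpos c(1) by (simp add: pow_weight_def)
    also have "\<dots> \<le> (1 / c) * \<omega> n" using c nonpos by (intro mult_left_mono) auto
    also have "\<dots> \<le> max 1 (1 / c) * \<omega> n" using is_weight_pos[OF assms(3)] by (intro mult_right_mono) (auto intro: less_imp_le)
    finally show ?thesis .
  qed
  obtain K where K: "\<And>n. \<omega> n \<le> K * exp_weight \<beta> n"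
  proof -
    obtain K1 where K1: "K1 > 0" "\<And>y. 0 < y \<Longrightarrow> y powr s * exp (- (1 * y powr \<beta>)) \<le> K1"
      by (rule powr_times_exp_bounded[of \<beta> 1 s], use \<beta> assms(1) in auto)
    have \<beta>1: "\<beta> \<le> 1" using \<gamma>(1) \<gamma>1 by linarith
    have pos: "\<omega> (int m) \<le> K1 * exp 1 * exp (real m powr \<beta>)" for m
    proof -
      have "(1 + real m) powr \<beta> \<le> 1 powr \<beta> + real m powr \<beta>" using \<beta> \<beta>1 by (intro powr_subadditive) auto
      then have *: "exp ((1 + real m) powr \<beta>) \<le> exp 1 * exp (real m powr \<beta>)" by (simp flip: exp_add)
      have "(1 + real m) powr s \<le> K1 * exp ((1 + real m) powr \<beta>)"
        using K1(2)[of "1 + real m"] by (simp add: exp_minus field_simps)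
      also have "\<dots> \<le> K1 * (exp 1 * exp (real m powr \<beta>))" using * K1(1) by (intro mult_left_mono) auto
      finally show ?thesis by (simp add: assms(4))
    qed
    obtain K2 where K2: "K2 > 0" "\<forall>\<^sub>F n in sequentially. norm (\<omega> (- int n)) \<le> K2 * norm (exp (real n powr \<beta>0))"
      using landau_o.bigE[OF \<beta>0(2)] by blast
    then obtain n0 where "\<forall>n\<ge>n0. norm (\<omega> (- int n)) \<le> K2 * norm (exp (real n powr \<beta>0))"
      unfolding eventually_sequentially by blast
    then have n0: "\<omega> (- int n) \<le> K2 * exp (real n powr \<beta>0)" if "n0 \<le> n" for n
      using that by (auto intro: order_trans[OF abs_ge_self])
    define K3 where "K3 = K2 + (\<Sum>n<n0. \<omega> (- int n))"
    have neg: "\<omega> (- int m) \<le> K3 * exp (real m powr \<beta>)" for m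
    proof -
      have s0: "0 \<le> (\<Sum>n<n0. \<omega> (- int n))" by (intro sum_nonneg) (use is_weight_pos[OF assms(3)] in \<open>auto intro: less_imp_le\<close>)
      have e1: "1 \<le> exp (real m powr \<beta>)" by simp
      show ?thesis
      proof (cases "m < n0")
        case True
        have "\<omega> (- int m) \<le> (\<Sum>n<n0. \<omega> (- int n))"
          using True is_weight_pos[OF assms(3)] by (intro member_le_sum[where f = "\<lambda>n. \<omega> (- int n)"]) (auto intro: less_imp_le)
        also have "\<dots> \<le> K3" using K2(1) by (simp add: K3_def)
        also have "\<dots> \<le> K3 * exp (real m powr \<beta>)"
          using mult_left_mono[OF e1, of K3] s0 K2(1) by (simp add: K3_def)
        finally show ?thesis .
      next
        case False
        \<comment> \<open>For \<open>m = 0\<close> both powers are \<open>0\<close> by convention,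
          even when \<open>\<beta>0\<close> is not positive.\<close>
        have "real m powr \<beta>0 \<le> real m powr \<beta>"
        proof (cases "m = 0")
          case False
          then show ?thesis using \<beta>(3) by (intro powr_mono) auto
        qed simp
        then have "K2 * exp (real m powr \<beta>0) \<le> K2 * exp (real m powr \<beta>)"
          using K2(1) by (intro mult_left_mono) auto
        then have "\<omega> (- int m) \<le> K2 * exp (real m powr \<beta>)"
          using n0[of m] False by linarith
        also have "\<dots> \<le> K3 * exp (real m powr \<beta>)"
          using s0 K2(1) by (intro mult_right_mono) (auto simp: K3_def)
        finally show ?thesis .
      qed
    qed
    show thesis
    proof (rule that)
      fix n :: int
      have "\<omega> n \<le> max (K1 * exp 1) K3 * exp (real_of_int \<bar>n\<bar> powr \<beta>)"
      proof (cases n rule: int_cases2)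
        case (nonneg m)
        have "K1 * exp 1 * exp (real m powr \<beta>) \<le> max (K1 * exp 1) K3 * exp (real m powr \<beta>)" by (intro mult_right_mono) auto
        with pos[of m] have "\<omega> (int m) \<le> max (K1 * exp 1) K3 * exp (real m powr \<beta>)" by linarith
        then show ?thesis using nonneg by simp
      next
        case (nonpos m)
        have "K3 * exp (real m powr \<beta>) \<le> max (K1 * exp 1) K3 * exp (real m powr \<beta>)" by (intro mult_right_mono) auto
        with neg[of m] have "\<omega> (- int m) \<le> max (K1 * exp 1) K3 * exp (real m powr \<beta>)" by linarith
        then show ?thesis using nonpos by simp
      qed
      then show "\<omega> n \<le> max (K1 * exp 1) K3 * exp_weight \<beta> n" by (simp add: exp_weight_def)
    qed
  qed
  have a0: "0 < a" using a'(2) ga \<gamma>(3) by linarith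
  interpret beurling_cantor q a \<omega> s \<beta> \<gamma> \<sigma> K "max 1 (1 / c)" \<phi> \<tau> B C
    by unfold_locales
       (use assms(1-4) a0 a1 ge K \<beta>(1) \<gamma>(1) \<gamma>\<sigma> \<sigma>1 a_eq a'(2) pl in auto)
  show ?thesis by (rule spectral_synthesis_E)
qed

end
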